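(* Let $p\in\mathbb{C}$ with $|p|<1$, let $n$ be a nonnegative integer, and let $v,w,q,t,x_1,\dots,x_n\in\mathbb{C}^{\ast}$ be such that both sides below are well defined. Then $$ \sum_{r=0}^n \frac{(v,w)_r}{(qv/t,qw/t)_r} \sum_{\substack{I\subseteq [n] \\ |I|=r}} \prod_{i\in I} \frac{q\,\theta(vx_i/tw)\,\theta(tq^{-r}x_i/qw)} {t\,\theta(vx_i/qw)\,\theta(q^{-r}x_i/w)} \prod_{j\notin I} \frac{\theta(x_j/q)\,\theta(q^{-r}x_j/tw)} {\theta(x_j/t)\,\theta(q^{-r}x_j/qw)} \prod_{\substack{i\in I \\ j\notin I}} \frac{\theta(t x_i/qx_j)\,\theta(q x_i/x_j)} {\theta(x_i/x_j)\,\theta(tx_i/x_j)} $$ $$ =\sum_{r=0}^n \frac{(v,w)_r}{(qv/t,qw/t)_r} \sum_{\substack{I\subseteq [n] \\ |I|=r}} \prod_{i\in I} \frac{q\,\theta(x_i/q)\,\theta(q^rvx_i/t^2)} {t\,\theta(x_i/t)\,\theta(q^rvx_i/tq)} \prod_{j\notin I} \frac{\theta(vx_j/tw)\,\theta(q^rvx_j/q)} {\theta(vx_j/qw)\,\theta(q^rvx_j/t)} \prod_{\substack{i\in I \\ j\notin I}} \frac{\theta(t x_j/q x_i)\,\theta(q x_j/x_i)} {\theta(x_j/x_i)\,\theta(t x_j/x_i)}. $$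
   Context: For $|p|<1$ and $x\in\mathbb{C}^{\ast}$, $\theta(x)=\theta(x;p)=\prod_{k=0}^{\infty}(1-xp^k)(1-x^{-1}p^{k+1})$ (with $\theta(x;0)=1-x$). The theta shifted factorial is $(a)_r=(a;q,p)_r=\prod_{k=0}^{r-1}\theta(aq^k;p)$ for $r\ge 0$, and $(a_1,\dots,a_k)_r=(a_1)_r\cdots(a_k)_r$. Also $[n]=\{1,2,\dots,n\}$, and $j\notin I$ means $j\in[n]\setminus I$. In fractions inside arguments, everything after the slash is in the denominator: e.g. $vx_i/tw=vx_i/(tw)$, $tq^{-r}x_i/qw=tq^{-r}x_i/(qw)$, $tx_i/qx_j=tx_i/(qx_j)$, $q^rvx_i/tq=q^rvx_i/(tq)$. *)

theory Defs
  imports "HOL-Analysis.Analysis"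
begin

definition theta :: "complex \<Rightarrow> complex \<Rightarrow> complex" where
  "theta p x = (\<Prod>k. (1 - x * p ^ k) * (1 - inverse x * p ^ (k + 1)))"

text \<open>
  The infinite product operator is total. The following two facts confirm that it has its intended
  meaning for \<open>norm p < 1\<close>, and that the convention \<open>\<theta>(x;0) = 1 - x\<close> is covered by \<open>0 ^ 0 = 1\<close>.
\<close>

lemma theta_convergent:
  fixes p x :: complex
  assumes "norm p < 1"
  shows "convergent_prod (\<lambda>k. (1 - x * p ^ k) * (1 - inverse x * p ^ (k + 1)))"
proof -
  have *: "convergent_prod (\<lambda>k. 1 - c * p ^ k)" for c :: complex
  proof -
    have "summable (\<lambda>k. norm ((1 - c * p ^ k) - 1))"
      using assms by (simp add: norm_mult norm_power summable_mult summable_geometric)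
    then show ?thesis
      by (intro abs_convergent_prod_imp_convergent_prod summable_imp_abs_convergent_prod)
  qed
  show ?thesis
    using convergent_prod_mult[OF *[of x] *[of "inverse x * p"]]
    by (simp add: mult.assoc)
qed

lemma theta_0: "theta 0 x = 1 - x"
proof -
  have "theta 0 x = (\<Prod>k\<in>{0::nat}. (1 - x * 0 ^ k) * (1 - inverse x * 0 ^ (k + 1)))"
    unfolding theta_def by (rule prodinf_finite) auto
  then show ?thesis by simp
qed

text \<open>\<open>(a)\<^sub>r = (a;q,p)\<^sub>r\<close> and, for a list of parameters, \<open>(a\<^sub>1,\<dots>,a\<^sub>k)\<^sub>r\<close>.\<close>

definition theta_fact :: "complex \<Rightarrow> complex \<Rightarrow> complex \<Rightarrow> nat \<Rightarrow> complex" where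
  "theta_fact q p a r = (\<Prod>k<r. theta p (a * q ^ k))"

definition theta_facts :: "complex \<Rightarrow> complex \<Rightarrow> complex list \<Rightarrow> nat \<Rightarrow> complex" where
  "theta_facts q p as r = (\<Prod>a\<leftarrow>as. theta_fact q p a r)"

end

theory Submission
  imports Defs "HOL-Complex_Analysis.Complex_Analysis"
begin

text \<open>
  Put \<open>y\<^sub>i = tqw / (v x\<^sub>i)\<close> and
  \<open>\<phi>(z) = \<theta>(z/q) \<theta>(vz/tw) / (\<theta>(z/t) \<theta>(vz/qw))\<close>. Since \<open>\<phi>(y\<^sub>i) = \<phi>(x\<^sub>i)\<close>,
  the left side equals \<open>F(x) \<Prod> \<phi>(x\<^sub>i)\<close> and the right side equals \<open>F(y) \<Prod> \<phi>(x\<^sub>i)\<close> for one and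
  the same function \<open>F\<close>, so the claim is \<open>D(x) = F(x) - F(y) = 0\<close>.

  For multiplicatively independent parameters and \<open>p \<noteq> 0\<close>, argue by induction on \<open>n\<close>.
  As a function of one variable \<open>z = x\<^sub>a\<close>, \<open>D\<close> is invariant under \<open>z \<mapsto> pz\<close> and has at most
  simple poles, and all residues vanish. For \<open>F\<close> alone the terms cancel in pairs at \<open>z = x\<^sub>j\<close> and at
  \<open>z = q\<^sup>s w\<close>; at \<open>z = q\<close> and \<open>z = tw/v\<close> the residue is a multiple of an instance of \<open>F\<close> with \<open>n - 1\<close>
  variables, and at \<open>z = t x\<^sub>j\<close> and \<open>z = x\<^sub>j / t\<close> of an instance with \<open>n - 2\<close> variables, so that
  the induction hypothesis makes the residues of \<open>F(x)\<close> and \<open>F(y)\<close> agree. Hence \<open>D\<close> does not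
  depend on \<open>x\<^sub>a\<close>, for every \<open>a\<close>. Replacing the \<open>x\<^sub>i\<close> by \<open>y\<^sub>i\<close> one after the other therefore does not
  change \<open>D\<close>, but \<open>D(y) = - D(x)\<close>.

  The remaining parameters, and \<open>p = 0\<close>, are limits of independent ones.
\<close>

subsection \<open>Theta functions\<close>

text \<open>The equality phi(y) = phi(x) holds because inversion of theta exchanges the two factors
  in the numerator of phi, and likewise the two in its denominator. The induction closes because the
  reflection x -> tqw/(vx) is compatible with the parameter changes made by the residues. For
  parameters (qv, w) the reflection of x/q is (tw/v) / (x/q) = tqw/(vx), which is y again, and
  passing to (qv, qw) leaves tqw/v unchanged. So the residues of F(x) and F(y) involve the two
  members of one smaller instance. The obstacle is that poles may coincide and cease to be simple.
  Zeros of theta are powers of \<open>p\<close>, so poles stay apart when the parameters are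
  independent modulo powers of \<open>p\<close>. This independence survives every substitution of
  the induction, whereas the hypotheses of the theorem do not exclude coincidences. The argument by
  periodicity also needs a nonzero \<open>p\<close>. This is why continuity of theta is established
  jointly in \<open>p\<close> and the argument, including at \<open>p = 0\<close>.\<close>

definition qpoch_inf :: "complex \<Rightarrow> complex \<Rightarrow> complex" where
  "qpoch_inf p c = (\<Prod>k. 1 - c * p ^ k)"

lemma qpoch_inf_convergent:
  fixes p c :: complex
  assumes "norm p < 1"
  shows "convergent_prod (\<lambda>k. 1 - c * p ^ k)"
proof -
  have "summable (\<lambda>k. norm ((1 - c * p ^ k) - 1))"
    using assms by (simp add: norm_mult norm_power summable_mult summable_geometric)
  then show ?thesis
    by (intro abs_convergent_prod_imp_convergent_prod summable_imp_abs_convergent_prod)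
qed

lemma qpoch_inf_shift:
  assumes "norm p < 1"
  shows "qpoch_inf p c = (1 - c) * qpoch_inf p (c * p)"
proof -
  have "(\<lambda>k. 1 - c * p * p ^ k) has_prod qpoch_inf p (c * p)"
    unfolding qpoch_inf_def
    using qpoch_inf_convergent[OF assms, of "c * p"] by (rule convergent_prod_has_prod)
  then have "(\<lambda>k. 1 - c * p ^ Suc k) has_prod qpoch_inf p (c * p)"
    by (simp add: mult.assoc)
  then have "(\<lambda>k. 1 - c * p ^ k) has_prod (qpoch_inf p (c * p) * (1 - c * p ^ 0))"
    by (rule has_prod_Suc_imp)
  then show ?thesis
    using has_prod_unique[of "\<lambda>k. 1 - c * p ^ k"] by (simp add: qpoch_inf_def[of p c] mult.commute)
qed

lemma qpoch_inf_eq_0D: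
  assumes "norm p < 1" "qpoch_inf p c = 0"
  shows "\<exists>k. c * p ^ k = 1"
  using prodinf_nonzero[OF qpoch_inf_convergent[OF assms(1), of c]] assms(2)
  unfolding qpoch_inf_def by force

text \<open>The classical form (x;p)_infinity (p/x;p)_infinity. It reduces continuity and holomorphy
  of theta to one function that is entire in its argument, and separates the two families of
  zeros.\<close>

lemma theta_eq_qpoch_inf:
  assumes "norm p < 1"
  shows "theta p x = qpoch_inf p x * qpoch_inf p (p / x)"
  using prodinf_mult[OF qpoch_inf_convergent[OF assms, of x] qpoch_inf_convergent[OF assms, of "p / x"]]
  by (simp add: theta_def qpoch_inf_def divide_inverse mult_ac)

lemma theta_eq_one_minus_mult:
  assumes "norm p < 1"
  shows "theta p x = (1 - x) * (qpoch_inf p (x * p) * qpoch_inf p (p / x))"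
  using qpoch_inf_shift[OF assms, of x] by (simp add: theta_eq_qpoch_inf[OF assms])

text \<open>With the factor k = 0 split off, theta(x) and theta(1/x) share the remaining products
  and differ only in 1 - x against 1 - 1/x.\<close>

lemma theta_inverse:
  assumes "norm p < 1" "x \<noteq> 0"
  shows "theta p (1 / x) = - (1 / x) * theta p x"
  using assms qpoch_inf_shift[OF assms(1), of "1 / x"]
  by (simp add: theta_eq_one_minus_mult theta_eq_qpoch_inf field_simps)

lemma theta_mult_p:
  assumes "norm p < 1" "p \<noteq> 0" "x \<noteq> 0"
  shows "theta p (p * x) = - (1 / x) * theta p x"
proof -
  \<comment> \<open>The arguments of the two products become px and 1/x, which are those belonging
    to 1/x in exchanged order.\<close>
  have "theta p (p * x) = theta p (1 / x)"
    using assms by (simp add: theta_eq_qpoch_inf field_simps)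
  then show ?thesis
    using theta_inverse[OF assms(1,3)] by simp
qed

text \<open>This turns every non-vanishing requirement into the statement that some monomial is not
  a power of \<open>p\<close>.\<close>

lemma theta_eq_0D:
  assumes "norm p < 1" "p \<noteq> 0" "x \<noteq> 0" "theta p x = 0"
  shows "\<exists>m. x = p powi m"
proof -
  have "qpoch_inf p x = 0 \<or> qpoch_inf p (p / x) = 0"
    using assms by (simp add: theta_eq_qpoch_inf)
  then consider k where "x * p ^ k = 1" | k where "p / x * p ^ k = 1"
    using qpoch_inf_eq_0D[OF assms(1)] by blast
  then show ?thesis
  proof cases
    case 1
    then have "x = p powi (- int k)"
      using assms by (simp add: power_int_minus field_simps)
    then show ?thesis ..
  next
    case 2
    then have "x = p powi (int (Suc k))"
      using assms by (simp add: power_int_add field_simps)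
    then show ?thesis ..
  qed
qed

section \<open>Continuity jointly in nome and argument, and holomorphy\<close>

lemma qpoch_inf_uniform_limit:
  fixes r M :: real
  assumes "r < 1"
  defines "S \<equiv> cball 0 r \<times> cball 0 M"
  shows "uniform_limit S (\<lambda>N z. \<Prod>k<N. 1 - snd z * fst z ^ k) (\<lambda>z. qpoch_inf (fst z) (snd z)) sequentially"
proof -
  have "uniformly_convergent_on S (\<lambda>N z. \<Sum>k<N. norm ((1 - snd z * fst z ^ k) - 1 :: complex))"
  \<comment> \<open>A negative radius makes \<open>S\<close> empty; otherwise M r^k is a summable
    majorant for all pairs in \<open>S\<close>.\<close>
  proof (cases "r < 0 \<or> M < 0")
    case False
    show ?thesis
    proof (rule Weierstrass_m_test')
      show "norm (norm ((1 - snd z * fst z ^ k) - 1)) \<le> M * r ^ k" if "z \<in> S" for z :: "complex \<times> complex" and k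
        using that False by (auto simp: S_def norm_mult norm_power intro!: mult_mono power_mono)
      show "summable (\<lambda>k. M * r ^ k)"
        using assms(1) False by (intro summable_mult summable_geometric) auto
    qed
  qed (auto simp: S_def uniformly_convergent_on_empty)
  then have "uniformly_convergent_on S (\<lambda>N z. \<Prod>k<N. 1 - snd z * fst z ^ k :: complex)"
    by (intro uniformly_convergent_on_prod') (auto intro!: continuous_intros compact_Times simp: S_def)
  then obtain l where l: "uniform_limit S (\<lambda>N z. \<Prod>k<N. 1 - snd z * fst z ^ k :: complex) l sequentially"
    by (auto simp: uniformly_convergent_on_def)
  have "l z = qpoch_inf (fst z) (snd z)" if "z \<in> S" for z
  proof (rule LIMSEQ_unique)
    show "(\<lambda>N. \<Prod>k<N. 1 - snd z * fst z ^ k) \<longlonglongrightarrow> l z"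
      using tendsto_uniform_limitI[OF l that] .
    show "(\<lambda>N. \<Prod>k<N. 1 - snd z * fst z ^ k) \<longlonglongrightarrow> qpoch_inf (fst z) (snd z)"
      unfolding LIMSEQ_lessThan_iff_atMost qpoch_inf_def
      using that assms(1) by (intro convergent_prod_LIMSEQ qpoch_inf_convergent) (auto simp: S_def)
  qed
  then show ?thesis
    using l by (simp cong: uniform_limit_cong')
qed

lemma tendsto_qpoch_inf:
  assumes "(f \<longlongrightarrow> p) F" "(g \<longlongrightarrow> c) F" "norm p < 1"
  shows "((\<lambda>z. qpoch_inf (f z) (g z)) \<longlongrightarrow> qpoch_inf p c) F"
proof -
  obtain r where r: "norm p < r" "r < 1" using assms(3) dense by blast
  define M where "M = norm c + 1"
  define S where "S = cball (0::complex) r \<times> cball (0::complex) M"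
  have "continuous_on S (\<lambda>z. qpoch_inf (fst z) (snd z))"
    by (rule uniform_limit_theorem[OF _ qpoch_inf_uniform_limit[OF r(2), of M, folded S_def]])
       (auto intro!: always_eventually continuous_intros)
  moreover have "(p, c) \<in> interior S"
    using r by (auto simp: S_def M_def interior_Times)
  ultimately have "isCont (\<lambda>z. qpoch_inf (fst z) (snd z)) (p, c)"
    by (rule continuous_on_interior)
  from isCont_tendsto_compose[OF this tendsto_Pair[OF assms(1,2)]] show ?thesis
    by simp
qed

text \<open>The limit \<open>p = 0\<close> is included: there the second product has argument p / x
  = 0 and stays continuous. This makes the case \<open>p = 0\<close> a limit of nonzero
  nomes.\<close>

lemma tendsto_theta:
  assumes "(f \<longlongrightarrow> p) F" "(g \<longlongrightarrow> x) F" "norm p < 1" "x \<noteq> 0"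
  shows "((\<lambda>z. theta (f z) (g z)) \<longlongrightarrow> theta p x) F"
proof -
  have "((\<lambda>z. qpoch_inf (f z) (g z) * qpoch_inf (f z) (f z / g z)) \<longlongrightarrow> theta p x) F"
    unfolding theta_eq_qpoch_inf[OF assms(3)]
    by (intro tendsto_mult tendsto_qpoch_inf tendsto_divide assms)
  moreover have "eventually (\<lambda>z. norm (f z) < 1) F"
    using order_tendstoD(2)[OF tendsto_norm[OF assms(1)] assms(3)] .
  then have "eventually (\<lambda>z. qpoch_inf (f z) (g z) * qpoch_inf (f z) (f z / g z) = theta (f z) (g z)) F"
    by eventually_elim (simp add: theta_eq_qpoch_inf)
  ultimately show ?thesis
    by (rule Lim_transform_eventually)
qed

lemma qpoch_inf_holomorphic:
  assumes "norm p < 1"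
  shows "qpoch_inf p holomorphic_on UNIV"
proof (rule holomorphic_uniform_sequence[where f = "\<lambda>N c. \<Prod>k<N. 1 - c * p ^ k"])
  fix c :: complex
  have "norm y \<le> norm c + 1" if "dist c y \<le> 1" for y
    using that norm_triangle_sub[of y c] by (simp add: dist_norm norm_minus_commute)
  then have "Pair p \<in> cball c 1 \<rightarrow> cball 0 (norm p) \<times> cball 0 (norm c + 1)"
    by auto
  from uniform_limit_compose'[OF qpoch_inf_uniform_limit[OF assms] this]
  have "uniform_limit (cball c 1) (\<lambda>N c. \<Prod>k<N. 1 - c * p ^ k) (\<lambda>c. qpoch_inf p c) sequentially"
    by simp
  then show "\<exists>d>0. cball c d \<subseteq> UNIV \<and> uniform_limit (cball c d) (\<lambda>N c. \<Prod>k<N. 1 - c * p ^ k) (qpoch_inf p) sequentially"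
    by (intro exI[of _ 1]) simp
qed (auto intro!: holomorphic_intros)

lemma theta_analytic:
  assumes "norm p < 1" "f analytic_on A" "\<And>z. z \<in> A \<Longrightarrow> f z \<noteq> 0"
  shows "(\<lambda>z. theta p (f z)) analytic_on A"
proof -
  have *: "(\<lambda>z. qpoch_inf p (g z)) analytic_on A" if "g analytic_on A" for g
    using analytic_on_compose[OF that, of "qpoch_inf p"] qpoch_inf_holomorphic[OF assms(1)]
    by (simp add: o_def analytic_on_subset[OF _ subset_UNIV] analytic_on_open)
  show ?thesis
    unfolding theta_eq_qpoch_inf[OF assms(1)] by (intro analytic_intros * assms)
qed

lemma theta_one [simp]: "norm p < 1 \<Longrightarrow> theta p 1 = 0"
  by (simp add: theta_eq_one_minus_mult)

section \<open>The simple zero of theta at 1\<close>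

lemma theta_factor_at:
  assumes "norm p < 1" "b \<noteq> 0"
  obtains h where "(h \<longlongrightarrow> h b) (at b)" "h b \<noteq> 0" "\<And>z. theta p (z / b) = (1 - z / b) * h z"
proof
  define h where "h z = qpoch_inf p (z / b * p) * qpoch_inf p (p / (z / b))" for z
  show "(h \<longlongrightarrow> h b) (at b)"
    unfolding h_def using assms by (intro tendsto_intros tendsto_qpoch_inf) auto
  show "theta p (z / b) = (1 - z / b) * h z" for z
    unfolding h_def by (rule theta_eq_one_minus_mult[OF assms(1)])
  \<comment> \<open>The value is the square of (p;p)_infinity, which could only vanish if p^(k+1) =
    1 for some k.\<close>
  show "h b \<noteq> 0"
  proof
    assume "h b = 0"
    then obtain k where "p * p ^ k = 1"
      using qpoch_inf_eq_0D[OF assms(1), of p] assms(2) by (auto simp: h_def)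
    then have "norm p ^ Suc k = 1" by (metis norm_one norm_power power_Suc)
    moreover have "norm p ^ Suc k < 1"
      using assms(1) by (simp add: power_less_one_iff del: power_Suc)
    ultimately show False by simp
  qed
qed

text \<open>Residues are computed with the factor theta(z/b), which cancels against a theta in a
  denominator, while the criterion for a removable singularity uses z - b. This limit converts one
  into the other.\<close>

lemma tendsto_diff_div_theta:
  assumes "norm p < 1" "b \<noteq> 0"
  shows "\<exists>l. ((\<lambda>z. (z - b) / theta p (z / b)) \<longlongrightarrow> l) (at b)"
proof -
  obtain h where h: "(h \<longlongrightarrow> h b) (at b)" "h b \<noteq> 0" "\<And>z. theta p (z / b) = (1 - z / b) * h z"
    using theta_factor_at[OF assms] by blast
  have "((\<lambda>z. - b / h z) \<longlongrightarrow> - b / h b) (at b)"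
    by (intro tendsto_intros h)
  moreover have "eventually (\<lambda>z. - b / h z = (z - b) / theta p (z / b)) (at b)"
    unfolding eventually_at_filter
  proof (rule always_eventually, intro allI impI)
    fix z assume "z \<noteq> b"
    \<comment> \<open>Where \<open>h z = 0\<close> both sides are 0 by the convention for division
      by zero.\<close>
    then show "- b / h z = (z - b) / theta p (z / b)"
      using assms(2) unfolding h(3) by (cases "h z = 0") (simp_all add: divide_simps, simp add: algebra_simps)
  qed
  ultimately show ?thesis
    by (intro exI[of _ "- b / h b"]) (rule Lim_transform_eventually)
qed

lemma eventually_theta_nonzero:
  assumes "norm p < 1" "b \<noteq> 0"
  shows "eventually (\<lambda>z. theta p (z / b) \<noteq> 0) (at b)"
proof -
  obtain h where h: "(h \<longlongrightarrow> h b) (at b)" "h b \<noteq> 0" "\<And>z. theta p (z / b) = (1 - z / b) * h z"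
    using theta_factor_at[OF assms] by blast
  have "eventually (\<lambda>z. h z \<noteq> 0) (at b)"
    by (rule tendsto_imp_eventually_ne[OF h(1,2)])
  moreover have "eventually (\<lambda>z. z \<noteq> b) (at b)"
    by (simp add: eventually_at_filter)
  ultimately show ?thesis
    by eventually_elim (use assms h(3) in auto)
qed

subsection \<open>Elliptic functions without poles\<close>

text \<open>After its singularities are removed, the function is holomorphic on the punctured plane
  and determined by its values on the compact annulus |p| <= |z| <= 1, hence bounded. The conclusion
  is restricted to points of continuity because at a removed singularity the total function
  \<open>f\<close> may take any value.\<close>

lemma elliptic_without_poles_constant:
  fixes f :: "complex \<Rightarrow> complex" and p :: complex
  assumes p: "norm p < 1" "p \<noteq> 0"
    and period: "\<And>z. z \<noteq> 0 \<Longrightarrow> f (p * z) = f z"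
    and isolated: "\<And>z. z \<noteq> 0 \<Longrightarrow> isolated_singularity_at f z"
    and removable: "\<And>z. z \<noteq> 0 \<Longrightarrow> ((\<lambda>u. (u - z) * f u) \<longlongrightarrow> 0) (at z)"
  shows "\<exists>c. \<forall>z. z \<noteq> 0 \<longrightarrow> isCont f z \<longrightarrow> f z = c"
proof -
  define g where "g = remove_sings f"
  have lim: "\<exists>c. (f \<longlongrightarrow> c) (at z)" if "z \<noteq> 0" for z
  proof -
    note z = that
    obtain r where r: "r > 0" "f analytic_on ball z r - {z}"
      using isolated[OF z] by (auto simp: isolated_singularity_at_def)
    have "f holomorphic_on ball z r - {z}"
      using r(2) analytic_imp_holomorphic by blast
    then obtain h where h: "h holomorphic_on ball z r" "\<forall>u\<in>ball z r - {z}. h u = f u"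
      using holomorphic_on_extend_lim[of f "ball z r" z] removable[OF z] r(1) by auto
    have "isCont h z"
      using holomorphic_on_imp_continuous_on[OF h(1)] r(1) by (simp add: continuous_on_eq_continuous_at)
    then have "(h \<longlongrightarrow> h z) (at z)"
      by (simp add: isCont_def)
    moreover have "eventually (\<lambda>u. h u = f u) (at z)"
      using h(2) r(1) eventually_at_in_open[of "ball z r" z] by (auto elim: eventually_mono)
    ultimately show ?thesis
      using Lim_transform_eventually by blast
  qed
  have g_analytic: "g analytic_on {z}" if "z \<noteq> 0" for z
    unfolding g_def using lim[OF that] remove_sings_analytic_at isolated[OF that] by blast
  have g_period: "g (p * z) = g z" if "z \<noteq> 0" for z
  proof -
    have "p * z \<noteq> 0" using that p by simp
    then obtain c where c: "(f \<longlongrightarrow> c) (at (p * z))"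
      using lim by blast
    have "((\<lambda>u. f (p * u)) \<longlongrightarrow> c) (at z)"
    proof (rule filterlim_compose[OF c])
      show "filterlim (\<lambda>u. p * u) (at (p * z)) (at z)"
        using p by (auto simp: filterlim_at eventually_at_filter intro!: tendsto_eq_intros)
    qed
    moreover have "eventually (\<lambda>u. u \<in> - {0} - {z}) (at z)"
      using that by (intro eventually_at_in_open) auto
    then have "eventually (\<lambda>u. f (p * u) = f u) (at z)"
      by eventually_elim (simp add: period)
    ultimately have "(f \<longlongrightarrow> c) (at z)"
      by (rule Lim_transform_eventually)
    then show ?thesis
      using c by (simp add: g_def remove_sings_eqI)
  qed
  have g_period_power: "g (p ^ k * z) = g z" if "z \<noteq> 0" for k z
    by (induction k) (use that p in \<open>auto simp: g_period mult.assoc\<close>)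
  have g_cont: "continuous_on (- {0}) g"
    by (intro analytic_imp_holomorphic holomorphic_on_imp_continuous_on)
       (use g_analytic analytic_on_analytic_at in blast)
  define K where "K = cball 0 1 - ball (0::complex) (norm p)"
  have "compact (g ` K)"
    using p by (intro compact_continuous_image continuous_on_subset[OF g_cont]) (auto simp: K_def compact_diff)
  then obtain M where M: "\<And>z. z \<in> K \<Longrightarrow> norm (g z) \<le> M"
    by (fastforce dest!: compact_imp_bounded simp: bounded_iff)
  have small: "\<exists>k. p ^ k * z \<in> K" if z: "z \<noteq> 0" "norm z > norm p" for z
  proof -
    \<comment> \<open>The first power of \<open>p\<close> that brings z into the unit disc cannot
      overshoot below |p|, because the preceding one leaves it outside the disc.\<close>
    define k where "k = (LEAST k. norm (p ^ k * z) \<le> 1)"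
    have "(\<lambda>k. norm p ^ k * norm z) \<longlonglongrightarrow> 0 * norm z"
      using p by (intro tendsto_intros LIMSEQ_power_zero) auto
    then have "eventually (\<lambda>k. norm p ^ k * norm z < 1) sequentially"
      by (intro order_tendstoD(2)) auto
    then obtain k0 where "norm (p ^ k0 * z) \<le> 1"
      by (auto simp: eventually_sequentially norm_mult norm_power intro: less_imp_le)
    then have le: "norm (p ^ k * z) \<le> 1"
      unfolding k_def by (rule LeastI)
    have "norm (p ^ k * z) \<ge> norm p"
    proof (cases k)
      case (Suc j)
      have "\<not> norm (p ^ j * z) \<le> 1"
        using not_less_Least[of j "\<lambda>k. norm (p ^ k * z) \<le> 1"] Suc by (auto simp: k_def)
      then have "norm p * 1 \<le> norm p * norm (p ^ j * z)"
        by (intro mult_left_mono) auto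
      then show ?thesis
        by (simp add: Suc norm_mult mult.assoc)
    qed (use z in auto)
    then show ?thesis
      using le by (auto simp: K_def)
  qed
  have bound: "norm (g z) \<le> M" if z: "z \<noteq> 0" for z
  proof -
    \<comment> \<open>A point near 0 is first divided by a power of \<open>p\<close>, which moves it
      outward beyond |p|, where \<open>small\<close> applies.\<close>
    have "(\<lambda>k. norm p * norm p ^ k) \<longlonglongrightarrow> norm p * 0"
      using p by (intro tendsto_intros LIMSEQ_power_zero) auto
    then have "eventually (\<lambda>k. norm p * norm p ^ k < norm z) sequentially"
      using z by (intro order_tendstoD(2)) auto
    then obtain k where k: "norm p * norm p ^ k < norm z"
      by (auto simp: eventually_sequentially)
    define y where "y = z / p ^ k"
    have y: "y \<noteq> 0" "norm y > norm p" "z = p ^ k * y"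
      using z p k by (auto simp: y_def norm_divide norm_power field_simps)
    obtain j where "p ^ j * y \<in> K"
      using small y by blast
    then show ?thesis
      using M g_period_power[OF y(1)] y(3) by metis
  qed
  \<comment> \<open>Pulling back along exp, which covers the punctured plane, gives an entire
    function for Liouville's theorem.\<close>
  have "(\<lambda>s. g (exp s)) holomorphic_on UNIV"
  proof -
    have "g holomorphic_on (- {0})"
      using g_analytic analytic_on_analytic_at analytic_imp_holomorphic by blast
    moreover have "exp ` UNIV \<subseteq> - {0::complex}" by auto
    ultimately show ?thesis
      using holomorphic_on_compose_gen[OF holomorphic_on_exp, of g "- {0}" UNIV] by (simp add: o_def)
  qed
  moreover have "bounded (range (\<lambda>s. g (exp s)))"
    by (auto simp: bounded_iff intro!: exI[of _ M] bound)
  ultimately obtain c where c: "\<And>s. g (exp s) = c"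
    using Liouville_theorem unfolding constant_on_def by blast
  have "f z = c" if "z \<noteq> 0" "isCont f z" for z
  proof -
    have "g z = f z"
      unfolding g_def using that(2) by (intro remove_sings_eqI) (simp add: isCont_def)
    then show ?thesis
      using c[of "Ln z"] that(1) by simp
  qed
  then show ?thesis by blast
qed

subsection \<open>The normalised sum\<close>

text \<open>Only \<open>p\<close>, \<open>q\<close>, \<open>t\<close> are fixed; the induction
  replaces \<open>v\<close> and \<open>w\<close> by \<open>q * v\<close> and
  \<open>q * w\<close>.\<close>

locale theta_params =
  fixes p q t :: complex
  assumes p_less_1: "norm p < 1" and p_nonzero: "p \<noteq> 0" and q_nonzero: "q \<noteq> 0" and t_nonzero: "t \<noteq> 0"
begin

abbreviation Th :: "complex \<Rightarrow> complex" where
  "Th \<equiv> theta p"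

lemma Th_flip: "x \<noteq> 0 \<Longrightarrow> y \<noteq> 0 \<Longrightarrow> Th (x / y) = - (x / y) * Th (y / x)"
  using theta_inverse[OF p_less_1, of "y / x"] by simp

lemma Th_shift: "x \<noteq> 0 \<Longrightarrow> Th (p * x) = - (1 / x) * Th x"
  by (rule theta_mult_p[OF p_less_1 p_nonzero])

lemma Th_tendsto: "(f \<longlongrightarrow> l) F \<Longrightarrow> l \<noteq> 0 \<Longrightarrow> ((\<lambda>z. Th (f z)) \<longlongrightarrow> Th l) F"
  by (rule tendsto_theta[OF tendsto_const _ p_less_1])

lemma Th_analytic: "f analytic_on S \<Longrightarrow> (\<And>z. z \<in> S \<Longrightarrow> f z \<noteq> 0) \<Longrightarrow> (\<lambda>z. Th (f z)) analytic_on S"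
  by (rule theta_analytic[OF p_less_1])

text \<open>
  \<open>K\<close> is the factor of a pair on the left side. \<open>A\<close> and \<open>B\<close> are the factors of \<open>i \<in> I\<close> and of \<open>j \<notin> I\<close> on the left
  side divided by \<open>\<phi>\<close>. This division replaces the poles at \<open>t\<close> and \<open>qw/v\<close> by poles at \<open>q\<close> and \<open>tw/v\<close>, whose residues
  are again sums of the same kind.
\<close>

definition K :: "complex \<Rightarrow> complex" where
  "K z = Th (t * z / q) * Th (q * z) / (Th z * Th (t * z))"

definition A :: "complex \<Rightarrow> nat \<Rightarrow> complex \<Rightarrow> complex" where
  "A w r z = q * Th (z / t) * Th (t * z / (q ^ Suc r * w)) / (t * Th (z / q) * Th (z / (q ^ r * w)))"

definition B :: "complex \<Rightarrow> complex \<Rightarrow> nat \<Rightarrow> complex \<Rightarrow> complex" where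
  "B v w r z = Th (v * z / (q * w)) * Th (z / (q ^ r * t * w)) / (Th (v * z / (t * w)) * Th (z / (q ^ Suc r * w)))"

definition fact_ratio :: "complex \<Rightarrow> complex \<Rightarrow> nat \<Rightarrow> complex" where
  "fact_ratio v w r = theta_fact q p v r * theta_fact q p w r / (theta_fact q p (q * v / t) r * theta_fact q p (q * w / t) r)"

text \<open>The rank \<open>r\<close> is separate from \<open>I\<close>: once a variable is split
  off, the remaining set \<open>J\<close> carries the rank of the full index set, which may be card
  J + 1.\<close>

definition W :: "complex \<Rightarrow> complex \<Rightarrow> nat set \<Rightarrow> (nat \<Rightarrow> complex) \<Rightarrow> nat set \<Rightarrow> nat \<Rightarrow> complex" where
  "W v w X x I r = (\<Prod>i\<in>I. A w r (x i)) * (\<Prod>j\<in>X - I. B v w r (x j)) * (\<Prod>i\<in>I. \<Prod>j\<in>X - I. K (x i / x j))"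

definition F :: "complex \<Rightarrow> complex \<Rightarrow> nat set \<Rightarrow> (nat \<Rightarrow> complex) \<Rightarrow> complex" where
  "F v w X x = (\<Sum>I\<in>Pow X. fact_ratio v w (card I) * W v w X x I (card I))"

lemma K_inverse:
  assumes "z \<noteq> 0"
  shows "K (1 / z) = Th (q * z / t) * Th (z / q) / (Th z * Th (z / t))"
proof -
  have eqs: "Th (t * (1 / z) / q) = - (t / (q * z)) * Th (q * z / t)"
       "Th (q * (1 / z)) = - (q / z) * Th (z / q)"
       "Th (1 / z) = - (1 / z) * Th z" "Th (t * (1 / z)) = - (t / z) * Th (z / t)"
    using Th_flip[of t "q * z"] Th_flip[of q z] Th_flip[of 1 z] Th_flip[of t z]
      assms q_nonzero t_nonzero by (simp_all add: mult_ac)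
  then show ?thesis
    unfolding K_def eqs using assms q_nonzero t_nonzero by (simp add: divide_simps)
qed

lemma K_inverse': "x \<noteq> 0 \<Longrightarrow> y \<noteq> 0 \<Longrightarrow>
   K (x / y) = Th (q * y / (t * x)) * Th (y / (q * x)) / (Th (y / x) * Th (y / (t * x)))"
  using K_inverse[of "y / x"] by (simp add: mult_ac)

text \<open>The substitution exchanges the two thetas upstairs and the two downstairs. At x_b = t
  x_a it makes the pair factor of (i, b) equal to that of (a, i), so the product over a subset and
  the one over its complement merge into a single product.\<close>

lemma K_reflect: "z \<noteq> 0 \<Longrightarrow> K (1 / (t * z)) = K z"
  using K_inverse[of "t * z"] t_nonzero by (simp add: K_def mult_ac)

text \<open>Each theta contributes minus the inverse of its argument, and numerator and denominator
  arguments have equal products. The same balance gives the periodicity of \<open>A\<close> and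
  \<open>B\<close>.\<close>

lemma K_shift: "z \<noteq> 0 \<Longrightarrow> K (p * z) = K z"
proof -
  assume z: "z \<noteq> 0"
  have eqs: "Th (t * (p * z) / q) = - (q / (t * z)) * Th (t * z / q)" "Th (q * (p * z)) = - (1 / (q * z)) * Th (q * z)"
     "Th (p * z) = - (1 / z) * Th z" "Th (t * (p * z)) = - (1 / (t * z)) * Th (t * z)"
    using z Th_shift[of "t * z / q"] Th_shift[of "q * z"] Th_shift[of z] Th_shift[of "t * z"] q_nonzero t_nonzero
    by (simp_all add: mult_ac)
  then show ?thesis
    unfolding K_def eqs using z q_nonzero t_nonzero by (simp add: divide_simps)
qed

lemma K_shift_inverse: "z \<noteq> 0 \<Longrightarrow> K (z / p) = K z"
  using K_shift[of "z / p"] p_nonzero by simp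

lemma A_shift:
  assumes "z \<noteq> 0" "w \<noteq> 0" shows "A w r (p * z) = A w r z"
proof -
  have eqs: "Th (p * z / t) = - (t / z) * Th (z / t)"
    "Th (t * (p * z) / (q ^ Suc r * w)) = - ((q ^ Suc r * w) / (t * z)) * Th (t * z / (q ^ Suc r * w))"
     "Th (p * z / q) = - (q / z) * Th (z / q)" "Th (p * z / (q ^ r * w)) = - (q ^ r * w / z) * Th (z / (q ^ r * w))"
    using assms Th_shift[of "z / t"] Th_shift[of "t * z / (q ^ Suc r * w)"] Th_shift[of "z / q"] Th_shift[of "z / (q ^ r * w)"]
      q_nonzero t_nonzero
    by (simp_all add: mult_ac)
  then show ?thesis
    unfolding A_def eqs using assms q_nonzero t_nonzero by (simp add: divide_simps)
qed

lemma B_shift: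
  assumes "z \<noteq> 0" "v \<noteq> 0" "w \<noteq> 0" shows "B v w r (p * z) = B v w r z"
proof -
  have eqs: "Th (v * (p * z) / (q * w)) = - (q * w / (v * z)) * Th (v * z / (q * w))"
    "Th (p * z / (q ^ r * t * w)) = - ((q ^ r * t * w) / z) * Th (z / (q ^ r * t * w))"
    "Th (v * (p * z) / (t * w)) = - (t * w / (v * z)) * Th (v * z / (t * w))"
    "Th (p * z / (q ^ Suc r * w)) = - (q ^ Suc r * w / z) * Th (z / (q ^ Suc r * w))"
    using assms Th_shift[of "v * z / (q * w)"] Th_shift[of "z / (q ^ r * t * w)"]
       Th_shift[of "v * z / (t * w)"] Th_shift[of "z / (q ^ Suc r * w)"]
      q_nonzero t_nonzero
    by (simp_all add: mult_ac)
  then show ?thesis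
    unfolding B_def eqs using assms q_nonzero t_nonzero by (simp add: divide_simps)
qed

lemma K_tendsto:
  assumes "(f \<longlongrightarrow> z) G" "z \<noteq> 0" "Th z \<noteq> 0" "Th (t * z) \<noteq> 0"
  shows "((\<lambda>s. K (f s)) \<longlongrightarrow> K z) G"
  unfolding K_def using assms q_nonzero t_nonzero by (intro tendsto_intros Th_tendsto) auto

lemma A_tendsto:
  assumes "(f \<longlongrightarrow> z) G" "z \<noteq> 0" "w \<noteq> 0" "Th (z / q) \<noteq> 0" "Th (z / (q ^ r * w)) \<noteq> 0"
  shows "((\<lambda>s. A w r (f s)) \<longlongrightarrow> A w r z) G"
  unfolding A_def using assms q_nonzero t_nonzero by (intro tendsto_intros Th_tendsto) auto

lemma B_tendsto:
  assumes "(f \<longlongrightarrow> z) G" "z \<noteq> 0" "v \<noteq> 0" "w \<noteq> 0" "Th (v * z / (t * w)) \<noteq> 0" "Th (z / (q ^ Suc r * w)) \<noteq> 0"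
  shows "((\<lambda>s. B v w r (f s)) \<longlongrightarrow> B v w r z) G"
  unfolding B_def using assms q_nonzero t_nonzero by (intro tendsto_intros Th_tendsto) auto

text \<open>Avoids the poles of \<open>A\<close> and \<open>B\<close> for all ranks at once, since
  the rank of a term varies with the index set.\<close>

definition regular_point :: "complex \<Rightarrow> complex \<Rightarrow> complex \<Rightarrow> bool" where
  "regular_point v w z \<longleftrightarrow> z \<noteq> 0 \<and> Th (z / q) \<noteq> 0 \<and> Th (v * z / (t * w)) \<noteq> 0 \<and> (\<forall>s. Th (z / (q ^ s * w)) \<noteq> 0)"

definition regular_pair :: "complex \<Rightarrow> complex \<Rightarrow> bool" where
  "regular_pair y z \<longleftrightarrow> Th (y / z) \<noteq> 0 \<and> Th (t * y / z) \<noteq> 0"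

lemma K_ratio_tendsto:
  assumes "(f \<longlongrightarrow> y) G" "(g \<longlongrightarrow> z) G" "y \<noteq> 0" "z \<noteq> 0" "regular_pair y z"
  shows "((\<lambda>s. K (f s / g s)) \<longlongrightarrow> K (y / z)) G"
  using assms by (intro K_tendsto tendsto_divide) (auto simp: regular_pair_def)

lemma W_tendsto:
  assumes "v \<noteq> 0" "w \<noteq> 0" "J \<subseteq> X"
    and "\<And>i. i \<in> X \<Longrightarrow> ((\<lambda>s. x s i) \<longlongrightarrow> \<xi> i) G" "\<And>i. i \<in> X \<Longrightarrow> regular_point v w (\<xi> i)"
    and "\<And>i j. i \<in> X \<Longrightarrow> j \<in> X \<Longrightarrow> i \<noteq> j \<Longrightarrow> regular_pair (\<xi> i) (\<xi> j)"
  shows "((\<lambda>s. W v w X (x s) J r) \<longlongrightarrow> W v w X \<xi> J r) G"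
  unfolding W_def
proof (intro tendsto_mult tendsto_prod)
  fix i assume "i \<in> J"
  then show "((\<lambda>s. A w r (x s i)) \<longlongrightarrow> A w r (\<xi> i)) G"
    using assms by (intro A_tendsto) (auto simp: regular_point_def)
next
  fix i assume "i \<in> X - J"
  then show "((\<lambda>s. B v w r (x s i)) \<longlongrightarrow> B v w r (\<xi> i)) G"
    using assms by (intro B_tendsto) (auto simp: regular_point_def simp del: power_Suc)
next
  fix i j assume "i \<in> J" "j \<in> X - J"
  then have "i \<in> X" "j \<in> X" "i \<noteq> j" using assms(3) by auto
  then show "((\<lambda>s. K (x s i / x s j)) \<longlongrightarrow> K (\<xi> i / \<xi> j)) G"
    using assms by (intro K_ratio_tendsto) (auto simp: regular_point_def)
qed

lemma W_cong: "(\<And>i. i \<in> X \<Longrightarrow> x i = y i) \<Longrightarrow> J \<subseteq> X \<Longrightarrow> W v w X x J r = W v w X y J r"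
  unfolding W_def by (intro arg_cong2[where f = "(*)"] prod.cong refl) (auto simp: subset_iff)

lemma F_cong: "(\<And>i. i \<in> X \<Longrightarrow> x i = y i) \<Longrightarrow> F v w X x = F v w X y"
  unfolding F_def by (intro sum.cong refl arg_cong2[where f = "(*)"] W_cong) auto

section \<open>Splitting one or two variables off the sum\<close>

lemma W_insert_in:
  assumes "finite X" "a \<notin> X" "J \<subseteq> X"
  shows "W v w (insert a X) x (insert a J) r = A w r (x a) * (\<Prod>j\<in>X - J. K (x a / x j)) * W v w X x J r"
proof -
  have "insert a X - insert a J = X - J" "finite J" "a \<notin> J"
    using assms by (auto intro: finite_subset)
  then show ?thesis by (simp add: W_def)
qed

lemma W_insert_out:
  assumes "finite X" "a \<notin> X" "J \<subseteq> X"
  shows "W v w (insert a X) x J r = B v w r (x a) * (\<Prod>i\<in>J. K (x i / x a)) * W v w X x J r"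
proof -
  have "insert a X - J = insert a (X - J)" "finite (X - J)" "a \<notin> X - J"
    using assms by (auto intro: finite_subset)
  then show ?thesis by (simp add: W_def prod.distrib)
qed

lemma sum_Pow_insert:
  assumes "finite X" "a \<notin> X"
  shows "(\<Sum>I\<in>Pow (insert a X). f I) = (\<Sum>I\<in>Pow X. f (insert a I) + f I :: complex)"
proof -
  have "inj_on (insert a) (Pow X)" "Pow X \<inter> insert a ` Pow X = {}"
    using assms(2) by (auto simp: inj_on_def)
  then show ?thesis
    using assms(1) by (simp add: Pow_insert sum.union_disjoint sum.reindex sum.distrib add.commute)
qed

definition in_term where
  "in_term v w X x a J r = A w r (x a) * (\<Prod>j\<in>X - J. K (x a / x j)) * W v w X x J r"

definition out_term where
  "out_term v w X x a J r = B v w r (x a) * (\<Prod>i\<in>J. K (x i / x a)) * W v w X x J r"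

text \<open>Here \<open>J\<close> is the index set without \<open>a\<close>. Index sets containing
  \<open>a\<close> have rank card J + 1, so each \<open>J\<close> enters with two consecutive ranks;
  cancellations and rank shifts rest on this.\<close>

lemma F_insert:
  assumes "finite X" "a \<notin> X"
  shows "F v w (insert a X) x = (\<Sum>J\<in>Pow X.
     fact_ratio v w (Suc (card J)) * in_term v w X x a J (Suc (card J)) + fact_ratio v w (card J) * out_term v w X x a J (card J))"
  unfolding F_def sum_Pow_insert[OF assms]
proof (intro sum.cong refl)
  fix J assume J: "J \<in> Pow X"
  then have "finite J" "a \<notin> J" using assms by (auto intro: finite_subset)
  then show "fact_ratio v w (card (insert a J)) * W v w (insert a X) x (insert a J) (card (insert a J)) +
       fact_ratio v w (card J) * W v w (insert a X) x J (card J)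
     = fact_ratio v w (Suc (card J)) * in_term v w X x a J (Suc (card J)) + fact_ratio v w (card J) * out_term v w X x a J (card J)"
    using assms J by (simp add: W_insert_in W_insert_out in_term_def out_term_def)
qed

definition in_in_term where
  "in_in_term v w X x a b J r = A w r (x a) * A w r (x b) *
     (\<Prod>j\<in>X - J. K (x a / x j) * K (x b / x j)) * W v w X x J r"

definition in_out_term where
  "in_out_term v w X x a b J r = A w r (x a) * B v w r (x b) * K (x a / x b) *
     (\<Prod>j\<in>X - J. K (x a / x j)) * (\<Prod>i\<in>J. K (x i / x b)) * W v w X x J r"

definition out_out_term where
  "out_out_term v w X x a b J r = B v w r (x a) * B v w r (x b) *
     (\<Prod>i\<in>J. K (x i / x a) * K (x i / x b)) * W v w X x J r"

text \<open>A pair factor between \<open>a\<close> and \<open>b\<close> occurs only in the two mixed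
  terms, so the poles of the pair come from these alone.\<close>

lemma F_insert2:
  assumes "finite X" "a \<notin> X" "b \<notin> X" "a \<noteq> b"
  shows "F v w (insert a (insert b X)) x = (\<Sum>J\<in>Pow X.
     fact_ratio v w (Suc (Suc (card J))) * in_in_term v w X x a b J (Suc (Suc (card J)))
   + fact_ratio v w (Suc (card J)) * in_out_term v w X x a b J (Suc (card J))
   + fact_ratio v w (Suc (card J)) * in_out_term v w X x b a J (Suc (card J))
   + fact_ratio v w (card J) * out_out_term v w X x a b J (card J))"
proof -
  have fin: "finite (insert b X)" "a \<notin> insert b X" using assms by auto
  show ?thesis
    unfolding F_insert[OF fin] sum_Pow_insert[OF assms(1,3)]
  proof (intro sum.cong refl)
    fix J assume "J \<in> Pow X"
    then have J: "J \<subseteq> X" "finite J" "b \<notin> J" "a \<notin> J" "finite (X - J)" "b \<notin> X - J"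
       "insert b X - insert b J = X - J" "insert b X - J = insert b (X - J)"
      using assms by (auto intro: finite_subset)
    show "fact_ratio v w (Suc (card (insert b J))) * in_term v w (insert b X) x a (insert b J) (Suc (card (insert b J))) +
       fact_ratio v w (card (insert b J)) * out_term v w (insert b X) x a (insert b J) (card (insert b J)) +
       (fact_ratio v w (Suc (card J)) * in_term v w (insert b X) x a J (Suc (card J)) +
        fact_ratio v w (card J) * out_term v w (insert b X) x a J (card J)) =
     fact_ratio v w (Suc (Suc (card J))) * in_in_term v w X x a b J (Suc (Suc (card J)))
   + fact_ratio v w (Suc (card J)) * in_out_term v w X x a b J (Suc (card J))
   + fact_ratio v w (Suc (card J)) * in_out_term v w X x b a J (Suc (card J))
   + fact_ratio v w (card J) * out_out_term v w X x a b J (card J)"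
      using J assms
      by (simp add: in_term_def out_term_def in_in_term_def in_out_term_def out_out_term_def W_insert_in W_insert_out
        prod.distrib mult_ac)
  qed
qed

subsection \<open>Residues\<close>

lemma theta_fact_Suc: "theta_fact q p a (Suc r) = theta_fact q p a r * Th (q ^ r * a)"
  by (simp add: theta_fact_def mult_ac)

lemma theta_fact_Suc': "theta_fact q p a (Suc r) = Th a * theta_fact q p (q * a) r"
  unfolding theta_fact_def prod.lessThan_Suc_shift by (simp add: mult_ac)

text \<open>For both \<open>v\<close> and \<open>w\<close>, this keeps all factors of
  \<open>fact_ratio\<close> nonzero at every rank, so that they can be cancelled.\<close>

definition generic_const :: "complex \<Rightarrow> bool" where
  "generic_const v \<longleftrightarrow> v \<noteq> 0 \<and> (\<forall>n. Th (q ^ n * v) \<noteq> 0) \<and> (\<forall>n. Th (q ^ Suc n * v / t) \<noteq> 0)"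

lemma fact_ratio_Suc_shift_left:
  "fact_ratio v w (Suc n) = Th v * Th (q ^ n * w) / (Th (q * v / t) * Th (q ^ Suc n * w / t)) * fact_ratio (q * v) w n"
  unfolding fact_ratio_def theta_fact_Suc'[of v] theta_fact_Suc'[of "q * v / t"] theta_fact_Suc[of w] theta_fact_Suc[of "q * w / t"]
  by (simp add: mult_ac)

lemma fact_ratio_Suc_shift_both:
  "fact_ratio v w (Suc n) = Th v * Th w / (Th (q * v / t) * Th (q * w / t)) * fact_ratio (q * v) (q * w) n"
  unfolding fact_ratio_def theta_fact_Suc' by (simp add: mult_ac)

lemma fact_ratio_Suc:
  "fact_ratio v w (Suc n) = Th (q ^ n * v) * Th (q ^ n * w) / (Th (q ^ Suc n * v / t) * Th (q ^ Suc n * w / t)) * fact_ratio v w n"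
  unfolding fact_ratio_def theta_fact_Suc by (simp add: mult_ac)

text \<open>The rank stays and only \<open>v\<close> moves: the factorials telescope and leave one
  factor from each end.\<close>

lemma fact_ratio_shift_left:
  assumes "generic_const v"
  shows "fact_ratio v w n = Th v * Th (q ^ Suc n * v / t) / (Th (q * v / t) * Th (q ^ n * v)) * fact_ratio (q * v) w n"
proof -
  have nz: "Th (q ^ n * v) \<noteq> 0" "Th (q * v / t) \<noteq> 0" "Th (q ^ Suc n * v / t) \<noteq> 0"
    using assms by (auto simp: generic_const_def dest: spec[of _ 0])
  have "theta_fact q p v n = Th v * theta_fact q p (q * v) n / Th (q ^ n * v)"
    using theta_fact_Suc[of v n] theta_fact_Suc'[of v n] nz by (simp add: field_simps)
  moreover have "theta_fact q p (q * v / t) n = Th (q * v / t) * theta_fact q p (q * (q * v) / t) n / Th (q ^ Suc n * v / t)"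
    using theta_fact_Suc[of "q * v / t" n] theta_fact_Suc'[of "q * v / t" n] nz by (simp add: field_simps)
  ultimately show ?thesis
    using nz by (simp add: fact_ratio_def mult_ac)
qed

lemma A_Suc:
  assumes "y \<noteq> 0" "w \<noteq> 0" "Th (y / (q * q)) \<noteq> 0" "Th (y / (t * q)) \<noteq> 0"
  shows "A w (Suc n) y = K (q / y) * A w n (y / q)"
proof -
  have "K (q / y) = Th (y / t) * Th (y / (q * q)) / (Th (y / q) * Th (y / (t * q)))"
    using K_inverse'[of q y] assms q_nonzero t_nonzero by simp
  then show ?thesis
    using assms q_nonzero t_nonzero by (simp add: A_def mult_ac)
qed

lemma B_Suc: "B v w (Suc n) y = B (q * v) w n (y / q)"
  using q_nonzero by (simp add: B_def mult_ac)

text \<open>With x_a = q and \<open>a\<close> in the index set, pair factors K(q / x_j) are present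
  only for j outside \<open>J\<close>. The rank shift of \<open>A\<close> supplies those for j in
  \<open>J\<close>, so a product over all of \<open>X\<close> comes out, independent of
  \<open>J\<close>.\<close>

lemma W_Suc:
  assumes "finite X" "J \<subseteq> X" "w \<noteq> 0"
    and "\<And>i. i \<in> X \<Longrightarrow> x i \<noteq> 0 \<and> Th (x i / (q * q)) \<noteq> 0 \<and> Th (x i / (t * q)) \<noteq> 0"
  shows "(\<Prod>j\<in>X - J. K (q / x j)) * W v w X x J (Suc n) = (\<Prod>j\<in>X. K (q / x j)) * W (q * v) w X (\<lambda>i. x i / q) J n"
proof -
  have "(\<Prod>i\<in>J. A w (Suc n) (x i)) = (\<Prod>i\<in>J. K (q / x i)) * (\<Prod>i\<in>J. A w n (x i / q))"
    unfolding prod.distrib[symmetric] using assms by (intro prod.cong refl A_Suc) auto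
  moreover have "(\<Prod>j\<in>X. K (q / x j)) = (\<Prod>j\<in>X - J. K (q / x j)) * (\<Prod>j\<in>J. K (q / x j))"
    using assms by (intro prod.subset_diff) auto
  ultimately show ?thesis
    using q_nonzero by (simp add: W_def B_Suc)
qed

lemma A_residue_q:
  assumes "(f \<longlongrightarrow> q) G" "eventually (\<lambda>s. Th (f s / q) \<noteq> 0) G" "w \<noteq> 0" "Th (q / (q ^ r * w)) \<noteq> 0"
  shows "((\<lambda>s. Th (f s / q) * A w r (f s)) \<longlongrightarrow>
           q * Th (q / t) * Th (t * q / (q ^ Suc r * w)) / (t * Th (q / (q ^ r * w)))) G"
proof (rule Lim_transform_eventually)
  show "((\<lambda>s. q * Th (f s / t) * Th (t * f s / (q ^ Suc r * w)) / (t * Th (f s / (q ^ r * w)))) \<longlongrightarrow>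
           q * Th (q / t) * Th (t * q / (q ^ Suc r * w)) / (t * Th (q / (q ^ r * w)))) G"
    using assms q_nonzero t_nonzero by (intro tendsto_intros Th_tendsto) auto
  show "eventually (\<lambda>s. q * Th (f s / t) * Th (t * f s / (q ^ Suc r * w)) / (t * Th (f s / (q ^ r * w)))
          = Th (f s / q) * A w r (f s)) G"
    using assms(2) by eventually_elim (simp add: A_def)
qed

text \<open>The rank survives only inside \<open>fact_ratio (q * v) w n\<close>; this makes the
  residue a constant multiple of a smaller \<open>F\<close>.\<close>

lemma residue_const_q:
  assumes "generic_const v" "generic_const w"
  shows "fact_ratio v w (Suc n) * (q * Th (q / t) * Th (t * q / (q ^ Suc (Suc n) * w)) / (t * Th (q / (q ^ Suc n * w))))
       = Th (q / t) * Th v / Th (q * v / t) * fact_ratio (q * v) w n"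
proof -
  have nz: "w \<noteq> 0" "Th (q ^ n * w) \<noteq> 0" "Th (q ^ Suc n * w / t) \<noteq> 0"
    using assms by (auto simp: generic_const_def)
  have eqs: "Th (t * q / (q ^ Suc (Suc n) * w)) = - (t / (q ^ Suc n * w)) * Th (q ^ Suc n * w / t)"
       "Th (q / (q ^ Suc n * w)) = - (1 / (q ^ n * w)) * Th (q ^ n * w)"
    using Th_flip[of t "q ^ Suc n * w"] Th_flip[of 1 "q ^ n * w"] nz q_nonzero t_nonzero by (simp_all add: mult.assoc)
  then show ?thesis
    unfolding fact_ratio_Suc_shift_left eqs using nz q_nonzero t_nonzero by (simp add: divide_simps)
qed

lemma B_shift_left:
  assumes "y \<noteq> 0" "w \<noteq> 0" "v \<noteq> 0" "Th (v * y / w) \<noteq> 0" "Th (q * v * y / (t * w)) \<noteq> 0"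
  shows "B v w n y = K (v * y / (t * w)) * B (q * v) w n y"
  using assms q_nonzero t_nonzero by (simp add: B_def K_def mult_ac)

text \<open>The counterpart of \<open>W_Suc\<close> at x_a = tw/v with \<open>a\<close> outside the
  index set: pair factors are present only for i in \<open>J\<close>, and the shift of
  \<open>v\<close> in \<open>B\<close> supplies the others.\<close>

lemma W_shift_left:
  assumes "finite X" "J \<subseteq> X" "v \<noteq> 0" "w \<noteq> 0"
    and "\<And>i. i \<in> X \<Longrightarrow> x i \<noteq> 0 \<and> Th (v * x i / w) \<noteq> 0 \<and> Th (q * v * x i / (t * w)) \<noteq> 0"
  shows "(\<Prod>i\<in>J. K (v * x i / (t * w))) * W v w X x J n = (\<Prod>j\<in>X. K (v * x j / (t * w))) * W (q * v) w X x J n"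
proof -
  have "(\<Prod>j\<in>X - J. B v w n (x j)) = (\<Prod>j\<in>X - J. K (v * x j / (t * w))) * (\<Prod>j\<in>X - J. B (q * v) w n (x j))"
    unfolding prod.distrib[symmetric] using assms by (intro prod.cong refl B_shift_left) auto
  moreover have "(\<Prod>j\<in>X. K (v * x j / (t * w))) = (\<Prod>j\<in>X - J. K (v * x j / (t * w))) * (\<Prod>j\<in>J. K (v * x j / (t * w)))"
    using assms by (intro prod.subset_diff) auto
  ultimately show ?thesis
    by (simp add: W_def)
qed

lemma B_residue_left:
  assumes "(f \<longlongrightarrow> t * w / v) G" "eventually (\<lambda>s. Th (v * f s / (t * w)) \<noteq> 0) G" "v \<noteq> 0" "w \<noteq> 0" "Th (t / (q ^ Suc r * v)) \<noteq> 0"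
  shows "((\<lambda>s. Th (v * f s / (t * w)) * B v w r (f s)) \<longlongrightarrow>
           Th (t / q) * Th (1 / (q ^ r * v)) / Th (t / (q ^ Suc r * v))) G"
proof (rule Lim_transform_eventually)
  have "((\<lambda>s. Th (v * f s / (q * w)) * Th (f s / (q ^ r * t * w)) / Th (f s / (q ^ Suc r * w))) \<longlongrightarrow>
      Th (v * (t * w / v) / (q * w)) * Th (t * w / v / (q ^ r * t * w)) / Th (t * w / v / (q ^ Suc r * w))) G"
    using assms q_nonzero t_nonzero by (intro tendsto_intros Th_tendsto) (auto simp: mult_ac)
  then show "((\<lambda>s. Th (v * f s / (q * w)) * Th (f s / (q ^ r * t * w)) / Th (f s / (q ^ Suc r * w))) \<longlongrightarrow>
           Th (t / q) * Th (1 / (q ^ r * v)) / Th (t / (q ^ Suc r * v))) G"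
    using assms t_nonzero by (simp add: mult_ac)
  show "eventually (\<lambda>s. Th (v * f s / (q * w)) * Th (f s / (q ^ r * t * w)) / Th (f s / (q ^ Suc r * w))
          = Th (v * f s / (t * w)) * B v w r (f s)) G"
    using assms(2) by eventually_elim (simp add: B_def)
qed

text \<open>The same constant as at the pole q, with opposite sign. The sign compensates for theta(q
  / x_a) taking the place of theta(x_a / q) after reflection.\<close>

lemma residue_const_left:
  assumes "generic_const v"
  shows "fact_ratio v w n * (Th (t / q) * Th (1 / (q ^ n * v)) / Th (t / (q ^ Suc n * v)))
       = - (Th (q / t) * Th v / Th (q * v / t)) * fact_ratio (q * v) w n"
proof -
  have nz: "v \<noteq> 0" "Th (q ^ n * v) \<noteq> 0" "Th (q ^ Suc n * v / t) \<noteq> 0"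
    using assms by (auto simp: generic_const_def)
  have eqs: "Th (t / (q ^ Suc n * v)) = - (t / (q ^ Suc n * v)) * Th (q ^ Suc n * v / t)"
       "Th (1 / (q ^ n * v)) = - (1 / (q ^ n * v)) * Th (q ^ n * v)" "Th (t / q) = - (t / q) * Th (q / t)"
    using Th_flip[of t "q ^ Suc n * v"] Th_flip[of 1 "q ^ n * v"] Th_flip[of t q] nz q_nonzero t_nonzero by simp_all
  show ?thesis
    unfolding fact_ratio_shift_left[OF assms, of w n] eqs using nz q_nonzero t_nonzero by (simp add: divide_simps)
qed

lemma A_residue_spec:
  assumes "(f \<longlongrightarrow> q ^ Suc m * w) G" "eventually (\<lambda>s. Th (f s / (q ^ Suc m * w)) \<noteq> 0) G" "w \<noteq> 0" "Th (q ^ m * w) \<noteq> 0"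
  shows "((\<lambda>s. Th (f s / (q ^ Suc m * w)) * A w (Suc m) (f s)) \<longlongrightarrow>
           q * Th (q ^ Suc m * w / t) * Th (t / q) / (t * Th (q ^ m * w))) G"
proof (rule Lim_transform_eventually)
  have "((\<lambda>s. q * Th (f s / t) * Th (t * f s / (q ^ Suc (Suc m) * w)) / (t * Th (f s / q))) \<longlongrightarrow>
           q * Th (q ^ Suc m * w / t) * Th (t * (q ^ Suc m * w) / (q ^ Suc (Suc m) * w)) / (t * Th (q ^ Suc m * w / q))) G"
    using assms q_nonzero t_nonzero by (intro tendsto_intros Th_tendsto) auto
  then show "((\<lambda>s. q * Th (f s / t) * Th (t * f s / (q ^ Suc (Suc m) * w)) / (t * Th (f s / q))) \<longlongrightarrow>
           q * Th (q ^ Suc m * w / t) * Th (t / q) / (t * Th (q ^ m * w))) G"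
    using assms q_nonzero by (simp add: mult_ac)
  show "eventually (\<lambda>s. q * Th (f s / t) * Th (t * f s / (q ^ Suc (Suc m) * w)) / (t * Th (f s / q))
          = Th (f s / (q ^ Suc m * w)) * A w (Suc m) (f s)) G"
    using assms(2) by eventually_elim (simp add: A_def)
qed

lemma B_residue_spec:
  assumes "(f \<longlongrightarrow> q ^ Suc m * w) G" "eventually (\<lambda>s. Th (f s / (q ^ Suc m * w)) \<noteq> 0) G" "v \<noteq> 0" "w \<noteq> 0" "Th (q ^ Suc m * v / t) \<noteq> 0"
  shows "((\<lambda>s. Th (f s / (q ^ Suc m * w)) * B v w m (f s)) \<longlongrightarrow>
           Th (q ^ m * v) * Th (q / t) / Th (q ^ Suc m * v / t)) G"
proof (rule Lim_transform_eventually)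
  have "((\<lambda>s. Th (v * f s / (q * w)) * Th (f s / (q ^ m * t * w)) / Th (v * f s / (t * w))) \<longlongrightarrow>
           Th (v * (q ^ Suc m * w) / (q * w)) * Th (q ^ Suc m * w / (q ^ m * t * w)) / Th (v * (q ^ Suc m * w) / (t * w))) G"
    using assms q_nonzero t_nonzero by (intro tendsto_intros Th_tendsto) (auto simp: mult_ac)
  then show "((\<lambda>s. Th (v * f s / (q * w)) * Th (f s / (q ^ m * t * w)) / Th (v * f s / (t * w))) \<longlongrightarrow>
           Th (q ^ m * v) * Th (q / t) / Th (q ^ Suc m * v / t)) G"
    using assms q_nonzero t_nonzero by (simp add: mult_ac)
  show "eventually (\<lambda>s. Th (v * f s / (q * w)) * Th (f s / (q ^ m * t * w)) / Th (v * f s / (t * w))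
          = Th (f s / (q ^ Suc m * w)) * B v w m (f s)) G"
    using assms(2) by eventually_elim (simp add: B_def)
qed

lemma A_spec:
  assumes "y \<noteq> 0" "w \<noteq> 0" "Th (y / (q ^ m * w)) \<noteq> 0" "Th (t * y / (q ^ Suc m * w)) \<noteq> 0"
  shows "A w (Suc m) y = A w m y * K (y / (q ^ Suc m * w))"
  using assms q_nonzero t_nonzero by (simp add: A_def K_def mult_ac)

lemma B_spec:
  assumes "y \<noteq> 0" "w \<noteq> 0" "Th (y / (q ^ Suc (Suc m) * w)) \<noteq> 0" "Th (y / (q ^ Suc m * t * w)) \<noteq> 0"
  shows "K (q ^ Suc m * w / y) * B v w (Suc m) y = B v w m y"
  using assms q_nonzero t_nonzero
  by (subst K_inverse') (simp_all add: B_def mult_ac)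

text \<open>The two sides are the cofactors of the terms with and without \<open>a\<close> when x_a
  = q^(m+1) w. They agree because raising the rank from m to m + 1 in \<open>A\<close> and
  \<open>B\<close> creates exactly the pair factors between this point and the other
  variables.\<close>

lemma W_spec:
  assumes "finite X" "J \<subseteq> X" "w \<noteq> 0"
    and "\<And>i. i \<in> X \<Longrightarrow> x i \<noteq> 0 \<and> (\<forall>s. Th (x i / (q ^ s * w)) \<noteq> 0) \<and> Th (t * x i / (q ^ Suc m * w)) \<noteq> 0
            \<and> Th (x i / (q ^ Suc m * t * w)) \<noteq> 0"
  shows "(\<Prod>j\<in>X - J. K (q ^ Suc m * w / x j)) * W v w X x J (Suc m)
       = (\<Prod>i\<in>J. K (x i / (q ^ Suc m * w))) * W v w X x J m"
proof -
  have eqA: "(\<Prod>i\<in>J. A w (Suc m) (x i)) = (\<Prod>i\<in>J. A w m (x i)) * (\<Prod>i\<in>J. K (x i / (q ^ Suc m * w)))"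
    unfolding prod.distrib[symmetric] using assms by (intro prod.cong refl A_spec) (auto simp del: power_Suc)
  have eqB: "(\<Prod>j\<in>X - J. K (q ^ Suc m * w / x j)) * (\<Prod>j\<in>X - J. B v w (Suc m) (x j)) = (\<Prod>j\<in>X - J. B v w m (x j))"
    unfolding prod.distrib[symmetric] using assms by (intro prod.cong refl B_spec) (auto simp del: power_Suc)
  show ?thesis
    unfolding W_def eqA eqB[symmetric] by (simp only: mult_ac)
qed

text \<open>The residue of \<open>A\<close> at rank m + 1 cancels that of \<open>B\<close> at rank
  m, each weighted by its \<open>fact_ratio\<close>.\<close>

lemma residue_const_spec:
  assumes "generic_const v" "generic_const w"
  shows "fact_ratio v w (Suc m) * (q * Th (q ^ Suc m * w / t) * Th (t / q) / (t * Th (q ^ m * w)))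
       + fact_ratio v w m * (Th (q ^ m * v) * Th (q / t) / Th (q ^ Suc m * v / t)) = 0"
proof -
  have nz: "Th (q ^ m * w) \<noteq> 0" "Th (q ^ Suc m * w / t) \<noteq> 0" "Th (q ^ Suc m * v / t) \<noteq> 0"
    using assms by (auto simp: generic_const_def)
  have eqs: "Th (t / q) = - (t / q) * Th (q / t)"
    using Th_flip[of t q] q_nonzero t_nonzero by simp
  show ?thesis
    unfolding fact_ratio_Suc eqs using nz q_nonzero t_nonzero by (simp add: divide_simps)
qed

section \<open>Residues of the pair factor at 1 and at 1/t\<close>

lemma K_residue_1:
  assumes "(f \<longlongrightarrow> 1) G" "eventually (\<lambda>s. Th (f s) \<noteq> 0) G" "Th t \<noteq> 0"
  shows "((\<lambda>s. Th (f s) * K (f s)) \<longlongrightarrow> Th (t / q) * Th q / Th t) G"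
proof (rule Lim_transform_eventually)
  have "((\<lambda>s. Th (t * f s / q) * Th (q * f s) / Th (t * f s)) \<longlongrightarrow> Th (t * 1 / q) * Th (q * 1) / Th (t * 1)) G"
    using assms q_nonzero t_nonzero by (intro tendsto_intros Th_tendsto) auto
  then show "((\<lambda>s. Th (t * f s / q) * Th (q * f s) / Th (t * f s)) \<longlongrightarrow> Th (t / q) * Th q / Th t) G"
    by simp
  show "eventually (\<lambda>s. Th (t * f s / q) * Th (q * f s) / Th (t * f s) = Th (f s) * K (f s)) G"
    using assms(2) by eventually_elim (simp add: K_def)
qed

lemma K_residue_t:
  assumes "(f \<longlongrightarrow> 1 / t) G" "eventually (\<lambda>s. Th (t * f s) \<noteq> 0) G" "Th (1 / t) \<noteq> 0"
  shows "((\<lambda>s. Th (t * f s) * K (f s)) \<longlongrightarrow> Th (1 / q) * Th (q / t) / Th (1 / t)) G"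
proof (rule Lim_transform_eventually)
  have "((\<lambda>s. Th (t * f s / q) * Th (q * f s) / Th (f s)) \<longlongrightarrow> Th (t * (1 / t) / q) * Th (q * (1 / t)) / Th (1 / t)) G"
    using assms q_nonzero t_nonzero by (intro tendsto_intros Th_tendsto) auto
  then show "((\<lambda>s. Th (t * f s / q) * Th (q * f s) / Th (f s)) \<longlongrightarrow> Th (1 / q) * Th (q / t) / Th (1 / t)) G"
    using t_nonzero by simp
  show "eventually (\<lambda>s. Th (t * f s / q) * Th (q * f s) / Th (f s) = Th (t * f s) * K (f s)) G"
    using assms(2) by eventually_elim (simp add: K_def)
qed

end

text \<open>
  Residues are limits along an arbitrary path \<open>x s \<rightarrow> \<xi>\<close>, so that they apply both to \<open>x(a := z)\<close>
  and to its reflection, in which the moving variable is \<open>tqw / (v z)\<close>.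
\<close>

locale one_point = theta_params +
  fixes v w :: complex and X :: "nat set" and a :: nat and x :: "'s \<Rightarrow> nat \<Rightarrow> complex"
    and \<xi> :: "nat \<Rightarrow> complex" and G :: "'s filter"
  assumes finite_X: "finite X" and a_notin: "a \<notin> X"
    and gen_v: "generic_const v" and gen_w: "generic_const w"
    and x_tendsto: "\<And>i. i \<in> insert a X \<Longrightarrow> ((\<lambda>s. x s i) \<longlongrightarrow> \<xi> i) G"
    and \<xi>_a_nonzero: "\<xi> a \<noteq> 0"
    and regular_X: "\<And>i. i \<in> X \<Longrightarrow> regular_point v w (\<xi> i)"
    and regular_pair_X: "\<And>i j. i \<in> insert a X \<Longrightarrow> j \<in> insert a X \<Longrightarrow> i \<noteq> j \<Longrightarrow> regular_pair (\<xi> i) (\<xi> j)"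
begin

lemma v_nonzero: "v \<noteq> 0" and w_nonzero: "w \<noteq> 0"
  using gen_v gen_w by (auto simp: generic_const_def)

lemma \<xi>_nonzero: "i \<in> insert a X \<Longrightarrow> \<xi> i \<noteq> 0"
  using \<xi>_a_nonzero regular_X by (auto simp: regular_point_def)

lemma W_lim: "J \<subseteq> X \<Longrightarrow> ((\<lambda>s. W v w X (x s) J r) \<longlongrightarrow> W v w X \<xi> J r) G"
  using v_nonzero w_nonzero x_tendsto regular_X regular_pair_X by (intro W_tendsto) auto

lemma K_lim:
  assumes "i \<in> insert a X" "j \<in> insert a X" "i \<noteq> j"
  shows "((\<lambda>s. K (x s i / x s j)) \<longlongrightarrow> K (\<xi> i / \<xi> j)) G"
  using assms by (intro K_ratio_tendsto x_tendsto regular_pair_X \<xi>_nonzero)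

lemma in_term_lim:
  assumes "((\<lambda>s. \<rho> s * A w r (x s a)) \<longlongrightarrow> l) G" "J \<subseteq> X"
  shows "((\<lambda>s. \<rho> s * in_term v w X (x s) a J r) \<longlongrightarrow> l * (\<Prod>j\<in>X - J. K (\<xi> a / \<xi> j)) * W v w X \<xi> J r) G"
proof -
  have "((\<lambda>s. \<rho> s * A w r (x s a) * (\<Prod>j\<in>X - J. K (x s a / x s j)) * W v w X (x s) J r)
      \<longlongrightarrow> l * (\<Prod>j\<in>X - J. K (\<xi> a / \<xi> j)) * W v w X \<xi> J r) G"
    using assms a_notin by (intro tendsto_mult tendsto_prod K_lim W_lim) auto
  then show ?thesis
    by (simp add: in_term_def mult.assoc)
qed

lemma out_term_lim:
  assumes "((\<lambda>s. \<rho> s * B v w r (x s a)) \<longlongrightarrow> l) G" "J \<subseteq> X"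
  shows "((\<lambda>s. \<rho> s * out_term v w X (x s) a J r) \<longlongrightarrow> l * (\<Prod>i\<in>J. K (\<xi> i / \<xi> a)) * W v w X \<xi> J r) G"
proof -
  have "((\<lambda>s. \<rho> s * B v w r (x s a) * (\<Prod>i\<in>J. K (x s i / x s a)) * W v w X (x s) J r)
      \<longlongrightarrow> l * (\<Prod>i\<in>J. K (\<xi> i / \<xi> a)) * W v w X \<xi> J r) G"
    using assms a_notin by (intro tendsto_mult tendsto_prod K_lim W_lim) auto
  then show ?thesis
    by (simp add: out_term_def mult.assoc)
qed

text \<open>All factors apart from those of the moving variable converge, so only the limits of
  \<open>\<rho> * A\<close> and \<open>\<rho> * B\<close> are needed. With \<open>\<rho>\<close>
  vanishing this computes a residue, with \<open>\<rho> = 1\<close> it yields continuity.\<close>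

lemma F_lim:
  assumes "\<And>J. J \<subseteq> X \<Longrightarrow> ((\<lambda>s. \<rho> s * A w (Suc (card J)) (x s a)) \<longlongrightarrow> \<alpha> (card J)) G"
    and "\<And>J. J \<subseteq> X \<Longrightarrow> ((\<lambda>s. \<rho> s * B v w (card J) (x s a)) \<longlongrightarrow> \<beta> (card J)) G"
  shows "((\<lambda>s. \<rho> s * F v w (insert a X) (x s)) \<longlongrightarrow> (\<Sum>J\<in>Pow X.
     fact_ratio v w (Suc (card J)) * (\<alpha> (card J) * (\<Prod>j\<in>X - J. K (\<xi> a / \<xi> j)) * W v w X \<xi> J (Suc (card J)))
     + fact_ratio v w (card J) * (\<beta> (card J) * (\<Prod>i\<in>J. K (\<xi> i / \<xi> a)) * W v w X \<xi> J (card J)))) G"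
proof -
  have "((\<lambda>s. \<Sum>J\<in>Pow X.
     fact_ratio v w (Suc (card J)) * (\<rho> s * in_term v w X (x s) a J (Suc (card J)))
     + fact_ratio v w (card J) * (\<rho> s * out_term v w X (x s) a J (card J))) \<longlongrightarrow> (\<Sum>J\<in>Pow X.
     fact_ratio v w (Suc (card J)) * (\<alpha> (card J) * (\<Prod>j\<in>X - J. K (\<xi> a / \<xi> j)) * W v w X \<xi> J (Suc (card J)))
     + fact_ratio v w (card J) * (\<beta> (card J) * (\<Prod>i\<in>J. K (\<xi> i / \<xi> a)) * W v w X \<xi> J (card J)))) G"
    using assms by (intro tendsto_intros in_term_lim out_term_lim) auto
  then show ?thesis
    by (simp add: F_insert[OF finite_X a_notin] sum_distrib_left algebra_simps)
qed

text \<open>Only terms with \<open>a\<close> in the index set have a pole at q, through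
  \<open>A\<close>. In the others \<open>B\<close> is regular there and the vanishing factor removes
  them.\<close>

lemma F_residue_q:
  assumes \<xi>a: "\<xi> a = q"
    and ev: "eventually (\<lambda>s. Th (x s a / q) \<noteq> 0) G"
    and a: "Th (v * q / (t * w)) \<noteq> 0" "\<And>s. Th (q / (q ^ s * w)) \<noteq> 0"
    and qq: "\<And>i. i \<in> X \<Longrightarrow> Th (\<xi> i / (q * q)) \<noteq> 0"
  shows "((\<lambda>s. Th (x s a / q) * F v w (insert a X) (x s)) \<longlongrightarrow>
            Th (q / t) * Th v / Th (q * v / t) * (\<Prod>j\<in>X. K (q / \<xi> j)) * F (q * v) w X (\<lambda>i. \<xi> i / q)) G"
proof -
  have xa: "((\<lambda>s. x s a) \<longlongrightarrow> q) G" using x_tendsto[of a] \<xi>a by simp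
  have tq: "Th (\<xi> i / (t * q)) \<noteq> 0" if "i \<in> X" for i
    using regular_pair_X[of a i] that a_notin \<xi>a \<xi>_nonzero[of i] q_nonzero t_nonzero Th_flip[of "t * q" "\<xi> i"]
    by (auto simp: regular_pair_def)
  have "((\<lambda>s. Th (x s a / q) * B v w r (x s a)) \<longlongrightarrow> Th (q / q) * B v w r q) G" for r
    using a v_nonzero w_nonzero q_nonzero by (intro tendsto_intros Th_tendsto B_tendsto xa) (auto simp del: power_Suc)
  then have "((\<lambda>s. Th (x s a / q) * B v w r (x s a)) \<longlongrightarrow> 0) G" for r
    using q_nonzero p_less_1 by simp
  from F_lim[OF A_residue_q[OF xa ev w_nonzero a(2)] this]
  have "((\<lambda>s. Th (x s a / q) * F v w (insert a X) (x s)) \<longlongrightarrow> (\<Sum>J\<in>Pow X.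
     fact_ratio v w (Suc (card J)) * (q * Th (q / t) * Th (t * q / (q ^ Suc (Suc (card J)) * w)) / (t * Th (q / (q ^ Suc (card J) * w)))) *
        ((\<Prod>j\<in>X - J. K (q / \<xi> j)) * W v w X \<xi> J (Suc (card J))))) G"
    by (simp add: \<xi>a mult.assoc)
  also have "(\<Sum>J\<in>Pow X.
     fact_ratio v w (Suc (card J)) * (q * Th (q / t) * Th (t * q / (q ^ Suc (Suc (card J)) * w)) / (t * Th (q / (q ^ Suc (card J) * w)))) *
        ((\<Prod>j\<in>X - J. K (q / \<xi> j)) * W v w X \<xi> J (Suc (card J))))
    = Th (q / t) * Th v / Th (q * v / t) * (\<Prod>j\<in>X. K (q / \<xi> j)) * F (q * v) w X (\<lambda>i. \<xi> i / q)"
    unfolding F_def sum_distrib_left residue_const_q[OF gen_v gen_w]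
    using \<xi>_nonzero qq tq by (intro sum.cong refl) (simp add: W_Suc[OF finite_X _ w_nonzero])
  finally show ?thesis .
qed

text \<open>Here the pole sits in \<open>B\<close>, so only the index sets without \<open>a\<close>
  contribute.\<close>

lemma F_residue_left:
  assumes \<xi>a: "\<xi> a = t * w / v"
    and ev: "eventually (\<lambda>s. Th (v * x s a / (t * w)) \<noteq> 0) G"
    and a: "Th (t * w / v / q) \<noteq> 0" "\<And>s. Th (t * w / v / (q ^ s * w)) \<noteq> 0"
    and qv: "\<And>i. i \<in> X \<Longrightarrow> Th (q * v * \<xi> i / (t * w)) \<noteq> 0"
  shows "((\<lambda>s. Th (v * x s a / (t * w)) * F v w (insert a X) (x s)) \<longlongrightarrow>
            - (Th (q / t) * Th v / Th (q * v / t)) * (\<Prod>j\<in>X. K (v * \<xi> j / (t * w))) * F (q * v) w X \<xi>) G"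
proof -
  have xa: "((\<lambda>s. x s a) \<longlongrightarrow> t * w / v) G" using x_tendsto[of a] \<xi>a by simp
  have vw: "Th (v * \<xi> i / w) \<noteq> 0" if "i \<in> X" for i
    using regular_pair_X[of i a] that a_notin \<xi>a v_nonzero w_nonzero t_nonzero by (auto simp: regular_pair_def mult_ac)
  have "((\<lambda>s. Th (v * x s a / (t * w)) * A w r (x s a)) \<longlongrightarrow> Th (v * (t * w / v) / (t * w)) * A w r (t * w / v)) G" for r
    using a v_nonzero w_nonzero t_nonzero by (intro tendsto_intros Th_tendsto A_tendsto xa) auto
  then have A0: "((\<lambda>s. Th (v * x s a / (t * w)) * A w r (x s a)) \<longlongrightarrow> 0) G" for r
    using v_nonzero w_nonzero t_nonzero p_less_1 by simp
  have "Th (t / (q ^ Suc r * v)) \<noteq> 0" for r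
    using a(2)[of "Suc r"] w_nonzero by (simp add: mult_ac)
  from F_lim[OF A0 B_residue_left[OF xa ev v_nonzero w_nonzero this]]
  have "((\<lambda>s. Th (v * x s a / (t * w)) * F v w (insert a X) (x s)) \<longlongrightarrow> (\<Sum>J\<in>Pow X.
     fact_ratio v w (card J) * (Th (t / q) * Th (1 / (q ^ card J * v)) / Th (t / (q ^ Suc (card J) * v))) *
        ((\<Prod>i\<in>J. K (v * \<xi> i / (t * w))) * W v w X \<xi> J (card J)))) G"
    by (simp add: \<xi>a mult_ac)
  also have "(\<Sum>J\<in>Pow X.
     fact_ratio v w (card J) * (Th (t / q) * Th (1 / (q ^ card J * v)) / Th (t / (q ^ Suc (card J) * v))) *
        ((\<Prod>i\<in>J. K (v * \<xi> i / (t * w))) * W v w X \<xi> J (card J)))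
    = - (Th (q / t) * Th v / Th (q * v / t)) * (\<Prod>j\<in>X. K (v * \<xi> j / (t * w))) * F (q * v) w X \<xi>"
    unfolding F_def sum_distrib_left residue_const_left[OF gen_v]
    using \<xi>_nonzero qv vw by (intro sum.cong refl) (simp add: W_shift_left[OF finite_X _ v_nonzero w_nonzero])
  finally show ?thesis .
qed

text \<open>At q^(m+1) w the pole occurs in \<open>A\<close> only at rank m + 1 and in
  \<open>B\<close> only at rank m. Hence exactly the sets \<open>J\<close> with m elements
  contribute, and for each of them the terms with and without \<open>a\<close> cancel.\<close>

lemma F_residue_spec:
  assumes \<xi>a: "\<xi> a = q ^ Suc m * w"
    and ev: "eventually (\<lambda>s. Th (x s a / (q ^ Suc m * w)) \<noteq> 0) G"
    and a: "Th (q ^ Suc m * v / t) \<noteq> 0" "\<And>s. s \<noteq> Suc m \<Longrightarrow> Th (q ^ Suc m * w / (q ^ s * w)) \<noteq> 0"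
  shows "((\<lambda>s. Th (x s a / (q ^ Suc m * w)) * F v w (insert a X) (x s)) \<longlongrightarrow> 0) G"
proof -
  define \<rho> where "\<rho> s = Th (x s a / (q ^ Suc m * w))" for s
  have xa: "((\<lambda>s. x s a) \<longlongrightarrow> q ^ Suc m * w) G" using x_tendsto[of a] \<xi>a by simp
  have nz: "Th (q ^ m * w) \<noteq> 0" "q ^ Suc m * w \<noteq> 0"
    using gen_w w_nonzero q_nonzero by (auto simp: generic_const_def)
  have sp: "Th (t * \<xi> i / (q ^ Suc m * w)) \<noteq> 0" "Th (\<xi> i / (q ^ Suc m * t * w)) \<noteq> 0" if "i \<in> X" for i
    using regular_pair_X[of i a] regular_pair_X[of a i] that a_notin \<xi>a \<xi>_nonzero[of i] nz t_nonzero
      Th_flip[of "\<xi> i" "q ^ Suc m * t * w"]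
    by (auto simp: regular_pair_def mult_ac simp del: power_Suc)
  have \<rho>0: "(\<rho> \<longlongrightarrow> 0) G"
  proof -
    have "(\<rho> \<longlongrightarrow> Th (q ^ Suc m * w / (q ^ Suc m * w))) G"
      unfolding \<rho>_def using nz(2) by (intro tendsto_intros Th_tendsto xa) auto
    then show ?thesis using nz(2) p_less_1 by simp
  qed
  have eqs: "q ^ Suc m * w / q = q ^ m * w" "v * (q ^ Suc m * w) / (t * w) = q ^ Suc m * v / t"
    using q_nonzero w_nonzero by auto
  define \<alpha> where "\<alpha> r = (if r = m then q * Th (q ^ Suc m * w / t) * Th (t / q) / (t * Th (q ^ m * w)) else 0)" for r
  define \<beta> where "\<beta> r = (if r = m then Th (q ^ m * v) * Th (q / t) / Th (q ^ Suc m * v / t) else 0)" for r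
  have A_lim: "((\<lambda>s. \<rho> s * A w (Suc r) (x s a)) \<longlongrightarrow> \<alpha> r) G" for r
  proof (cases "r = m")
    case True
    then show ?thesis
      unfolding \<rho>_def \<alpha>_def using A_residue_spec[OF xa ev w_nonzero nz(1)] by simp
  next
    case False
    then have "((\<lambda>s. \<rho> s * A w (Suc r) (x s a)) \<longlongrightarrow> 0 * A w (Suc r) (q ^ Suc m * w)) G"
      using nz w_nonzero a(2)[of "Suc r"] by (intro tendsto_mult \<rho>0 A_tendsto xa) (simp_all only: eqs, auto)
    then show ?thesis using False by (simp add: \<alpha>_def)
  qed
  have B_lim: "((\<lambda>s. \<rho> s * B v w r (x s a)) \<longlongrightarrow> \<beta> r) G" for r
  proof (cases "r = m")
    case True
    then show ?thesis
      unfolding \<rho>_def \<beta>_def using B_residue_spec[OF xa ev v_nonzero w_nonzero a(1)] by simp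
  next
    case False
    then have "((\<lambda>s. \<rho> s * B v w r (x s a)) \<longlongrightarrow> 0 * B v w r (q ^ Suc m * w)) G"
      using nz v_nonzero w_nonzero a(1) a(2)[of "Suc r"]
      by (intro tendsto_mult \<rho>0 B_tendsto xa) (simp_all only: eqs, auto)
    then show ?thesis using False by (simp add: \<beta>_def)
  qed
  have "(\<Sum>J\<in>Pow X.
     fact_ratio v w (Suc (card J)) * (\<alpha> (card J) * (\<Prod>j\<in>X - J. K (\<xi> a / \<xi> j)) * W v w X \<xi> J (Suc (card J)))
     + fact_ratio v w (card J) * (\<beta> (card J) * (\<Prod>i\<in>J. K (\<xi> i / \<xi> a)) * W v w X \<xi> J (card J))) = 0"
  proof (rule sum.neutral, intro ballI)
    fix J assume J: "J \<in> Pow X"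
    show "fact_ratio v w (Suc (card J)) * (\<alpha> (card J) * (\<Prod>j\<in>X - J. K (\<xi> a / \<xi> j)) * W v w X \<xi> J (Suc (card J)))
     + fact_ratio v w (card J) * (\<beta> (card J) * (\<Prod>i\<in>J. K (\<xi> i / \<xi> a)) * W v w X \<xi> J (card J)) = 0"
    proof (cases "card J = m")
      case True
      have "(\<Prod>j\<in>X - J. K (\<xi> a / \<xi> j)) * W v w X \<xi> J (Suc m) = (\<Prod>i\<in>J. K (\<xi> i / \<xi> a)) * W v w X \<xi> J m"
        unfolding \<xi>a using J regular_X \<xi>_nonzero sp by (intro W_spec finite_X w_nonzero) (auto simp: regular_point_def simp del: power_Suc)
      moreover have "fact_ratio v w (Suc m) * \<alpha> m + fact_ratio v w m * \<beta> m = 0"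
        using residue_const_spec[OF gen_v gen_w, of m] by (simp add: \<alpha>_def \<beta>_def)
      ultimately show ?thesis
        by (simp add: True mult.assoc) (simp add: mult.assoc[symmetric] distrib_right[symmetric])
    qed (simp add: \<alpha>_def \<beta>_def)
  qed
  with F_lim[OF A_lim B_lim] show ?thesis
    by (simp add: \<rho>_def)
qed

end

text \<open>Nothing is required of the pair (a, b) itself, whose factor carries the pole;
  \<open>a\<close> and \<open>b\<close> must instead be regular for \<open>A\<close> and
  \<open>B\<close>.\<close>

locale two_points = theta_params +
  fixes v w :: complex and X :: "nat set" and a b :: nat and x :: "'s \<Rightarrow> nat \<Rightarrow> complex"
    and \<xi> :: "nat \<Rightarrow> complex" and G :: "'s filter"
  assumes finite_X: "finite X" and ab: "a \<notin> X" "b \<notin> X" "a \<noteq> b"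
    and v_nonzero: "v \<noteq> 0" and w_nonzero: "w \<noteq> 0"
    and x_tendsto: "\<And>i. i \<in> insert a (insert b X) \<Longrightarrow> ((\<lambda>s. x s i) \<longlongrightarrow> \<xi> i) G"
    and regular_X: "\<And>i. i \<in> insert a (insert b X) \<Longrightarrow> regular_point v w (\<xi> i)"
    and regular_pair_X: "\<And>i j. i \<in> insert a (insert b X) \<Longrightarrow> j \<in> X \<Longrightarrow> i \<noteq> j \<Longrightarrow> regular_pair (\<xi> i) (\<xi> j) \<and> regular_pair (\<xi> j) (\<xi> i)"
begin

lemma swap: "two_points p q t v w X b a x \<xi> G"
  using finite_X ab v_nonzero w_nonzero x_tendsto regular_X regular_pair_X by unfold_locales auto

lemma \<xi>_nonzero: "i \<in> insert a (insert b X) \<Longrightarrow> \<xi> i \<noteq> 0"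
  using regular_X by (auto simp: regular_point_def)

lemma W_lim: "J \<subseteq> X \<Longrightarrow> ((\<lambda>s. W v w X (x s) J r) \<longlongrightarrow> W v w X \<xi> J r) G"
  using v_nonzero w_nonzero x_tendsto regular_X regular_pair_X by (intro W_tendsto) auto

lemma K_lim:
  assumes "i \<in> insert a (insert b X)" "j \<in> X" "i \<noteq> j"
  shows "((\<lambda>s. K (x s i / x s j)) \<longlongrightarrow> K (\<xi> i / \<xi> j)) G" "((\<lambda>s. K (x s j / x s i)) \<longlongrightarrow> K (\<xi> j / \<xi> i)) G"
  using assms regular_pair_X by (auto intro!: K_ratio_tendsto x_tendsto \<xi>_nonzero)

lemma A_lim: "i \<in> insert a (insert b X) \<Longrightarrow> ((\<lambda>s. A w r (x s i)) \<longlongrightarrow> A w r (\<xi> i)) G"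
  using regular_X[of i] w_nonzero by (intro A_tendsto x_tendsto) (auto simp: regular_point_def)

lemma B_lim: "i \<in> insert a (insert b X) \<Longrightarrow> ((\<lambda>s. B v w r (x s i)) \<longlongrightarrow> B v w r (\<xi> i)) G"
  using regular_X[of i] w_nonzero v_nonzero by (intro B_tendsto x_tendsto) (auto simp: regular_point_def simp del: power_Suc)

text \<open>The cofactor of K(x_a / x_b) at the limit point, in the terms with \<open>a\<close>
  inside and \<open>b\<close> outside the index set.\<close>

definition cross :: "nat set \<Rightarrow> nat \<Rightarrow> complex" where
  "cross J r = A w r (\<xi> a) * B v w r (\<xi> b) * (\<Prod>j\<in>X - J. K (\<xi> a / \<xi> j)) * (\<Prod>i\<in>J. K (\<xi> i / \<xi> b)) * W v w X \<xi> J r"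

lemma in_in_lim:
  assumes "(\<rho> \<longlongrightarrow> 0) G" "J \<subseteq> X"
  shows "((\<lambda>s. \<rho> s * in_in_term v w X (x s) a b J r) \<longlongrightarrow> 0) G"
proof -
  have "((\<lambda>s. in_in_term v w X (x s) a b J r) \<longlongrightarrow> in_in_term v w X \<xi> a b J r) G"
    unfolding in_in_term_def using assms ab
    by (intro tendsto_mult tendsto_prod A_lim K_lim W_lim) auto
  from tendsto_mult[OF assms(1) this] show ?thesis by simp
qed

lemma out_out_lim:
  assumes "(\<rho> \<longlongrightarrow> 0) G" "J \<subseteq> X"
  shows "((\<lambda>s. \<rho> s * out_out_term v w X (x s) a b J r) \<longlongrightarrow> 0) G"
proof -
  have "((\<lambda>s. out_out_term v w X (x s) a b J r) \<longlongrightarrow> out_out_term v w X \<xi> a b J r) G"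
    unfolding out_out_term_def using assms ab
    by (intro tendsto_mult tendsto_prod B_lim K_lim W_lim) auto
  from tendsto_mult[OF assms(1) this] show ?thesis by simp
qed

lemma in_out_lim:
  assumes "((\<lambda>s. \<rho> s * K (x s a / x s b)) \<longlongrightarrow> k) G" "J \<subseteq> X"
  shows "((\<lambda>s. \<rho> s * in_out_term v w X (x s) a b J r) \<longlongrightarrow> k * cross J r) G"
proof -
  have "((\<lambda>s. \<rho> s * K (x s a / x s b) * (A w r (x s a) * B v w r (x s b) *
      (\<Prod>j\<in>X - J. K (x s a / x s j)) * (\<Prod>i\<in>J. K (x s i / x s b)) * W v w X (x s) J r)) \<longlongrightarrow> k * cross J r) G"
    unfolding cross_def using assms ab
    by (intro tendsto_mult tendsto_prod A_lim B_lim K_lim W_lim) auto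
  then show ?thesis
    by (simp add: in_out_term_def mult_ac)
qed

end

lemma (in two_points) F_lim:
  assumes "(\<rho> \<longlongrightarrow> 0) G" "((\<lambda>s. \<rho> s * K (x s a / x s b)) \<longlongrightarrow> k) G" "((\<lambda>s. \<rho> s * K (x s b / x s a)) \<longlongrightarrow> k') G"
  shows "((\<lambda>s. \<rho> s * F v w (insert a (insert b X)) (x s)) \<longlongrightarrow> (\<Sum>J\<in>Pow X. fact_ratio v w (Suc (card J)) *
    (k * cross J (Suc (card J)) + k' * two_points.cross p q t v w X b a \<xi> J (Suc (card J))))) G"
proof -
  interpret swap: two_points p q t v w X b a x \<xi> G by (rule swap)
  have "((\<lambda>s. \<Sum>J\<in>Pow X. fact_ratio v w (Suc (Suc (card J))) * (\<rho> s * in_in_term v w X (x s) a b J (Suc (Suc (card J))))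
     + fact_ratio v w (Suc (card J)) * (\<rho> s * in_out_term v w X (x s) a b J (Suc (card J)))
     + fact_ratio v w (Suc (card J)) * (\<rho> s * in_out_term v w X (x s) b a J (Suc (card J)))
     + fact_ratio v w (card J) * (\<rho> s * out_out_term v w X (x s) a b J (card J)))
   \<longlongrightarrow> (\<Sum>J\<in>Pow X. fact_ratio v w (Suc (Suc (card J))) * 0
     + fact_ratio v w (Suc (card J)) * (k * cross J (Suc (card J)))
     + fact_ratio v w (Suc (card J)) * (k' * swap.cross J (Suc (card J)))
     + fact_ratio v w (card J) * 0)) G"
    using assms by (intro tendsto_sum tendsto_add tendsto_mult[OF tendsto_const] in_in_lim out_out_lim in_out_lim swap.in_out_lim) auto
  then show ?thesis
    by (simp add: F_insert2[OF finite_X ab] sum_distrib_left algebra_simps)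
qed

text \<open>The two mixed terms have equal cofactors once the two limit points coincide, and
  inversion of theta gives their pair factors opposite residues.\<close>

lemma (in two_points) F_residue_diagonal:
  assumes \<xi>ab: "\<xi> a = \<xi> b" and ev: "eventually (\<lambda>s. Th (x s a / x s b) \<noteq> 0) G" and t1: "Th t \<noteq> 0"
  shows "((\<lambda>s. Th (x s a / x s b) * F v w (insert a (insert b X)) (x s)) \<longlongrightarrow> 0) G"
proof -
  interpret swap: two_points p q t v w X b a x \<xi> G by (rule swap)
  define k where "k = Th (t / q) * Th q / Th t"
  have nz: "\<xi> a \<noteq> 0" "\<xi> b \<noteq> 0" using \<xi>_nonzero by auto
  have lim1: "((\<lambda>s. x s a / x s b) \<longlongrightarrow> 1) G" "((\<lambda>s. x s b / x s a) \<longlongrightarrow> 1) G"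
    using tendsto_divide[OF x_tendsto[of a] x_tendsto[of b]] tendsto_divide[OF x_tendsto[of b] x_tendsto[of a]] nz \<xi>ab
    by auto
  have evnz: "eventually (\<lambda>s. x s a \<noteq> 0 \<and> x s b \<noteq> 0) G"
    using tendsto_imp_eventually_ne[OF x_tendsto[of a] nz(1)] tendsto_imp_eventually_ne[OF x_tendsto[of b] nz(2)]
    by (auto simp: eventually_conj_iff)
  have ev': "eventually (\<lambda>s. Th (x s b / x s a) \<noteq> 0) G"
    using ev evnz by eventually_elim (metis Th_flip divide_eq_0_iff mult_eq_0_iff neg_equal_0_iff_equal)
  have "((\<lambda>s. Th (x s a / x s b)) \<longlongrightarrow> Th 1) G"
    using lim1 by (intro Th_tendsto) auto
  then have \<rho>0: "((\<lambda>s. Th (x s a / x s b)) \<longlongrightarrow> 0) G" using p_less_1 by simp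
  have k1: "((\<lambda>s. Th (x s a / x s b) * K (x s a / x s b)) \<longlongrightarrow> k) G"
    unfolding k_def by (rule K_residue_1[OF lim1(1) ev t1])
  have "((\<lambda>s. - (x s a / x s b) * (Th (x s b / x s a) * K (x s b / x s a))) \<longlongrightarrow> - 1 * k) G"
    unfolding k_def by (intro tendsto_intros K_residue_1 lim1 ev' t1)
  moreover have "eventually (\<lambda>s. - (x s a / x s b) * (Th (x s b / x s a) * K (x s b / x s a)) = Th (x s a / x s b) * K (x s b / x s a)) G"
    using evnz by eventually_elim (subst (2) Th_flip, auto)
  ultimately have k2: "((\<lambda>s. Th (x s a / x s b) * K (x s b / x s a)) \<longlongrightarrow> - 1 * k) G"
    by (rule Lim_transform_eventually)
  have "swap.cross J r = cross J r" for J r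
    unfolding cross_def swap.cross_def \<xi>ab by (simp add: mult_ac)
  with F_lim[OF \<rho>0 k1 k2] show ?thesis by simp
qed

context theta_params
begin

text \<open>The residue of \<open>K\<close> at 1/t times the quotient of
  \<open>fact_ratio v w (Suc n)\<close> by \<open>fact_ratio (q * v) (q * w) n\<close>.\<close>

definition pair_const :: "complex \<Rightarrow> complex \<Rightarrow> complex" where
  "pair_const v w = Th (1 / q) * Th (q / t) / Th (1 / t) * (Th v * Th w / (Th (q * v / t) * Th (q * w / t)))"

definition pair_factor :: "complex \<Rightarrow> complex \<Rightarrow> complex \<Rightarrow> complex" where
  "pair_factor v w y = q * Th (y / t) * Th (t * v * y / (q * w)) / (t * Th (y / q) * Th (v * y / w))"

text \<open>At the pole of a pair the dependence on \<open>r\<close> cancels; otherwise the residue would not be a sum of the same kind.\<close>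

lemma A_mult_B:
  assumes "regular_point v w y" "regular_point v w (t * y)"
  shows "A w r y * B v w r (t * y) = pair_factor v w y"
proof -
  have "Th (y / (q ^ r * w)) \<noteq> 0" "Th (t * y / (q ^ Suc r * w)) \<noteq> 0"
    using assms by (auto simp: regular_point_def simp del: power_Suc)
  then show ?thesis
    using t_nonzero by (simp add: A_def B_def pair_factor_def mult_ac)
qed

text \<open>\<open>A\<close> and \<open>B\<close> depend on \<open>v\<close> and the rank only
  through v/w and q^r w, so raising the rank amounts to multiplying both parameters by q.\<close>

lemma W_Suc_both: "W v w X x J (Suc n) = W (q * v) (q * w) X x J n"
  using q_nonzero by (simp add: W_def A_def B_def mult_ac)

end

text \<open>Of the two mixed terms only the one with \<open>a\<close> inside and \<open>b\<close>
  outside has a pole: the opposite pair factor tends to the finite value K(t).\<close>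

lemma (in two_points) F_residue_pair:
  assumes \<xi>ab: "\<xi> b = t * \<xi> a" and ev: "eventually (\<lambda>s. Th (t * x s a / x s b) \<noteq> 0) G"
    and t1: "Th t \<noteq> 0" "Th (t * t) \<noteq> 0"
  shows "((\<lambda>s. Th (t * x s a / x s b) * F v w (insert a (insert b X)) (x s)) \<longlongrightarrow>
     pair_const v w * pair_factor v w (\<xi> a) * (\<Prod>j\<in>X. K (\<xi> a / \<xi> j)) * F (q * v) (q * w) X \<xi>) G"
proof -
  interpret swap: two_points p q t v w X b a x \<xi> G by (rule swap)
  define k where "k = Th (1 / q) * Th (q / t) / Th (1 / t)"
  have nz: "\<xi> a \<noteq> 0" "\<xi> b \<noteq> 0" using \<xi>_nonzero by auto
  have "Th (1 / t) \<noteq> 0" using Th_flip[of 1 t] t_nonzero t1 by auto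
  have lim: "((\<lambda>s. x s a / x s b) \<longlongrightarrow> 1 / t) G" "((\<lambda>s. x s b / x s a) \<longlongrightarrow> t) G"
    using tendsto_divide[OF x_tendsto[of a] x_tendsto[of b]] tendsto_divide[OF x_tendsto[of b] x_tendsto[of a]] nz \<xi>ab
    by auto
  have "((\<lambda>s. Th (t * (x s a / x s b))) \<longlongrightarrow> Th (t * (1 / t))) G"
    using t_nonzero by (intro Th_tendsto tendsto_intros lim) auto
  then have \<rho>0: "((\<lambda>s. Th (t * x s a / x s b)) \<longlongrightarrow> 0) G" using p_less_1 t_nonzero by simp
  have k1: "((\<lambda>s. Th (t * x s a / x s b) * K (x s a / x s b)) \<longlongrightarrow> k) G"
    using K_residue_t[OF lim(1)] ev \<open>Th (1 / t) \<noteq> 0\<close> by (simp add: k_def)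
  have "((\<lambda>s. Th (t * x s a / x s b) * K (x s b / x s a)) \<longlongrightarrow> 0 * K t) G"
    by (intro tendsto_mult \<rho>0 K_tendsto lim t_nonzero t1)
  then have k2: "((\<lambda>s. Th (t * x s a / x s b) * K (x s b / x s a)) \<longlongrightarrow> 0) G" by simp
  have "(\<Sum>J\<in>Pow X. fact_ratio v w (Suc (card J)) * (k * cross J (Suc (card J)) + 0 * swap.cross J (Suc (card J))))
     = pair_const v w * pair_factor v w (\<xi> a) * (\<Prod>j\<in>X. K (\<xi> a / \<xi> j)) * F (q * v) (q * w) X \<xi>"
    unfolding F_def sum_distrib_left
  proof (intro sum.cong refl)
    fix J assume "J \<in> Pow X"
    then have J: "J \<subseteq> X" by simp
    have "K (\<xi> i / \<xi> b) = K (\<xi> a / \<xi> i)" if "i \<in> X" for i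
      using K_reflect[of "\<xi> a / \<xi> i"] \<xi>_nonzero[of i] that nz \<xi>ab by simp
    then have "(\<Prod>i\<in>J. K (\<xi> i / \<xi> b)) = (\<Prod>i\<in>J. K (\<xi> a / \<xi> i))"
      using J by (intro prod.cong) auto
    then have "cross J (Suc n) = pair_factor v w (\<xi> a) * (\<Prod>j\<in>X. K (\<xi> a / \<xi> j)) * W (q * v) (q * w) X \<xi> J n" for n
      using A_mult_B[of v w "\<xi> a" "Suc n"] regular_X[of a] regular_X[of b] prod.subset_diff[OF J finite_X, of "\<lambda>j. K (\<xi> a / \<xi> j)"]
      by (simp add: cross_def \<xi>ab W_Suc_both mult_ac)
    then show "fact_ratio v w (Suc (card J)) * (k * cross J (Suc (card J)) + 0 * swap.cross J (Suc (card J)))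
      = pair_const v w * pair_factor v w (\<xi> a) * (\<Prod>j\<in>X. K (\<xi> a / \<xi> j)) * (fact_ratio (q * v) (q * w) (card J) * W (q * v) (q * w) X \<xi> J (card J))"
      by (simp add: fact_ratio_Suc_shift_both pair_const_def k_def mult_ac)
  qed
  with F_lim[OF \<rho>0 k1 k2] show ?thesis by simp
qed

section \<open>Periodicity and reflection of the difference\<close>

context theta_params
begin

lemma F_meromorphic:
  assumes v: "v \<noteq> 0" "w \<noteq> 0"
    and x: "\<And>i. i \<in> X \<Longrightarrow> (\<lambda>s. x s i) analytic_on U" "\<And>i s. i \<in> X \<Longrightarrow> s \<in> U \<Longrightarrow> x s i \<noteq> 0"
  shows "(\<lambda>s. F v w X (x s)) meromorphic_on U"
proof -
  have Th: "(\<lambda>s. Th (f s)) meromorphic_on U" if "f analytic_on U" "\<And>s. s \<in> U \<Longrightarrow> f s \<noteq> 0" for f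
    using that by (intro analytic_on_imp_meromorphic_on Th_analytic)
  have A: "(\<lambda>s. A w r (x s i)) meromorphic_on U" if "i \<in> X" for r i
    unfolding A_def using that x v q_nonzero t_nonzero by (intro meromorphic_intros Th analytic_intros) auto
  have B: "(\<lambda>s. B v w r (x s i)) meromorphic_on U" if "i \<in> X" for r i
    unfolding B_def using that x v q_nonzero t_nonzero by (intro meromorphic_intros Th analytic_intros) auto
  have K: "(\<lambda>s. K (x s i / x s j)) meromorphic_on U" if "i \<in> X" "j \<in> X" for i j
    unfolding K_def using that x v q_nonzero t_nonzero by (intro meromorphic_intros Th analytic_intros) auto
  show ?thesis
    unfolding F_def W_def by (intro meromorphic_intros A B K) auto
qed

lemma F_shift:
  assumes "v \<noteq> 0" "w \<noteq> 0" "\<And>i. i \<in> X \<Longrightarrow> x i \<noteq> 0"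
  shows "F v w X (x(a := p * x a)) = F v w X x"
proof -
  have eqA: "A w r ((x(a := p * x a)) i) = A w r (x i)" and eqB: "B v w r ((x(a := p * x a)) i) = B v w r (x i)" if "i \<in> X" for i r
    using assms that by (auto simp: A_shift B_shift)
  have eqK: "K ((x(a := p * x a)) i / (x(a := p * x a)) j) = K (x i / x j)" if "i \<in> X" "j \<in> X" for i j
    using assms(3)[OF that(1)] assms(3)[OF that(2)] K_shift[of "x i / x j"] K_shift_inverse[of "x i / x j"] p_nonzero
    by (auto simp: mult_ac)
  show ?thesis
    unfolding F_def W_def
    by (intro sum.cong prod.cong refl arg_cong2[where f = "(*)"] eqA eqB eqK) auto
qed

definition reflect :: "complex \<Rightarrow> complex \<Rightarrow> (nat \<Rightarrow> complex) \<Rightarrow> nat \<Rightarrow> complex" where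
  "reflect v w x i = t * q * w / v / x i"

definition D :: "complex \<Rightarrow> complex \<Rightarrow> nat set \<Rightarrow> (nat \<Rightarrow> complex) \<Rightarrow> complex" where
  "D v w X x = F v w X x - F v w X (reflect v w x)"

lemma reflect_reflect: "v \<noteq> 0 \<Longrightarrow> w \<noteq> 0 \<Longrightarrow> reflect v w (reflect v w x) = x"
  using q_nonzero t_nonzero by (auto simp: reflect_def fun_eq_iff)

lemma reflect_upd: "reflect v w (x(a := z)) = (reflect v w x)(a := t * q * w / v / z)"
  by (auto simp: reflect_def)

lemma D_reflect: "v \<noteq> 0 \<Longrightarrow> w \<noteq> 0 \<Longrightarrow> D v w X (reflect v w x) = - D v w X x"
  by (simp add: D_def reflect_reflect)

lemma D_shift:
  assumes "v \<noteq> 0" "w \<noteq> 0" "\<And>i. i \<in> X \<Longrightarrow> x i \<noteq> 0"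
  shows "D v w X (x(a := p * x a)) = D v w X x"
proof -
  let ?y = "reflect v w (x(a := p * x a))"
  \<comment> \<open>Reflection turns multiplication by \<open>p\<close> into division by
    \<open>p\<close>, which one further shift undoes.\<close>
  have "?y(a := p * ?y a) = reflect v w x"
    using p_nonzero by (auto simp: reflect_def)
  moreover have "F v w X (?y(a := p * ?y a)) = F v w X ?y"
    using assms q_nonzero t_nonzero p_nonzero by (intro F_shift) (auto simp: reflect_def)
  ultimately have "F v w X ?y = F v w X (reflect v w x)" by simp
  then show ?thesis
    using assms by (simp add: D_def F_shift)
qed

text \<open>If x_b = t x_a, the reflection of x_b is qw/(v x_a). The lemma therefore gives F(x) and
  F(y) the same prefactor at a pair pole. It holds since the involution exchanges the two thetas
  upstairs and the two downstairs.\<close>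

lemma pair_factor_reflect:
  assumes "v \<noteq> 0" "w \<noteq> 0" "y \<noteq> 0"
  shows "pair_factor v w (q * w / (v * y)) = pair_factor v w y"
proof -
  have eqs: "Th (q * w / (v * y) / t) = - (q * w / (t * v * y)) * Th (t * v * y / (q * w))"
    "Th (t * v * (q * w / (v * y)) / (q * w)) = - (t / y) * Th (y / t)"
    "Th (q * w / (v * y) / q) = - (w / (v * y)) * Th (v * y / w)"
    "Th (v * (q * w / (v * y)) / w) = - (q / y) * Th (y / q)"
    using assms q_nonzero t_nonzero Th_flip[of "q * w" "t * v * y"] Th_flip[of t y] Th_flip[of w "v * y"] Th_flip[of q y]
    by (simp_all add: mult_ac)
  show ?thesis
    unfolding pair_factor_def eqs using assms q_nonzero t_nonzero by (simp add: divide_simps)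
qed

end

text \<open>The exponent starts at 1: \<open>A\<close> occurs at x_a only when \<open>a\<close> is
  in the index set, hence with rank at least 1, and \<open>B\<close> carries q^(r+1). So w itself is
  no pole.\<close>

lemma (in one_point) F_regular:
  assumes "Th (\<xi> a / q) \<noteq> 0" "Th (v * \<xi> a / (t * w)) \<noteq> 0" "\<And>s. Th (\<xi> a / (q ^ Suc s * w)) \<noteq> 0"
  shows "((\<lambda>s. F v w (insert a X) (x s)) \<longlongrightarrow> F v w (insert a X) \<xi>) G"
proof -
  have xa: "((\<lambda>s. x s a) \<longlongrightarrow> \<xi> a) G" by (intro x_tendsto) simp
  have "((\<lambda>s. 1 * A w (Suc r) (x s a)) \<longlongrightarrow> A w (Suc r) (\<xi> a)) G"
       "((\<lambda>s. 1 * B v w r (x s a)) \<longlongrightarrow> B v w r (\<xi> a)) G" for r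
    using A_tendsto[OF xa \<xi>_a_nonzero w_nonzero, of "Suc r"] B_tendsto[OF xa \<xi>_a_nonzero v_nonzero w_nonzero, of r] assms
    by (simp_all del: power_Suc)
  from F_lim[OF this] show ?thesis
    by (simp add: F_insert[OF finite_X a_notin] in_term_def out_term_def mult.assoc)
qed

text \<open>When x_a reaches q, its reflection reaches tw/v, so both parts of the difference have a
  pole and must be compared.\<close>

lemma (in one_point) D_residue_q:
  assumes y: "one_point p q t v w X a (\<lambda>s. reflect v w (x s)) (reflect v w \<xi>) G"
    and \<xi>a: "\<xi> a = q"
    and ev: "eventually (\<lambda>s. Th (x s a / q) \<noteq> 0) G"
    and a: "Th (v * q / (t * w)) \<noteq> 0" "\<And>s. Th (q / (q ^ s * w)) \<noteq> 0" "\<And>s. Th (t / (q ^ s * v)) \<noteq> 0"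
    and qq: "\<And>i. i \<in> X \<Longrightarrow> Th (\<xi> i / (q * q)) \<noteq> 0"
    and IH: "D (q * v) w X (\<lambda>i. \<xi> i / q) = 0"
  shows "((\<lambda>s. Th (x s a / q) * D v w (insert a X) (x s)) \<longlongrightarrow> 0) G"
proof -
  interpret y: one_point p q t v w X a "\<lambda>s. reflect v w (x s)" "reflect v w \<xi>" G by (rule y)
  define C where "C = Th (q / t) * Th v / Th (q * v / t) * (\<Prod>j\<in>X. K (q / \<xi> j)) * F (q * v) w X (\<lambda>i. \<xi> i / q)"
  have xa: "((\<lambda>s. x s a) \<longlongrightarrow> q) G" using x_tendsto[of a] \<xi>a by simp
  have xnz: "eventually (\<lambda>s. x s a \<noteq> 0) G"
    using tendsto_imp_eventually_ne[OF xa q_nonzero] .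
  have yx: "v * reflect v w (x s) i / (t * w) = q / x s i" "v * reflect v w \<xi> i / (t * w) = q / \<xi> i" for s i
    using v_nonzero w_nonzero t_nonzero by (auto simp: reflect_def)
  have L1: "((\<lambda>s. Th (x s a / q) * F v w (insert a X) (x s)) \<longlongrightarrow> C) G"
    unfolding C_def by (rule F_residue_q[OF \<xi>a ev a(1,2) qq])
  have "((\<lambda>s. Th (q / x s a) * F v w (insert a X) (reflect v w (x s))) \<longlongrightarrow>
         - (Th (q / t) * Th v / Th (q * v / t)) * (\<Prod>j\<in>X. K (q / \<xi> j)) * F (q * v) w X (reflect v w \<xi>)) G"
    unfolding yx[symmetric]
  proof (rule y.F_residue_left)
    show "reflect v w \<xi> a = t * w / v"
      using q_nonzero by (simp add: reflect_def \<xi>a)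
    show "eventually (\<lambda>s. Th (v * reflect v w (x s) a / (t * w)) \<noteq> 0) G"
      unfolding yx using ev xnz
    proof eventually_elim
      case (elim s)
      then show ?case using Th_flip[of "q" "x s a"] q_nonzero by simp
    qed
    show "Th (t * w / v / q) \<noteq> 0"
      using Th_flip[of "t * w" "v * q"] a(1) v_nonzero w_nonzero t_nonzero q_nonzero by simp
    show "Th (t * w / v / (q ^ s * w)) \<noteq> 0" for s
      using a(3)[of s] w_nonzero by (simp add: mult_ac)
    show "Th (q * v * reflect v w \<xi> i / (t * w)) \<noteq> 0" if "i \<in> X" for i
    proof -
      have "q * v * reflect v w \<xi> i / (t * w) = (q * q) / \<xi> i"
        using v_nonzero w_nonzero t_nonzero by (simp add: reflect_def)
      then show ?thesis
        using Th_flip[of "q * q" "\<xi> i"] qq[OF that] \<xi>_nonzero[of i] that q_nonzero by simp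
    qed
  qed
  \<comment> \<open>The old reflection of x is the new reflection of x/q, so the two residues are
    the two members of the smaller instance.\<close>
  moreover have "F (q * v) w X (reflect v w \<xi>) = F (q * v) w X (\<lambda>i. \<xi> i / q)"
  proof -
    have "reflect (q * v) w (\<lambda>i. \<xi> i / q) = reflect v w \<xi>"
      using q_nonzero by (auto simp: reflect_def fun_eq_iff)
    then show ?thesis using IH by (simp add: D_def)
  qed
  ultimately have L2: "((\<lambda>s. Th (q / x s a) * F v w (insert a X) (reflect v w (x s))) \<longlongrightarrow> - C) G"
    by (simp add: C_def)
  \<comment> \<open>The factor -(x_a/q), which tends to -1, converts theta(q / x_a) into theta(x_a /
    q) and makes the residues C and -C cancel in the difference.\<close>
  have "((\<lambda>s. Th (x s a / q) * F v w (insert a X) (x s) - - (x s a / q) * (Th (q / x s a) * F v w (insert a X) (reflect v w (x s))))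
      \<longlongrightarrow> C - - (q / q) * - C) G"
    using q_nonzero by (intro tendsto_intros L1 L2 xa) auto
  then have "((\<lambda>s. Th (x s a / q) * F v w (insert a X) (x s) - - (x s a / q) * (Th (q / x s a) * F v w (insert a X) (reflect v w (x s)))) \<longlongrightarrow> 0) G"
    using q_nonzero by simp
  moreover have "eventually (\<lambda>s. Th (x s a / q) * F v w (insert a X) (x s) - - (x s a / q) * (Th (q / x s a) * F v w (insert a X) (reflect v w (x s)))
       = Th (x s a / q) * D v w (insert a X) (x s)) G"
    using xnz
  proof eventually_elim
    case (elim s)
    show ?case using Th_flip[of "x s a" q] elim q_nonzero by (simp add: D_def right_diff_distrib)
  qed
  ultimately show ?thesis
    by (rule Lim_transform_eventually)
qed

text \<open>F(x) has residue 0 by itself, while F(y) is regular at this point and is multiplied by a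
  factor tending to 0.\<close>

lemma (in one_point) D_residue_spec:
  assumes y: "one_point p q t v w X a (\<lambda>s. reflect v w (x s)) (reflect v w \<xi>) G"
    and \<xi>a: "\<xi> a = q ^ Suc m * w"
    and ev: "eventually (\<lambda>s. Th (x s a / (q ^ Suc m * w)) \<noteq> 0) G"
    and a: "Th (q ^ Suc m * v / t) \<noteq> 0" "\<And>s. s \<noteq> Suc m \<Longrightarrow> Th (q ^ Suc m * w / (q ^ s * w)) \<noteq> 0"
    and b: "Th (reflect v w \<xi> a / q) \<noteq> 0" "Th (v * reflect v w \<xi> a / (t * w)) \<noteq> 0" "\<And>s. Th (reflect v w \<xi> a / (q ^ Suc s * w)) \<noteq> 0"
  shows "((\<lambda>s. Th (x s a / (q ^ Suc m * w)) * D v w (insert a X) (x s)) \<longlongrightarrow> 0) G"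
proof -
  interpret y: one_point p q t v w X a "\<lambda>s. reflect v w (x s)" "reflect v w \<xi>" G by (rule y)
  have xa: "((\<lambda>s. x s a) \<longlongrightarrow> q ^ Suc m * w) G" using x_tendsto[of a] \<xi>a by simp
  have "((\<lambda>s. Th (x s a / (q ^ Suc m * w))) \<longlongrightarrow> Th (q ^ Suc m * w / (q ^ Suc m * w))) G"
    using q_nonzero w_nonzero by (intro Th_tendsto tendsto_intros xa) auto
  from tendsto_diff[OF F_residue_spec[OF \<xi>a ev a] tendsto_mult[OF this y.F_regular[OF b]]] show ?thesis
    using q_nonzero w_nonzero p_less_1 by (simp add: D_def right_diff_distrib)
qed

text \<open>Reflection inverts ratios of variables, so the result for F(y) is used with
  \<open>a\<close> and \<open>b\<close> exchanged; the vanishing factor is then the same. The pair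
  poles below are treated alike.\<close>

lemma (in two_points) D_residue_diagonal:
  assumes y: "two_points p q t v w X a b (\<lambda>s. reflect v w (x s)) (reflect v w \<xi>) G"
    and \<xi>ab: "\<xi> a = \<xi> b" and ev: "eventually (\<lambda>s. Th (x s a / x s b) \<noteq> 0) G" and t1: "Th t \<noteq> 0"
  shows "((\<lambda>s. Th (x s a / x s b) * D v w (insert a (insert b X)) (x s)) \<longlongrightarrow> 0) G"
proof -
  interpret y: two_points p q t v w X a b "\<lambda>s. reflect v w (x s)" "reflect v w \<xi>" G by (rule y)
  interpret y': two_points p q t v w X b a "\<lambda>s. reflect v w (x s)" "reflect v w \<xi>" G by (rule y.swap)
  have yx: "reflect v w (x s) b / reflect v w (x s) a = x s a / x s b" for s
    using v_nonzero w_nonzero q_nonzero t_nonzero by (simp add: reflect_def)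
  have "((\<lambda>s. Th (reflect v w (x s) b / reflect v w (x s) a) * F v w (insert b (insert a X)) (reflect v w (x s))) \<longlongrightarrow> 0) G"
    using ev by (intro y'.F_residue_diagonal t1) (simp_all add: yx, simp add: reflect_def \<xi>ab)
  then have "((\<lambda>s. Th (x s a / x s b) * F v w (insert a (insert b X)) (reflect v w (x s))) \<longlongrightarrow> 0) G"
    by (simp add: yx insert_commute)
  from tendsto_diff[OF F_residue_diagonal[OF \<xi>ab ev t1] this] show ?thesis
    by (simp add: D_def right_diff_distrib)
qed

lemma (in two_points) D_residue_pair:
  assumes y: "two_points p q t v w X a b (\<lambda>s. reflect v w (x s)) (reflect v w \<xi>) G"
    and \<xi>ab: "\<xi> b = t * \<xi> a" and ev: "eventually (\<lambda>s. Th (t * x s a / x s b) \<noteq> 0) G"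
    and t1: "Th t \<noteq> 0" "Th (t * t) \<noteq> 0"
    and IH: "D (q * v) (q * w) X \<xi> = 0"
  shows "((\<lambda>s. Th (t * x s a / x s b) * D v w (insert a (insert b X)) (x s)) \<longlongrightarrow> 0) G"
proof -
  interpret y: two_points p q t v w X a b "\<lambda>s. reflect v w (x s)" "reflect v w \<xi>" G by (rule y)
  interpret y': two_points p q t v w X b a "\<lambda>s. reflect v w (x s)" "reflect v w \<xi>" G by (rule y.swap)
  have yx: "t * reflect v w (x s) b / reflect v w (x s) a = t * x s a / x s b" for s
    using v_nonzero w_nonzero q_nonzero t_nonzero by (simp add: reflect_def)
  have nz: "\<xi> a \<noteq> 0" by (simp add: \<xi>_nonzero)
  have yb: "reflect v w \<xi> b = q * w / (v * \<xi> a)"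
    using v_nonzero w_nonzero q_nonzero t_nonzero nz by (simp add: reflect_def \<xi>ab)
  have "((\<lambda>s. Th (t * reflect v w (x s) b / reflect v w (x s) a) * F v w (insert b (insert a X)) (reflect v w (x s))) \<longlongrightarrow>
     pair_const v w * pair_factor v w (reflect v w \<xi> b) * (\<Prod>j\<in>X. K (reflect v w \<xi> b / reflect v w \<xi> j)) * F (q * v) (q * w) X (reflect v w \<xi>)) G"
    using ev t_nonzero by (intro y'.F_residue_pair t1) (simp_all only: yx, simp add: reflect_def \<xi>ab)
  moreover have "pair_factor v w (reflect v w \<xi> b) = pair_factor v w (\<xi> a)"
    unfolding yb using v_nonzero w_nonzero nz by (rule pair_factor_reflect)
  moreover have "K (reflect v w \<xi> b / reflect v w \<xi> j) = K (\<xi> a / \<xi> j)" if "j \<in> X" for j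
    using K_reflect[of "\<xi> a / \<xi> j"] \<xi>_nonzero[of j] nz that v_nonzero w_nonzero q_nonzero t_nonzero
    by (simp add: reflect_def \<xi>ab mult_ac)
  moreover have "F (q * v) (q * w) X (reflect v w \<xi>) = F (q * v) (q * w) X \<xi>"
  proof -
    have "reflect (q * v) (q * w) \<xi> = reflect v w \<xi>"
      using q_nonzero by (auto simp: reflect_def fun_eq_iff)
    then show ?thesis using IH by (simp add: D_def)
  qed
  ultimately have "((\<lambda>s. Th (t * x s a / x s b) * F v w (insert a (insert b X)) (reflect v w (x s))) \<longlongrightarrow>
     pair_const v w * pair_factor v w (\<xi> a) * (\<Prod>j\<in>X. K (\<xi> a / \<xi> j)) * F (q * v) (q * w) X \<xi>) G"
    by (simp add: yx insert_commute)
  from tendsto_diff[OF F_residue_pair[OF \<xi>ab ev t1] this] show ?thesis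
    by (simp add: D_def right_diff_distrib)
qed

subsection \<open>Multiplicatively independent parameters\<close>

lemma prod_powi_const:
  fixes c :: complex
  assumes "c \<noteq> 0" "finite X"
  shows "(\<Prod>i\<in>X. c powi k i) = c powi (\<Sum>i\<in>X. k i)"
  using assms(2) by induction (auto simp: power_int_add assms(1))

context theta_params
begin

text \<open>The classes of q, t, w, v and the x_i form a basis of a free abelian subgroup of the
  nonzero complex numbers modulo powers of \<open>p\<close>.\<close>

definition mult_independent :: "complex \<Rightarrow> complex \<Rightarrow> nat set \<Rightarrow> (nat \<Rightarrow> complex) \<Rightarrow> bool" where
  "mult_independent v w X x \<longleftrightarrow> v \<noteq> 0 \<and> w \<noteq> 0 \<and> (\<forall>i\<in>X. x i \<noteq> 0) \<and>
     (\<forall>\<alpha> \<beta> \<gamma> \<delta> k m. q powi \<alpha> * t powi \<beta> * w powi \<gamma> * v powi \<delta> * (\<Prod>i\<in>X. x i powi k i) = p powi m \<longrightarrow>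
        \<alpha> = 0 \<and> \<beta> = 0 \<and> \<gamma> = 0 \<and> \<delta> = 0 \<and> (\<forall>i\<in>X. k i = 0))"

lemma mult_independentD:
  assumes "mult_independent v w X x"
    "q powi \<alpha> * t powi \<beta> * w powi \<gamma> * v powi \<delta> * (\<Prod>i\<in>X. x i powi k i) = p powi m"
  shows "\<alpha> = 0 \<and> \<beta> = 0 \<and> \<gamma> = 0 \<and> \<delta> = 0 \<and> (\<forall>i\<in>X. k i = 0)"
  using assms unfolding mult_independent_def by blast

lemma mult_independent_nonzero: "mult_independent v w X x \<Longrightarrow> v \<noteq> 0" "mult_independent v w X x \<Longrightarrow> w \<noteq> 0" "mult_independent v w X x \<Longrightarrow> i \<in> X \<Longrightarrow> x i \<noteq> 0"
  by (auto simp: mult_independent_def)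

text \<open>The source of the non-vanishing conditions at the poles: each asks about theta at a
  nontrivial monomial in the parameters. The variants below fix how many variables occur.\<close>

lemma mult_independent_Th:
  assumes "mult_independent v w X x" "finite X" "\<alpha> \<noteq> 0 \<or> \<beta> \<noteq> 0 \<or> \<gamma> \<noteq> 0 \<or> \<delta> \<noteq> 0 \<or> (\<exists>i\<in>X. k i \<noteq> 0)"
  shows "Th (q powi \<alpha> * t powi \<beta> * w powi \<gamma> * v powi \<delta> * (\<Prod>i\<in>X. x i powi k i)) \<noteq> 0"
proof
  assume "Th (q powi \<alpha> * t powi \<beta> * w powi \<gamma> * v powi \<delta> * (\<Prod>i\<in>X. x i powi k i)) = 0"
  moreover have "q powi \<alpha> * t powi \<beta> * w powi \<gamma> * v powi \<delta> * (\<Prod>i\<in>X. x i powi k i) \<noteq> 0"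
    using assms(1,2) mult_independent_nonzero[OF assms(1)] q_nonzero t_nonzero by auto
  ultimately obtain m where "q powi \<alpha> * t powi \<beta> * w powi \<gamma> * v powi \<delta> * (\<Prod>i\<in>X. x i powi k i) = p powi m"
    using theta_eq_0D[OF p_less_1 p_nonzero] by blast
  from mult_independentD[OF assms(1) this] show False using assms(3) by blast
qed

lemma mult_independent_Th_0:
  assumes "mult_independent v w X x" "finite X" "\<alpha> \<noteq> 0 \<or> \<beta> \<noteq> 0 \<or> \<gamma> \<noteq> 0 \<or> \<delta> \<noteq> 0"
  shows "Th (q powi \<alpha> * t powi \<beta> * w powi \<gamma> * v powi \<delta>) \<noteq> 0"
  using mult_independent_Th[OF assms(1,2), of \<alpha> \<beta> \<gamma> \<delta> "\<lambda>_. 0"] assms(3) by simp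

lemma mult_independent_Th_1:
  assumes "mult_independent v w X x" "finite X" "i \<in> X" "e \<noteq> 0"
  shows "Th (q powi \<alpha> * t powi \<beta> * w powi \<gamma> * v powi \<delta> * x i powi e) \<noteq> 0"
proof -
  have "(\<Prod>l\<in>X. x l powi (if l = i then e else 0)) = (\<Prod>l\<in>{i}. x l powi (if l = i then e else 0))"
    using assms by (intro prod.mono_neutral_right) auto
  then show ?thesis
    using mult_independent_Th[OF assms(1,2), of \<alpha> \<beta> \<gamma> \<delta> "\<lambda>l. if l = i then e else 0"] assms(3,4) by auto
qed

lemma mult_independent_Th_2:
  assumes "mult_independent v w X x" "finite X" "i \<in> X" "j \<in> X" "i \<noteq> j" "e \<noteq> 0"
  shows "Th (q powi \<alpha> * t powi \<beta> * w powi \<gamma> * v powi \<delta> * x i powi e * x j powi f) \<noteq> 0"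
proof -
  let ?k = "\<lambda>l. if l = i then e else if l = j then f else 0"
  have "(\<Prod>l\<in>X. x l powi ?k l) = (\<Prod>l\<in>{i, j}. x l powi ?k l)"
    using assms by (intro prod.mono_neutral_right) auto
  then have "(\<Prod>l\<in>X. x l powi ?k l) = x i powi e * x j powi f"
    using assms(5) by simp
  moreover have "\<exists>l\<in>X. ?k l \<noteq> 0"
    using assms(3,6) by (intro bexI[of _ i]) auto
  ultimately show ?thesis
    using mult_independent_Th[OF assms(1,2), of \<alpha> \<beta> \<gamma> \<delta> ?k] by (simp add: mult.assoc)
qed

lemma mult_independent_subset:
  assumes "mult_independent v w Y x" "finite Y" "X \<subseteq> Y"
  shows "mult_independent v w X x"
  unfolding mult_independent_def
proof (intro conjI allI impI)
  fix \<alpha> \<beta> \<gamma> \<delta> k m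
  assume *: "q powi \<alpha> * t powi \<beta> * w powi \<gamma> * v powi \<delta> * (\<Prod>i\<in>X. x i powi k i) = p powi m"
  have "(\<Prod>i\<in>Y. x i powi (if i \<in> X then k i else 0)) = (\<Prod>i\<in>X. x i powi (if i \<in> X then k i else 0))"
    using assms by (intro prod.mono_neutral_right) auto
  then have "(\<Prod>i\<in>Y. x i powi (if i \<in> X then k i else 0)) = (\<Prod>i\<in>X. x i powi k i)" by simp
  with * have "q powi \<alpha> * t powi \<beta> * w powi \<gamma> * v powi \<delta> * (\<Prod>i\<in>Y. x i powi (if i \<in> X then k i else 0)) = p powi m"
    by simp
  from mult_independentD[OF assms(1) this] assms(3) show "\<alpha> = 0" "\<beta> = 0" "\<gamma> = 0" "\<delta> = 0" "\<forall>i\<in>X. k i = 0"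
    by auto (metis subsetD)
qed (use assms mult_independent_nonzero[OF assms(1)] in auto)

text \<open>The reflections and the shifts by \<open>q\<close> that occur in the induction are all of this shape.\<close>

lemma mult_independent_transform:
  assumes "mult_independent v w X x" "finite X"
    and x': "\<And>i. i \<in> X \<Longrightarrow> x' i = q powi a i * t powi b i * w powi c i * v powi d i * x i powi e i"
    and e: "\<And>i. i \<in> X \<Longrightarrow> e i \<noteq> (0::int)"
  shows "mult_independent (q powi r * v) (q powi s * w) X x'"
  unfolding mult_independent_def
proof (intro conjI allI impI)
  note nz = mult_independent_nonzero[OF assms(1)] q_nonzero t_nonzero
  fix \<alpha> \<beta> \<gamma> \<delta> k m
  assume *: "q powi \<alpha> * t powi \<beta> * (q powi s * w) powi \<gamma> * (q powi r * v) powi \<delta> * (\<Prod>i\<in>X. x' i powi k i) = p powi m"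
  have "(\<Prod>i\<in>X. x' i powi k i) = (\<Prod>i\<in>X. q powi (a i * k i) * t powi (b i * k i) * w powi (c i * k i) * v powi (d i * k i) * x i powi (e i * k i))"
    by (intro prod.cong refl) (simp add: x' power_int_mult_distrib power_int_mult[symmetric])
  also have "\<dots> = q powi (\<Sum>i\<in>X. a i * k i) * t powi (\<Sum>i\<in>X. b i * k i) * w powi (\<Sum>i\<in>X. c i * k i) * v powi (\<Sum>i\<in>X. d i * k i) * (\<Prod>i\<in>X. x i powi (e i * k i))"
    using nz assms(2) by (simp add: prod.distrib prod_powi_const)
  finally have "q powi (\<alpha> + s * \<gamma> + r * \<delta> + (\<Sum>i\<in>X. a i * k i)) * t powi (\<beta> + (\<Sum>i\<in>X. b i * k i)) *
     w powi (\<gamma> + (\<Sum>i\<in>X. c i * k i)) * v powi (\<delta> + (\<Sum>i\<in>X. d i * k i)) * (\<Prod>i\<in>X. x i powi (e i * k i)) = p powi m"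
    using * nz by (simp add: power_int_add power_int_mult_distrib power_int_mult[symmetric] mult_ac)
  from mult_independentD[OF assms(1) this] have 0: "\<alpha> + s * \<gamma> + r * \<delta> + (\<Sum>i\<in>X. a i * k i) = 0" "\<beta> + (\<Sum>i\<in>X. b i * k i) = 0"
    "\<gamma> + (\<Sum>i\<in>X. c i * k i) = 0" "\<delta> + (\<Sum>i\<in>X. d i * k i) = 0" "\<forall>i\<in>X. e i * k i = 0"
    by auto
  \<comment> \<open>The exponent of x_i is e_i k_i, so the k_i vanish first; the sums then drop out
    and a triangular system remains.\<close>
  then have k: "\<forall>i\<in>X. k i = 0" using e by auto
  then have "(\<Sum>i\<in>X. g i * k i) = 0" for g by (intro sum.neutral) auto
  then show "\<alpha> = 0" "\<beta> = 0" "\<gamma> = 0" "\<delta> = 0" "\<forall>i\<in>X. k i = 0"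
    using 0 k by auto
qed (use mult_independent_nonzero[OF assms(1)] q_nonzero t_nonzero x' in auto)

lemma mult_independent_reflect:
  assumes "mult_independent v w X x" "finite X"
  shows "mult_independent v w X (reflect v w x)"
  using mult_independent_transform[OF assms, of "reflect v w x" "\<lambda>_. 1" "\<lambda>_. 1" "\<lambda>_. 1" "\<lambda>_. -1" "\<lambda>_. -1" 0 0]
  by (simp add: reflect_def power_int_minus divide_inverse mult_ac)

lemma mult_independent_reflect_one:
  assumes "mult_independent v w X x" "finite X"
  shows "mult_independent v w X (x(a := t * q * w / v / x a))"
proof -
  \<comment> \<open>The exponent 1 - 2 e is -1 at the reflected coordinate and 1 elsewhere, hence
    never 0.\<close>
  let ?e = "\<lambda>i. if i = a then 1 else (0::int)"
  have "(x(a := t * q * w / v / x a)) i = q powi ?e i * t powi ?e i * w powi ?e i * v powi - ?e i * x i powi (1 - 2 * ?e i)" for i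
    by (simp add: power_int_minus divide_inverse mult_ac)
  then show ?thesis
    using mult_independent_transform[OF assms, of "x(a := t * q * w / v / x a)" ?e ?e ?e "\<lambda>i. - ?e i" "\<lambda>i. 1 - 2 * ?e i" 0 0]
    by (simp del: fun_upd_apply)
qed

lemma mult_independent_shift_left:
  assumes "mult_independent v w X x" "finite X"
  shows "mult_independent (q * v) w X (\<lambda>i. x i / q)"
  using mult_independent_transform[OF assms, of "\<lambda>i. x i / q" "\<lambda>_. -1" "\<lambda>_. 0" "\<lambda>_. 0" "\<lambda>_. 0" "\<lambda>_. 1" 1 0]
  by (simp add: power_int_minus divide_inverse mult_ac)

lemma mult_independent_shift_both:
  assumes "mult_independent v w X x" "finite X"
  shows "mult_independent (q * v) (q * w) X x"
  using mult_independent_transform[OF assms, of x "\<lambda>_. 0" "\<lambda>_. 0" "\<lambda>_. 0" "\<lambda>_. 0" "\<lambda>_. 1" 1 1]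
  by simp

lemma mult_independent_generic_const:
  assumes "mult_independent v w X x" "finite X"
  shows "generic_const v" "generic_const w"
proof -
  have "Th (q ^ n * v) \<noteq> 0" "Th (q ^ Suc n * v / t) \<noteq> 0" "Th (q ^ n * w) \<noteq> 0" "Th (q ^ Suc n * w / t) \<noteq> 0" for n
    using mult_independent_Th_0[OF assms, of "int n" 0 0 1] mult_independent_Th_0[OF assms, of "int (Suc n)" "-1" 0 1]
      mult_independent_Th_0[OF assms, of "int n" 0 1 0] mult_independent_Th_0[OF assms, of "int (Suc n)" "-1" 1 0]
    by (simp_all add: power_int_minus divide_inverse mult_ac del: of_nat_Suc power_Suc)
  then show "generic_const v" "generic_const w"
    using mult_independent_nonzero[OF assms(1)] by (auto simp: generic_const_def)
qed

lemma mult_independent_Th_t: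
  assumes "mult_independent v w X x" "finite X"
  shows "Th t \<noteq> 0" "Th (t * t) \<noteq> 0"
  using mult_independent_Th_0[OF assms, of 0 1 0 0] mult_independent_Th_0[OF assms, of 0 2 0 0] by (simp_all add: power2_eq_square)

text \<open>The free exponent \<open>e\<close> covers x_i together with t x_i and x_i / t, where
  pair poles are examined.\<close>

lemma mult_independent_regular_point:
  assumes "mult_independent v w X x" "finite X" "i \<in> X"
  shows "regular_point v w (t powi e * x i)"
proof -
  have "Th (t powi e * x i / q) \<noteq> 0" "Th (v * (t powi e * x i) / (t * w)) \<noteq> 0" "Th (t powi e * x i / (q ^ s * w)) \<noteq> 0" for s
    using mult_independent_Th_1[OF assms, of 1 "-1" e 0 0] mult_independent_Th_1[OF assms, of 1 0 "e - 1" "-1" 1] mult_independent_Th_1[OF assms, of 1 "- int s" e "-1" 0]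
    by (simp_all add: power_int_minus power_int_diff t_nonzero divide_inverse mult_ac)
  then show ?thesis
    using mult_independent_nonzero(3)[OF assms(1,3)] t_nonzero by (simp add: regular_point_def)
qed

lemma mult_independent_regular_pair:
  assumes "mult_independent v w X x" "finite X" "i \<in> X" "j \<in> X" "i \<noteq> j"
  shows "regular_pair (t powi e * x i) (x j) \<and> regular_pair (x j) (t powi e * x i)"
proof -
  have "Th (t powi e * x i / x j) \<noteq> 0" "Th (t * (t powi e * x i) / x j) \<noteq> 0"
    "Th (x j / (t powi e * x i)) \<noteq> 0" "Th (t * x j / (t powi e * x i)) \<noteq> 0"
    using mult_independent_Th_2[OF assms, of 1 0 e 0 0 "-1"] mult_independent_Th_2[OF assms, of 1 0 "e + 1" 0 0 "-1"]
      mult_independent_Th_2[OF assms, of "-1" 0 "-e" 0 0 1] mult_independent_Th_2[OF assms, of "-1" 0 "1 - e" 0 0 1]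
    by (simp_all add: power_int_minus power_int_diff power_int_add t_nonzero divide_inverse mult_ac)
  then show ?thesis by (simp add: regular_pair_def)
qed

lemma mult_independent_one_point:
  assumes "mult_independent v w (insert a X) x" "finite X" "a \<notin> X"
    and "\<And>i. i \<in> X \<Longrightarrow> \<xi> i = x i" "\<And>i. i \<in> insert a X \<Longrightarrow> ((\<lambda>s. x' s i) \<longlongrightarrow> \<xi> i) G"
    and "\<xi> a \<noteq> 0" "\<And>i. i \<in> X \<Longrightarrow> regular_pair (\<xi> a) (x i) \<and> regular_pair (x i) (\<xi> a)"
  shows "one_point p q t v w X a x' \<xi> G"
proof
  have fin: "finite (insert a X)" using assms by simp
  show "generic_const v" "generic_const w" using mult_independent_generic_const[OF assms(1) fin] by auto
  show "regular_point v w (\<xi> i)" if "i \<in> X" for i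
    using mult_independent_regular_point[OF assms(1) fin, of i 0] that assms(4) by simp
  show "regular_pair (\<xi> i) (\<xi> j)" if "i \<in> insert a X" "j \<in> insert a X" "i \<noteq> j" for i j
    using mult_independent_regular_pair[OF assms(1) fin that, of 0] that assms(3,4,7) by auto
qed (use assms in auto)

lemma mult_independent_two_points:
  assumes "mult_independent v w (insert a (insert b X)) x" "finite X" "a \<notin> X" "b \<notin> X" "a \<noteq> b"
    and "\<And>i. i \<in> insert b X \<Longrightarrow> \<xi> i = x i" "\<And>i. i \<in> insert a (insert b X) \<Longrightarrow> ((\<lambda>s. x' s i) \<longlongrightarrow> \<xi> i) G"
    and "\<xi> a = t powi e * x b"
  shows "two_points p q t v w X a b x' \<xi> G"
proof
  have fin: "finite (insert a (insert b X))" using assms by simp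
  show "v \<noteq> 0" "w \<noteq> 0" using mult_independent_nonzero[OF assms(1)] by auto
  have b: "\<xi> b = t powi 0 * x b" using assms(6) by simp
  show "regular_point v w (\<xi> i)" if "i \<in> insert a (insert b X)" for i
    using mult_independent_regular_point[OF assms(1) fin, of i 0] mult_independent_regular_point[OF assms(1) fin, of b e] that assms(6,8) by auto
  show "regular_pair (\<xi> i) (\<xi> j) \<and> regular_pair (\<xi> j) (\<xi> i)" if "i \<in> insert a (insert b X)" "j \<in> X" "i \<noteq> j" for i j
  proof -
    have "b \<noteq> j" using that assms(4) by auto
    then show ?thesis
      using mult_independent_regular_pair[OF assms(1) fin, of i j 0] mult_independent_regular_pair[OF assms(1) fin, of b j e] that assms(3,4,6,8) by auto
  qed
qed (use assms in auto)

end

subsection \<open>Vanishing for independent parameters\<close>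

lemma filterlim_divide_at:
  fixes c b :: complex
  assumes "c \<noteq> 0" "b \<noteq> 0"
  shows "filterlim (\<lambda>u. c / u) (at b) (at (c / b))"
proof -
  have "((\<lambda>u. c / u) \<longlongrightarrow> b) (at (c / b))"
    using assms by (auto intro!: tendsto_eq_intros)
  moreover have "eventually (\<lambda>u. u \<in> - {0} - {c / b}) (at (c / b))"
    using assms by (intro eventually_at_in_open) auto
  then have "eventually (\<lambda>u. c / u \<noteq> b) (at (c / b))"
    by eventually_elim (use assms in \<open>auto simp: field_simps\<close>)
  ultimately show ?thesis
    by (simp add: filterlim_at)
qed

section \<open>Replacing theta(z/b) or theta(b/z) by z - b in limits\<close>

context theta_params
begin

lemma simple_zero_limit:
  assumes "((\<lambda>z. Th (z / b) * f z) \<longlongrightarrow> 0) (at b)" "b \<noteq> 0"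
  shows "((\<lambda>z. (z - b) * f z) \<longlongrightarrow> 0) (at b)"
proof -
  obtain l where l: "((\<lambda>z. (z - b) / Th (z / b)) \<longlongrightarrow> l) (at b)"
    using tendsto_diff_div_theta[OF p_less_1 assms(2)] by blast
  have "((\<lambda>z. (z - b) / Th (z / b) * (Th (z / b) * f z)) \<longlongrightarrow> 0) (at b)"
    using tendsto_mult[OF l assms(1)] by simp
  moreover have "eventually (\<lambda>z. (z - b) / Th (z / b) * (Th (z / b) * f z) = (z - b) * f z) (at b)"
    using eventually_theta_nonzero[OF p_less_1 assms(2)] by eventually_elim simp
  ultimately show ?thesis
    by (rule Lim_transform_eventually)
qed

lemma simple_zero_limit_flip:
  assumes "((\<lambda>z. Th (b / z) * f z) \<longlongrightarrow> 0) (at b)" "b \<noteq> 0"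
  shows "((\<lambda>z. (z - b) * f z) \<longlongrightarrow> 0) (at b)"
proof (rule simple_zero_limit)
  have "((\<lambda>z. - (z / b) * (Th (b / z) * f z)) \<longlongrightarrow> - (b / b) * 0) (at b)"
    using assms by (intro tendsto_intros) auto
  then have "((\<lambda>z. - (z / b) * (Th (b / z) * f z)) \<longlongrightarrow> 0) (at b)" by simp
  moreover have "eventually (\<lambda>z. z \<in> - {0} - {b}) (at b)"
    using assms by (intro eventually_at_in_open) auto
  then have "eventually (\<lambda>z. - (z / b) * (Th (b / z) * f z) = Th (z / b) * f z) (at b)"
  proof eventually_elim
    case (elim z)
    then show ?case using Th_flip[of z b] assms(2) by simp
  qed
  ultimately show "((\<lambda>z. Th (z / b) * f z) \<longlongrightarrow> 0) (at b)"
    by (rule Lim_transform_eventually)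
qed (rule assms)

lemma Th_flip_nonzero: "x \<noteq> 0 \<Longrightarrow> y \<noteq> 0 \<Longrightarrow> Th (y / x) \<noteq> 0 \<Longrightarrow> Th (x / y) \<noteq> 0"
  using Th_flip[of x y] by simp

lemma eventually_Th_flip: "b \<noteq> 0 \<Longrightarrow> eventually (\<lambda>z. Th (b / z) \<noteq> 0) (at b)"
proof -
  assume b: "b \<noteq> 0"
  have "eventually (\<lambda>z. z \<in> - {0} - {b}) (at b)"
    using b by (intro eventually_at_in_open) auto
  with eventually_theta_nonzero[OF p_less_1 b] show ?thesis
  proof eventually_elim
    case (elim z)
    then show ?case using Th_flip[of b z] b by auto
  qed
qed

end

text \<open>The induction step in the variable x_a. The induction hypotheses quantify over all
  tuples, so the locale is closed under reflection; half of the poles are then obtained by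
  symmetry.\<close>

locale generic_point = theta_params +
  fixes v w :: complex and X :: "nat set" and a :: nat and x :: "nat \<Rightarrow> complex"
  assumes finite_X: "finite X" and a_notin: "a \<notin> X" and mult_independent: "mult_independent v w (insert a X) x"
    and IH_left: "\<And>y. mult_independent (q * v) w X y \<Longrightarrow> D (q * v) w X y = 0"
    and IH_both: "\<And>y j. j \<in> X \<Longrightarrow> mult_independent (q * v) (q * w) (X - {j}) y \<Longrightarrow> D (q * v) (q * w) (X - {j}) y = 0"
begin

abbreviation \<kappa> :: complex where "\<kappa> \<equiv> t * q * w / v"

definition f :: "complex \<Rightarrow> complex" where
  "f z = D v w (insert a X) (x(a := z))"

lemma fin: "finite (insert a X)" using finite_X by simp

lemma v_nonzero: "v \<noteq> 0" and w_nonzero: "w \<noteq> 0" and x_nonzero: "i \<in> insert a X \<Longrightarrow> x i \<noteq> 0"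
  using mult_independent_nonzero[OF mult_independent] by auto

lemma \<kappa>_nonzero: "\<kappa> \<noteq> 0"
  using v_nonzero w_nonzero q_nonzero t_nonzero by simp

lemma generic_point_reflect: "generic_point p q t v w X a (reflect v w x)"
  by unfold_locales (use finite_X a_notin mult_independent_reflect[OF mult_independent fin] IH_left IH_both in auto)

lemma f_reflect: "f z = - generic_point.f p q t v w X a (reflect v w x) (\<kappa> / z)"
proof -
  interpret y: generic_point p q t v w X a "reflect v w x" by (rule generic_point_reflect)
  have "y.f (\<kappa> / z) = D v w (insert a X) (reflect v w (x(a := z)))"
    unfolding y.f_def reflect_upd ..
  then show ?thesis
    using v_nonzero w_nonzero by (simp add: D_reflect f_def)
qed

lemma one_point_at:
  assumes "b \<noteq> 0" "\<And>i. i \<in> X \<Longrightarrow> regular_pair b (x i) \<and> regular_pair (x i) b"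
  shows "one_point p q t v w X a (\<lambda>z. x(a := z)) (x(a := b)) (at b)"
    "one_point p q t v w X a (\<lambda>z. reflect v w (x(a := z))) (reflect v w (x(a := b))) (at b)"
proof -
  show "one_point p q t v w X a (\<lambda>z. x(a := z)) (x(a := b)) (at b)"
    using assms a_notin by (intro mult_independent_one_point[OF mult_independent finite_X a_notin]) auto
  have "((\<lambda>z. reflect v w (x(a := z)) i) \<longlongrightarrow> reflect v w (x(a := b)) i) (at b)" for i
    using assms(1) v_nonzero by (cases "i = a") (auto simp: reflect_def intro!: tendsto_intros)
  moreover have "regular_pair (\<kappa> / b) (reflect v w x i) \<and> regular_pair (reflect v w x i) (\<kappa> / b)" if "i \<in> X" for i
    using assms(1) assms(2)[OF that] x_nonzero[of i] that v_nonzero w_nonzero q_nonzero t_nonzero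
    by (simp add: regular_pair_def reflect_def)
  ultimately show "one_point p q t v w X a (\<lambda>z. reflect v w (x(a := z))) (reflect v w (x(a := b))) (at b)"
    using assms(1) a_notin \<kappa>_nonzero
    by (intro mult_independent_one_point[OF mult_independent_reflect[OF mult_independent fin] finite_X a_notin]) (auto simp: reflect_upd)
qed

lemma f_isCont:
  assumes "z \<noteq> 0" "\<And>i. i \<in> X \<Longrightarrow> regular_pair z (x i) \<and> regular_pair (x i) z"
    and "Th (z / q) \<noteq> 0" "Th (v * z / (t * w)) \<noteq> 0" "\<And>s. Th (z / (q ^ Suc s * w)) \<noteq> 0"
    and "Th (\<kappa> / z / q) \<noteq> 0" "Th (v * (\<kappa> / z) / (t * w)) \<noteq> 0" "\<And>s. Th (\<kappa> / z / (q ^ Suc s * w)) \<noteq> 0"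
  shows "isCont f z"
proof -
  interpret one_point p q t v w X a "\<lambda>u. x(a := u)" "x(a := z)" "at z"
    using one_point_at[OF assms(1,2)] by blast
  interpret y: one_point p q t v w X a "\<lambda>u. reflect v w (x(a := u))" "reflect v w (x(a := z))" "at z"
    using one_point_at[OF assms(1,2)] by blast
  show ?thesis
    unfolding isCont_def f_def D_def using assms
    by (intro tendsto_diff F_regular y.F_regular) (simp_all add: reflect_upd del: power_Suc)
qed

lemma mult_independent_f_isCont:
  assumes "mult_independent v w (insert a X) (x(a := z))"
  shows "isCont f z"
proof (rule f_isCont)
  note g = assms
  have r: "regular_point v w z" "regular_point v w (\<kappa> / z)"
    using mult_independent_regular_point[OF g fin, of a 0] mult_independent_regular_point[OF mult_independent_reflect[OF g fin] fin, of a 0] by (simp_all add: reflect_def)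
  show "z \<noteq> 0" using mult_independent_nonzero(3)[OF g, of a] by simp
  show "regular_pair z (x i) \<and> regular_pair (x i) z" if "i \<in> X" for i
    using mult_independent_regular_pair[OF g fin, of a i 0] that a_notin by auto
  show "Th (z / q) \<noteq> 0" "Th (v * z / (t * w)) \<noteq> 0" "Th (z / (q ^ Suc s * w)) \<noteq> 0"
    "Th (\<kappa> / z / q) \<noteq> 0" "Th (v * (\<kappa> / z) / (t * w)) \<noteq> 0" "Th (\<kappa> / z / (q ^ Suc s * w)) \<noteq> 0" for s
    using r unfolding regular_point_def by blast+
qed

lemma limit_q: "((\<lambda>z. (z - q) * f z) \<longlongrightarrow> 0) (at q)"
proof (rule simple_zero_limit[OF _ q_nonzero])
  note m = power_int_minus divide_inverse mult_ac
  have "regular_pair q (x i) \<and> regular_pair (x i) q" if "i \<in> X" for i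
    using mult_independent_Th_1[OF mult_independent fin, of i "-1" 1 0 0 0] mult_independent_Th_1[OF mult_independent fin, of i "-1" 1 1 0 0]
      mult_independent_Th_1[OF mult_independent fin, of i 1 "-1" 0 0 0] mult_independent_Th_1[OF mult_independent fin, of i 1 "-1" 1 0 0] that
    by (simp add: regular_pair_def m)
  note op = one_point_at[OF q_nonzero this]
  interpret one_point p q t v w X a "\<lambda>z. x(a := z)" "x(a := q)" "at q"
    using op by blast
  have "((\<lambda>z. Th ((x(a := z)) a / q) * D v w (insert a X) (x(a := z))) \<longlongrightarrow> 0) (at q)"
  proof (rule D_residue_q[OF op(2)])
    show "(x(a := q)) a = q" by simp
    show "eventually (\<lambda>s. Th ((x(a := s)) a / q) \<noteq> 0) (at q)"
      using eventually_theta_nonzero[OF p_less_1 q_nonzero] by simp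
    show "Th (v * q / (t * w)) \<noteq> 0"
      using mult_independent_Th_0[OF mult_independent fin, of 1 "-1" "-1" 1] by (simp add: m)
    show "Th (q / (q ^ s * w)) \<noteq> 0" for s
      using mult_independent_Th_0[OF mult_independent fin, of "1 - int s" 0 "-1" 0] q_nonzero by (simp add: m power_int_diff)
    show "Th (t / (q ^ s * v)) \<noteq> 0" for s
      using mult_independent_Th_0[OF mult_independent fin, of "- int s" 1 0 "-1"] by (simp add: m)
    show "Th ((x(a := q)) i / (q * q)) \<noteq> 0" if "i \<in> X" for i
      using mult_independent_Th_1[OF mult_independent fin, of i 1 "-2" 0 0 0] that a_notin by (auto simp: m power2_eq_square)
    have "D (q * v) w X (\<lambda>i. x i / q) = 0"
      by (intro IH_left mult_independent_shift_left[OF mult_independent_subset[OF mult_independent fin] finite_X]) auto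
    moreover have "D (q * v) w X (\<lambda>i. (x(a := q)) i / q) = D (q * v) w X (\<lambda>i. x i / q)"
      unfolding D_def reflect_def using a_notin by (intro arg_cong2[where f = "(-)"] F_cong) auto
    ultimately show "D (q * v) w X (\<lambda>i. (x(a := q)) i / q) = 0" by simp
  qed
  then show "((\<lambda>z. Th (z / q) * f z) \<longlongrightarrow> 0) (at q)"
    by (simp add: f_def)
qed

lemma limit_spec: "((\<lambda>z. (z - q ^ Suc m * w) * f z) \<longlongrightarrow> 0) (at (q ^ Suc m * w))"
proof -
  define b where "b = q ^ Suc m * w"
  note s = power_int_minus divide_inverse mult_ac
  have b: "b \<noteq> 0" using q_nonzero w_nonzero by (simp add: b_def)
  have "regular_pair b (x i) \<and> regular_pair (x i) b" if "i \<in> X" for i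
    using mult_independent_Th_1[OF mult_independent fin, of i "-1" "int (Suc m)" 0 1 0] mult_independent_Th_1[OF mult_independent fin, of i "-1" "int (Suc m)" 1 1 0]
      mult_independent_Th_1[OF mult_independent fin, of i 1 "- int (Suc m)" 0 "-1" 0] mult_independent_Th_1[OF mult_independent fin, of i 1 "- int (Suc m)" 1 "-1" 0] that
    unfolding power_int_minus power_int_of_nat
    by (simp add: regular_pair_def b_def s)
  note op = one_point_at[OF b this]
  interpret one_point p q t v w X a "\<lambda>z. x(a := z)" "x(a := b)" "at b"
    using op by blast
  have "((\<lambda>z. Th ((x(a := z)) a / (q ^ Suc m * w)) * D v w (insert a X) (x(a := z))) \<longlongrightarrow> 0) (at b)"
  proof (rule D_residue_spec[OF op(2)])
    show "(x(a := b)) a = q ^ Suc m * w" by (simp add: b_def)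
    show "eventually (\<lambda>z. Th ((x(a := z)) a / (q ^ Suc m * w)) \<noteq> 0) (at b)"
      using eventually_theta_nonzero[OF p_less_1 b] by (simp add: b_def)
    show "Th (q ^ Suc m * v / t) \<noteq> 0"
      using mult_independent_generic_const[OF mult_independent fin] by (simp add: generic_const_def)
    show "Th (q ^ Suc m * w / (q ^ k * w)) \<noteq> 0" if "k \<noteq> Suc m" for k
    proof -
      have "q ^ Suc m * w / (q ^ k * w) = q powi (int (Suc m) - int k)"
        unfolding power_int_diff[OF disjI1[OF q_nonzero]] power_int_of_nat using w_nonzero by simp
      then show ?thesis
        using mult_independent_Th_0[OF mult_independent fin, of "int (Suc m) - int k" 0 0 0] that by simp
    qed
    \<comment> \<open>The reflected point is a monomial in t, q and v, from which independence gives
      regularity of F(y).\<close>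
    have yb: "reflect v w (x(a := b)) a = t / (q ^ m * v)"
      using q_nonzero w_nonzero by (simp add: reflect_def b_def)
    show "Th (reflect v w (x(a := b)) a / q) \<noteq> 0"
      unfolding yb using mult_independent_Th_0[OF mult_independent fin, of "- int (Suc m)" 1 0 "-1"] unfolding power_int_minus power_int_of_nat
      by (simp add: s)
    have yb': "v * (t / (q ^ m * v)) / (t * w) = 1 / (q ^ m * w)" using v_nonzero t_nonzero by simp
    show "Th (v * reflect v w (x(a := b)) a / (t * w)) \<noteq> 0"
      unfolding yb yb' using mult_independent_Th_0[OF mult_independent fin, of "- int m" 0 "-1" 0] by (simp add: s)
    show "Th (reflect v w (x(a := b)) a / (q ^ Suc k * w)) \<noteq> 0" for k
      unfolding yb using mult_independent_Th_0[OF mult_independent fin, of "- int (m + Suc k)" 1 "-1" "-1"] unfolding power_int_minus power_int_of_nat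
      by (simp add: s power_add)
  qed
  then have "((\<lambda>z. Th (z / b) * f z) \<longlongrightarrow> 0) (at b)"
    by (simp add: f_def b_def)
  from simple_zero_limit[OF this b] show ?thesis
    unfolding b_def .
qed

text \<open>The value e = 0 is the diagonal, e = 1 and e = -1 are the pair poles; reflection changes
  the sign of \<open>e\<close>.\<close>

lemma two_points_at:
  assumes "j \<in> X"
  shows "two_points p q t v w (X - {j}) a j (\<lambda>z. x(a := z)) (x(a := t powi e * x j)) (at (t powi e * x j))"
    "two_points p q t v w (X - {j}) a j (\<lambda>z. reflect v w (x(a := z))) (reflect v w (x(a := t powi e * x j))) (at (t powi e * x j))"
proof -
  have X: "insert j (X - {j}) = X" "finite (X - {j})" "a \<notin> X - {j}" "j \<notin> X - {j}" "a \<noteq> j"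
    using assms a_notin finite_X by auto
  have nz: "t powi e * x j \<noteq> 0" using t_nonzero x_nonzero[of j] assms by simp
  show "two_points p q t v w (X - {j}) a j (\<lambda>z. x(a := z)) (x(a := t powi e * x j)) (at (t powi e * x j))"
    using X mult_independent by (intro mult_independent_two_points[where x = x and e = e]) auto
  have lim: "((\<lambda>z. reflect v w (x(a := z)) i) \<longlongrightarrow> reflect v w (x(a := t powi e * x j)) i) (at (t powi e * x j))" for i
    using nz v_nonzero by (cases "i = a") (auto simp: reflect_def intro!: tendsto_intros)
  show "two_points p q t v w (X - {j}) a j (\<lambda>z. reflect v w (x(a := z))) (reflect v w (x(a := t powi e * x j))) (at (t powi e * x j))"
  proof (rule mult_independent_two_points[where x = "reflect v w x" and e = "- e", OF _ X(2-5)])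
    show "mult_independent v w (insert a (insert j (X - {j}))) (reflect v w x)"
      unfolding X(1) by (rule mult_independent_reflect[OF mult_independent fin])
    show "reflect v w (x(a := t powi e * x j)) i = reflect v w x i" if "i \<in> insert j (X - {j})" for i
      using that X by (auto simp: reflect_def)
    show "reflect v w (x(a := t powi e * x j)) a = t powi (- e) * reflect v w x j"
      by (simp add: reflect_def power_int_minus divide_inverse mult_ac)
  qed (rule lim)
qed

lemma limit_diagonal:
  assumes "j \<in> X"
  shows "((\<lambda>z. (z - x j) * f z) \<longlongrightarrow> 0) (at (x j))"
proof (rule simple_zero_limit)
  have X: "insert a (insert j (X - {j})) = insert a X" "a \<noteq> j" using assms a_notin by auto
  show nz: "x j \<noteq> 0" using x_nonzero[of j] assms by simp
  note tp = two_points_at[OF assms, of 0, simplified]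
  interpret two_points p q t v w "X - {j}" a j "\<lambda>z. x(a := z)" "x(a := x j)" "at (x j)" by (rule tp(1))
  show "((\<lambda>z. Th (z / x j) * f z) \<longlongrightarrow> 0) (at (x j))"
    using D_residue_diagonal[OF tp(2)] eventually_theta_nonzero[OF p_less_1 nz] mult_independent_Th_t[OF mult_independent fin] X
    by (simp add: f_def)
qed

lemma IH_pair:
  assumes "j \<in> X"
  shows "D (q * v) (q * w) (X - {j}) (x(a := z)) = 0"
proof -
  have "D (q * v) (q * w) (X - {j}) x = 0"
    using finite_X by (intro IH_both assms mult_independent_shift_both mult_independent_subset[OF mult_independent fin]) auto
  moreover have "D (q * v) (q * w) (X - {j}) (x(a := z)) = D (q * v) (q * w) (X - {j}) x"
    unfolding D_def reflect_def using a_notin by (intro arg_cong2[where f = "(-)"] F_cong) auto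
  ultimately show ?thesis by simp
qed

lemma limit_pair:
  assumes "j \<in> X"
  shows "((\<lambda>z. (z - x j / t) * f z) \<longlongrightarrow> 0) (at (x j / t))" "((\<lambda>z. (z - t * x j) * f z) \<longlongrightarrow> 0) (at (t * x j))"
proof -
  have X: "insert a (insert j (X - {j})) = insert a X" "insert j (insert a (X - {j})) = insert a X" "a \<noteq> j"
    using assms a_notin by auto
  have nz: "x j / t \<noteq> 0" "t * x j \<noteq> 0" using x_nonzero[of j] assms t_nonzero by auto
  have e: "t powi (-1) * x j = x j / t" by (simp add: power_int_minus divide_inverse)
  show "((\<lambda>z. (z - x j / t) * f z) \<longlongrightarrow> 0) (at (x j / t))"
  proof (rule simple_zero_limit)
    note tp = two_points_at[OF assms, of "-1", unfolded e]
    interpret two_points p q t v w "X - {j}" a j "\<lambda>z. x(a := z)" "x(a := x j / t)" "at (x j / t)" by (rule tp(1))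
    show "((\<lambda>z. Th (z / (x j / t)) * f z) \<longlongrightarrow> 0) (at (x j / t))"
      using D_residue_pair[OF tp(2)] eventually_theta_nonzero[OF p_less_1 nz(1)] mult_independent_Th_t[OF mult_independent fin] X IH_pair[OF assms] t_nonzero
      by (simp add: f_def mult_ac)
  qed (rule nz)
  show "((\<lambda>z. (z - t * x j) * f z) \<longlongrightarrow> 0) (at (t * x j))"
  \<comment> \<open>At t x_j the moving variable is the larger member of the pair, so the roles of
    \<open>a\<close> and \<open>j\<close> are exchanged and theta has z in the denominator.\<close>
  proof (rule simple_zero_limit_flip)
    note tp = two_points_at[OF assms, of 1, simplified]
    interpret two_points p q t v w "X - {j}" a j "\<lambda>z. x(a := z)" "x(a := t * x j)" "at (t * x j)" by (rule tp(1))
    interpret y: two_points p q t v w "X - {j}" a j "\<lambda>z. reflect v w (x(a := z))" "reflect v w (x(a := t * x j))" "at (t * x j)" by (rule tp(2))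
    interpret s: two_points p q t v w "X - {j}" j a "\<lambda>z. x(a := z)" "x(a := t * x j)" "at (t * x j)" by (rule swap)
    show "((\<lambda>z. Th (t * x j / z) * f z) \<longlongrightarrow> 0) (at (t * x j))"
      using s.D_residue_pair[OF y.swap] eventually_Th_flip[OF nz(2)] mult_independent_Th_t[OF mult_independent fin] X IH_pair[OF assms] t_nonzero
      by (simp add: f_def mult_ac)
  qed (rule nz)
qed

lemma reflect_limit:
  assumes "((\<lambda>z. (z - b) * generic_point.f p q t v w X a (reflect v w x) z) \<longlongrightarrow> 0) (at b)" "b \<noteq> 0"
  shows "((\<lambda>z. (z - \<kappa> / b) * f z) \<longlongrightarrow> 0) (at (\<kappa> / b))"
proof -
  interpret y: generic_point p q t v w X a "reflect v w x" by (rule generic_point_reflect)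
  have nz: "\<kappa> \<noteq> 0" "\<kappa> / b \<noteq> 0" using \<kappa>_nonzero assms(2) by auto
  have "((\<lambda>u. (\<kappa> / u - b) * y.f (\<kappa> / u)) \<longlongrightarrow> 0) (at (\<kappa> / b))"
    by (rule filterlim_compose[OF assms(1) filterlim_divide_at[OF nz(1) assms(2)]])
  \<comment> \<open>The factor u/b turns kappa/u - b into -(u - kappa/b), and its sign cancels the
    one in \<open>f_reflect\<close>.\<close>
  from tendsto_mult[OF tendsto_divide[OF tendsto_ident_at tendsto_const assms(2)] this]
  have "((\<lambda>u. u / b * ((\<kappa> / u - b) * y.f (\<kappa> / u))) \<longlongrightarrow> 0) (at (\<kappa> / b))" by simp
  moreover have "eventually (\<lambda>u. u \<in> - {0} - {\<kappa> / b}) (at (\<kappa> / b))"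
    using nz by (intro eventually_at_in_open) auto
  then have "eventually (\<lambda>u. u / b * ((\<kappa> / u - b) * y.f (\<kappa> / u)) = (u - \<kappa> / b) * f u) (at (\<kappa> / b))"
  proof eventually_elim
    case (elim u)
    have "u / b * (\<kappa> / u - b) = - (u - \<kappa> / b)"
      using elim assms(2) by (simp add: field_simps)
    then have "u / b * ((\<kappa> / u - b) * y.f (\<kappa> / u)) = - (u - \<kappa> / b) * y.f (\<kappa> / u)"
      by (simp only: mult.assoc[symmetric])
    then show ?case
      unfolding f_reflect by (simp only: mult_minus_left mult_minus_right)
  qed
  ultimately show ?thesis
    by (rule Lim_transform_eventually)
qed

lemma f_shift:
  assumes "z \<noteq> 0"
  shows "f (p * z) = f z"
proof -
  have "(x(a := z)) i \<noteq> 0" if "i \<in> insert a X" for i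
    using that assms x_nonzero by auto
  from D_shift[of v w "insert a X" "x(a := z)" a, OF v_nonzero w_nonzero this] show ?thesis
    by (simp add: f_def)
qed

text \<open>Zeros of theta(z/b) are translates of b by powers of \<open>p\<close>, so it suffices to
  examine one representative of each class of poles.\<close>

lemma limit_periodic:
  assumes "((\<lambda>z. (z - b) * f z) \<longlongrightarrow> 0) (at b)" "b \<noteq> 0" "Th (z0 / b) = 0" "z0 \<noteq> 0"
  shows "((\<lambda>z. (z - z0) * f z) \<longlongrightarrow> 0) (at z0)"
proof -
  obtain m where "z0 / b = p powi m"
    using theta_eq_0D[OF p_less_1 p_nonzero _ assms(3)] assms by auto
  then have z0: "z0 = p powi m * b" using assms(2) by (simp add: field_simps)
  define c where "c = p powi m"
  have c: "c \<noteq> 0" using p_nonzero by (simp add: c_def)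
  have pow: "f (p ^ k * z) = f z" if "z \<noteq> 0" for k z
    by (induction k) (use that p_nonzero in \<open>auto simp: f_shift mult.assoc\<close>)
  have per: "f (c * z) = f z" if "z \<noteq> 0" for z
  proof (cases "m \<ge> 0")
    case True
    then show ?thesis using pow[OF that, of "nat m"] by (simp add: c_def power_int_def)
  next
    case False
    then have "p ^ nat (- m) * (c * z) = z"
      using p_nonzero by (simp add: c_def power_int_def power_inverse)
    then show ?thesis using pow[of "c * z" "nat (- m)"] that c by (metis mult_eq_0_iff)
  qed
  have "filterlim (\<lambda>u. u / c) (at b) (at z0)"
    using c unfolding filterlim_at eventually_at_filter z0 c_def[symmetric]
    by (auto simp: field_simps intro!: tendsto_eq_intros always_eventually)
  from filterlim_compose[OF assms(1) this]
  have "((\<lambda>u. c * ((u / c - b) * f (u / c))) \<longlongrightarrow> c * 0) (at z0)"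
    by (intro tendsto_mult tendsto_const)
  then have "((\<lambda>u. c * ((u / c - b) * f (u / c))) \<longlongrightarrow> 0) (at z0)" by simp
  moreover have "eventually (\<lambda>u. u \<in> - {0} - {z0}) (at z0)"
    using assms(4) by (intro eventually_at_in_open) auto
  then have "eventually (\<lambda>u. c * ((u / c - b) * f (u / c)) = (u - z0) * f u) (at z0)"
  proof eventually_elim
    case (elim u)
    have "f (u / c) = f u" using per[of "u / c"] elim c by simp
    moreover have "c * (u / c - b) = u - z0" using c by (simp add: z0 c_def[symmetric] field_simps)
    ultimately show ?case by (simp add: mult.assoc[symmetric])
  qed
  ultimately show ?thesis
    by (rule Lim_transform_eventually)
qed

text \<open>The cases list all classes of possible poles of F(x) and F(y). The classes of q and
  q^(s+1) w come with their reflections; the pair classes are permuted by reflection and need no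
  extra cases. Elsewhere \<open>f\<close> is continuous.\<close>

lemma f_limit:
  assumes z: "z \<noteq> 0"
  shows "((\<lambda>u. (u - z) * f u) \<longlongrightarrow> 0) (at z)"
proof -
  interpret y: generic_point p q t v w X a "reflect v w x" by (rule generic_point_reflect)
  have qm: "q ^ Suc s * w \<noteq> 0" for s using q_nonzero w_nonzero by simp
  have L: ?thesis if "((\<lambda>z. (z - b) * f z) \<longlongrightarrow> 0) (at b)" "b \<noteq> 0" "Th (z / b) = 0" for b
    by (rule limit_periodic[OF that z])
  consider "Th (z / q) = 0" | "Th (z / (\<kappa> / q)) = 0" | s where "Th (z / (q ^ Suc s * w)) = 0"
    | s where "Th (z / (\<kappa> / (q ^ Suc s * w))) = 0"
    | j where "j \<in> X" "Th (z / x j) = 0" | j where "j \<in> X" "Th (z / (x j / t)) = 0" | j where "j \<in> X" "Th (z / (t * x j)) = 0"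
    | "Th (z / q) \<noteq> 0" "Th (z / (\<kappa> / q)) \<noteq> 0" "\<And>s. Th (z / (q ^ Suc s * w)) \<noteq> 0"
      "\<And>s. Th (z / (\<kappa> / (q ^ Suc s * w))) \<noteq> 0"
      "\<And>j. j \<in> X \<Longrightarrow> Th (z / x j) \<noteq> 0 \<and> Th (z / (x j / t)) \<noteq> 0 \<and> Th (z / (t * x j)) \<noteq> 0"
    by blast
  then show ?thesis
  proof cases
    case 1
    show ?thesis by (rule L[OF limit_q q_nonzero 1])
  next
    case 2
    show ?thesis by (rule L[OF reflect_limit[OF y.limit_q q_nonzero] _ 2]) (use \<kappa>_nonzero q_nonzero in auto)
  next
    case 3
    show ?thesis by (rule L[OF limit_spec qm 3])
  next
    case (4 s)
    show ?thesis by (rule L[OF reflect_limit[OF y.limit_spec qm] _ 4]) (use \<kappa>_nonzero qm[of s] in auto)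
  next
    case 5
    then show ?thesis using x_nonzero by (intro L[OF limit_diagonal]) auto
  next
    case 6
    then show ?thesis using x_nonzero t_nonzero by (intro L[OF limit_pair(1)]) auto
  next
    case 7
    then show ?thesis using x_nonzero t_nonzero by (intro L[OF limit_pair(2)]) auto
  next
    case 8
    have "isCont f z"
    proof (rule f_isCont[OF z])
      show "regular_pair z (x i) \<and> regular_pair (x i) z" if "i \<in> X" for i
        using 8(5)[OF that] x_nonzero[of i] that z t_nonzero Th_flip[of "x i" z] Th_flip[of "t * x i" z]
        by (auto simp: regular_pair_def mult_ac)
      show "Th (z / q) \<noteq> 0" "Th (z / (q ^ Suc s * w)) \<noteq> 0" for s
        by (rule 8)+
      have "v * z / (t * w) = z / (\<kappa> / q)" using q_nonzero by (simp add: mult_ac)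
      then show "Th (v * z / (t * w)) \<noteq> 0" using 8(2) by simp
      have "\<kappa> / z / q = \<kappa> / q / z" by (simp add: mult_ac)
      then show "Th (\<kappa> / z / q) \<noteq> 0"
        using 8(2) Th_flip_nonzero[of "\<kappa> / q" z] z \<kappa>_nonzero q_nonzero by simp
      have "v * (\<kappa> / z) / (t * w) = q / z" using v_nonzero w_nonzero t_nonzero by simp
      then show "Th (v * (\<kappa> / z) / (t * w)) \<noteq> 0"
        using 8(1) Th_flip[of q z] z q_nonzero by simp
      show "Th (\<kappa> / z / (q ^ Suc s * w)) \<noteq> 0" for s
      proof -
        have "\<kappa> / z / (q ^ Suc s * w) = \<kappa> / (q ^ Suc s * w) / z" by (simp add: mult_ac)
        then show ?thesis
          using Th_flip_nonzero[OF _ z 8(4)[of s]] \<kappa>_nonzero qm[of s] by (simp only:) (simp del: power_Suc)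
      qed
    qed
    then have "((\<lambda>u. (u - z) * f u) \<longlongrightarrow> (z - z) * f z) (at z)"
      unfolding isCont_def by (intro tendsto_intros)
    then show ?thesis by simp
  qed
qed

text \<open>Values are compared at independent tuples only, where \<open>f\<close> is continuous and
  so agrees with its holomorphic extension.\<close>

lemma f_const:
  assumes "mult_independent v w (insert a X) (x(a := z))" "mult_independent v w (insert a X) (x(a := z'))"
  shows "f z = f z'"
proof -
  have an: "(\<lambda>z. (x(a := z)) i) analytic_on - {0}" for i
    by (cases "i = a") (simp_all add: analytic_on_ident analytic_on_const)
  have nz: "(x(a := z)) i \<noteq> 0" "reflect v w (x(a := z)) i \<noteq> 0" if "i \<in> insert a X" "z \<in> - {0}" for i z
    using that v_nonzero w_nonzero x_nonzero q_nonzero t_nonzero by (auto simp: reflect_def)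
  have an': "(\<lambda>z. reflect v w (x(a := z)) i) analytic_on - {0}" if "i \<in> insert a X" for i
    unfolding reflect_def by (rule analytic_on_divide[OF analytic_on_const an]) (rule nz[OF that])
  have "(\<lambda>z. D v w (insert a X) (x(a := z))) meromorphic_on - {0}"
    unfolding D_def by (rule meromorphic_on_diff; rule F_meromorphic[OF v_nonzero w_nonzero]; (rule an | rule an', assumption | rule nz; assumption))
  then have "f meromorphic_on - {0}"
    by (simp add: f_def[abs_def])
  then have "isolated_singularity_at f z" if "z \<noteq> 0" for z
    using that meromorphic_on_subset[of f "- {0}" "{z}"] by (intro meromorphic_on_isolated_singularity) auto
  from elliptic_without_poles_constant[OF p_less_1 p_nonzero f_shift this f_limit]
  obtain c where c: "\<And>z. z \<noteq> 0 \<Longrightarrow> isCont f z \<Longrightarrow> f z = c" by blast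
  have "f u = c" if "mult_independent v w (insert a X) (x(a := u))" for u
    using c[OF _ mult_independent_f_isCont[OF that]] mult_independent_nonzero(3)[OF that, of a] by simp
  then show ?thesis using assms by simp
qed

end

text \<open>The induction leaves \<open>v\<close> and \<open>w\<close> arbitrary because the smaller
  instances have shifted parameters. No separate base case arises: for empty \<open>X\<close> a
  tuple and its reflection agree on \<open>X\<close>, while \<open>D\<close> changes sign.\<close>

theorem (in theta_params) D_eq_0:
  assumes "finite X" "mult_independent v w X x"
  shows "D v w X x = 0"
  using assms
proof (induction "card X" arbitrary: X v w x rule: less_induct)
  case less
  note nz = mult_independent_nonzero[OF less.prems(2)]
  \<comment> \<open>Reflecting a single coordinate preserves independence, so constancy in that
    coordinate applies to both values.\<close>
  have step: "D v w X (y(a := t * q * w / v / y a)) = D v w X y" if "mult_independent v w X y" "a \<in> X" for y a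
  proof -
    have X: "insert a (X - {a}) = X" "finite (X - {a})" using that less.prems by auto
    interpret generic_point p q t v w "X - {a}" a y
    proof
      show "D (q * v) w (X - {a}) z = 0" if "mult_independent (q * v) w (X - {a}) z" for z
        using that \<open>a \<in> X\<close> less.prems by (intro less.hyps psubset_card_mono) auto
      show "D (q * v) (q * w) (X - {a} - {j}) z = 0" if "mult_independent (q * v) (q * w) (X - {a} - {j}) z" for z j
        using that \<open>a \<in> X\<close> less.prems by (intro less.hyps psubset_card_mono) auto
    qed (use X that in auto)
    show ?thesis
      using f_const[of "t * q * w / v / y a" "y a"] mult_independent_reflect_one[OF that(1) less.prems(1), of a] that X
      by (simp add: f_def)
  qed
  have "mult_independent v w X (\<lambda>i. if i \<in> Y then reflect v w x i else x i) \<and>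
      D v w X (\<lambda>i. if i \<in> Y then reflect v w x i else x i) = D v w X x" if "Y \<subseteq> X" for Y
    using finite_subset[OF that less.prems(1)] that
  proof (induction Y rule: finite_induct)
    case empty
    then show ?case using less.prems by simp
  next
    case (insert a Y)
    let ?y = "\<lambda>i. if i \<in> Y then reflect v w x i else x i"
    have "(\<lambda>i. if i \<in> insert a Y then reflect v w x i else x i) = ?y(a := t * q * w / v / ?y a)"
      using insert.hyps by (auto simp: reflect_def)
    moreover have g: "mult_independent v w X ?y" "D v w X ?y = D v w X x"
      using insert.IH insert.prems by auto
    ultimately show ?case
      using step[OF g(1), of a] mult_independent_reflect_one[OF g(1) less.prems(1), of a] insert.prems g(2) by simp
  qed
  from this[of X] have "D v w X (\<lambda>i. if i \<in> X then reflect v w x i else x i) = D v w X x" by simp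
  also have "D v w X (\<lambda>i. if i \<in> X then reflect v w x i else x i) = D v w X (reflect v w x)"
    unfolding D_def by (intro arg_cong2[where f = "(-)"] F_cong) (auto simp: reflect_def)
  finally show ?case
    using D_reflect[OF nz(1,2), of X x] by simp
qed

subsection \<open>Passage to arbitrary parameters\<close>

text \<open>The equation splits into countably many polynomial equations P = Ln c + 2 pi i n, each
  with finitely many roots as P is not constant.\<close>

lemma countable_exp_poly_eq:
  fixes P :: "complex poly"
  assumes "coeff P (Suc i) \<noteq> 0" "c \<noteq> 0"
  shows "countable {\<epsilon>. exp (poly P \<epsilon>) = c}"
proof -
  let ?Z = "\<lambda>n::int. {\<epsilon>. poly (P - [:Ln c + of_int (2 * n) * pi * \<i>:]) \<epsilon> = 0}"
  have nz: "P - [:Ln c + of_int (2 * n) * pi * \<i>:] \<noteq> 0" for n :: int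
  proof
    assume "P - [:Ln c + of_int (2 * n) * pi * \<i>:] = 0"
    then have "coeff (P - [:Ln c + of_int (2 * n) * pi * \<i>:]) (Suc i) = 0" by simp
    then show False using assms(1) by simp
  qed
  have "countable (\<Union>n. ?Z n)"
    by (rule countable_UN) (simp_all only: countable_finite[OF poly_roots_finite[OF nz]] countableI_type)
  moreover have "{\<epsilon>. exp (poly P \<epsilon>) = c} \<subseteq> (\<Union>n. ?Z n)"
  proof
    fix \<epsilon> assume "\<epsilon> \<in> {\<epsilon>. exp (poly P \<epsilon>) = c}"
    then have "exp (poly P \<epsilon>) = exp (Ln c)" using assms(2) by simp
    then obtain n :: int where "poly P \<epsilon> = Ln c + of_int (2 * n) * pi * \<i>"
      unfolding exp_eq by auto
    then show "\<epsilon> \<in> (\<Union>n. ?Z n)" by auto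
  qed
  ultimately show ?thesis by (rule countable_subset[rotated])
qed

text \<open>The exponents \<open>\<epsilon>, \<epsilon>\<^sup>2, \<epsilon>\<^sup>3, \<dots>\<close> make every nontrivial monomial in the perturbed parameters
  a nonconstant function of \<open>\<epsilon>\<close>.\<close>

lemma exists_independent_perturbation:
  fixes p :: complex and u :: "nat \<Rightarrow> complex"
  assumes "p \<noteq> 0" "\<And>i. i < N \<Longrightarrow> u i \<noteq> 0" "\<delta> > 0"
  shows "\<exists>\<epsilon>. norm \<epsilon> < \<delta> \<and> (\<forall>k m. (\<Prod>i<N. (u i * exp (\<epsilon> ^ Suc i)) powi k i) = p powi m \<longrightarrow> (\<forall>i<N. k i = 0))"
proof -
  \<comment> \<open>Exponent vectors are taken extensional on the first N indices, since the set of
    all functions from nat to int is uncountable.\<close>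
  define KS where "KS = ({..<N} \<rightarrow>\<^sub>E (UNIV :: int set)) - {k. \<forall>i<N. k i = 0}"
  define bad where "bad = (\<lambda>(k, m). {\<epsilon>. (\<Prod>i<N. (u i * exp (\<epsilon> ^ Suc i)) powi k i) = p powi m})"
  have "countable (bad (k, m))" if "k \<in> KS" for k m
  proof -
    define C where "C = (\<Prod>i<N. u i powi k i)"
    have C: "C \<noteq> 0" using assms(2) by (auto simp: C_def)
    \<comment> \<open>The perturbed monomial equals C exp(P(\<epsilon>)); distinct degrees prevent
      cancellation among the exponents.\<close>
    define P :: "complex poly" where "P = (\<Sum>i<N. monom (of_int (k i)) (Suc i))"
    have "\<exists>i<N. k i \<noteq> 0" using that by (auto simp: KS_def)
    then obtain i where i: "i < N" "k i \<noteq> 0" by blast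
    have "coeff P (Suc i) = (\<Sum>j<N. if j = i then of_int (k j) else 0)"
      unfolding P_def coeff_sum by (intro sum.cong) auto
    then have "coeff P (Suc i) \<noteq> 0" using i by simp
    moreover have "bad (k, m) = {\<epsilon>. exp (poly P \<epsilon>) = p powi m / C}"
    proof -
      have "(\<Prod>i<N. (u i * exp (\<epsilon> ^ Suc i)) powi k i) = C * exp (poly P \<epsilon>)" for \<epsilon>
        unfolding C_def P_def poly_sum exp_sum[OF finite_lessThan] prod.distrib[symmetric]
        by (intro prod.cong) (simp_all add: power_int_mult_distrib poly_monom exp_power_int mult.commute)
      then show ?thesis using C by (auto simp: bad_def field_simps)
    qed
    ultimately show ?thesis
      using countable_exp_poly_eq[of P i "p powi m / C"] C assms(1) by simp
  qed
  moreover have "countable KS"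
    unfolding KS_def by (intro countable_Diff countable_PiE) auto
  ultimately have "countable (\<Union>km\<in>KS \<times> UNIV. bad km)"
    by (intro countable_UN countable_SIGMA) auto
  \<comment> \<open>A ball is uncountable, so some \<epsilon> in it violates no relation at
    all.\<close>
  then have "\<not> ball 0 \<delta> \<subseteq> (\<Union>km\<in>KS \<times> UNIV. bad km)"
    using uncountable_ball[OF assms(3), of "0::complex"] countable_subset by blast
  then obtain \<epsilon> where \<epsilon>: "norm \<epsilon> < \<delta>" "\<And>k m. k \<in> KS \<Longrightarrow> \<epsilon> \<notin> bad (k, m)"
    by (auto simp: subset_iff)
  have "\<forall>i<N. k i = 0" if "(\<Prod>i<N. (u i * exp (\<epsilon> ^ Suc i)) powi k i) = p powi m" for k m
  proof (rule ccontr)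
    assume "\<not> (\<forall>i<N. k i = 0)"
    then have "restrict k {..<N} \<in> KS" by (auto simp: KS_def)
    moreover have "\<epsilon> \<in> bad (restrict k {..<N}, m)"
      using that by (simp add: bad_def)
    ultimately show False using \<epsilon>(2) by blast
  qed
  then show ?thesis using \<epsilon>(1) by blast
qed

section \<open>Both sides of the identity in terms of the normalised sum\<close>

context theta_params
begin

definition phi :: "complex \<Rightarrow> complex \<Rightarrow> complex \<Rightarrow> complex" where
  "phi v w z = Th (z / q) * Th (v * z / (t * w)) / (Th (z / t) * Th (v * z / (q * w)))"

lemma theta_facts_eq_fact_ratio: "theta_facts q p [v, w] r / theta_facts q p [q * v / t, q * w / t] r = fact_ratio v w r"
  by (simp add: theta_facts_def theta_fact_def fact_ratio_def)

text \<open>Every variable contributes its factor \<phi> whether its index lies in \<open>I\<close>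
  or not, so the product over all indices leaves the sum.\<close>

lemma sum_card_eq_F:
  assumes "\<And>r i. i \<in> {1..n} \<Longrightarrow> f r i = A w r (z i) * \<phi> i" "\<And>r i. i \<in> {1..n} \<Longrightarrow> g r i = B v w r (z i) * \<phi> i"
    "\<And>i j. i \<in> {1..n} \<Longrightarrow> j \<in> {1..n} \<Longrightarrow> h i j = K (z i / z j)"
  shows "(\<Sum>r=0..n. fact_ratio v w r * (\<Sum>I | I \<subseteq> {1..n} \<and> card I = r. (\<Prod>i\<in>I. f r i) * (\<Prod>j\<in>{1..n} - I. g r j) *
     (\<Prod>i\<in>I. \<Prod>j\<in>{1..n} - I. h i j))) = (\<Prod>i\<in>{1..n}. \<phi> i) * F v w {1..n} z"
proof -
  have "(\<Sum>r=0..n. fact_ratio v w r * (\<Sum>I | I \<subseteq> {1..n} \<and> card I = r. (\<Prod>i\<in>I. f r i) * (\<Prod>j\<in>{1..n} - I. g r j) *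
     (\<Prod>i\<in>I. \<Prod>j\<in>{1..n} - I. h i j)))
   = (\<Sum>r=0..n. \<Sum>I\<in>{I \<in> Pow {1..n}. card I = r}. (\<Prod>i\<in>{1..n}. \<phi> i) * (fact_ratio v w (card I) * W v w {1..n} z I (card I)))"
    unfolding sum_distrib_left
  proof (intro sum.cong refl)
    fix r I assume "I \<in> {I \<in> Pow {1..n}. card I = r}"
    then have I: "I \<subseteq> {1..n}" "card I = r" by auto
    have "(\<Prod>i\<in>I. f r i) = (\<Prod>i\<in>I. A w r (z i)) * (\<Prod>i\<in>I. \<phi> i)"
      unfolding prod.distrib[symmetric] using I by (intro prod.cong refl assms) auto
    moreover have "(\<Prod>i\<in>{1..n} - I. g r i) = (\<Prod>i\<in>{1..n} - I. B v w r (z i)) * (\<Prod>i\<in>{1..n} - I. \<phi> i)"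
      unfolding prod.distrib[symmetric] using I by (intro prod.cong refl assms) auto
    moreover have "(\<Prod>i\<in>I. \<Prod>j\<in>{1..n} - I. h i j) = (\<Prod>i\<in>I. \<Prod>j\<in>{1..n} - I. K (z i / z j))"
      using I by (intro prod.cong refl assms) auto
    moreover have "(\<Prod>i\<in>{1..n}. \<phi> i) = (\<Prod>i\<in>{1..n} - I. \<phi> i) * (\<Prod>i\<in>I. \<phi> i)"
      using I by (intro prod.subset_diff) auto
    ultimately show "fact_ratio v w r * ((\<Prod>i\<in>I. f r i) * (\<Prod>j\<in>{1..n} - I. g r j) * (\<Prod>i\<in>I. \<Prod>j\<in>{1..n} - I. h i j))
      = (\<Prod>i\<in>{1..n}. \<phi> i) * (fact_ratio v w (card I) * W v w {1..n} z I (card I))"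
      by (simp add: W_def I(2) mult_ac)
  qed (auto simp: Pow_def)
  also have "\<dots> = (\<Sum>I\<in>Pow {1..n}. (\<Prod>i\<in>{1..n}. \<phi> i) * (fact_ratio v w (card I) * W v w {1..n} z I (card I)))"
    using card_mono[of "{1..n}"] by (intro sum.group) fastforce+
  finally show ?thesis
    by (simp add: F_def sum_distrib_left)
qed

lemma A_mult_phi:
  assumes "Th (z / q) \<noteq> 0" "Th (z / t) \<noteq> 0"
  shows "q * Th (v * z / (t * w)) * Th (t * q powi (- int r) * z / (q * w)) /
     (t * Th (v * z / (q * w)) * Th (q powi (- int r) * z / w)) = A w r z * phi v w z"
proof -
  have "t * q powi (- int r) * z / (q * w) = t * z / (q ^ Suc r * w)" "q powi (- int r) * z / w = z / (q ^ r * w)"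
    by (simp_all add: power_int_minus divide_inverse mult_ac)
  then show ?thesis using assms by (simp add: A_def phi_def mult_ac)
qed

lemma B_mult_phi:
  assumes "Th (v * z / (t * w)) \<noteq> 0" "Th (v * z / (q * w)) \<noteq> 0"
  shows "Th (z / q) * Th (q powi (- int r) * z / (t * w)) / (Th (z / t) * Th (q powi (- int r) * z / (q * w)))
    = B v w r z * phi v w z"
proof -
  have "q powi (- int r) * z / (t * w) = z / (q ^ r * t * w)" "q powi (- int r) * z / (q * w) = z / (q ^ Suc r * w)"
    by (simp_all add: power_int_minus divide_inverse mult_ac)
  then show ?thesis using assms by (simp add: B_def phi_def mult_ac)
qed

text \<open>The right side's factor is the left side's factor at the reflected point, while phi
  stays at z: phi has the same value at both points.\<close>

lemma A_reflect_mult_phi: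
  assumes "v \<noteq> 0" "w \<noteq> 0" "z \<noteq> 0" "Th (v * z / (t * w)) \<noteq> 0" "Th (v * z / (q * w)) \<noteq> 0"
  shows "q * Th (z / q) * Th (q ^ r * v * z / t ^ 2) / (t * Th (z / t) * Th (q ^ r * v * z / (t * q)))
    = A w r (t * q * w / v / z) * phi v w z"
proof -
  have "t * q * w / v / z / t = (q * w) / (v * z)" "t * (t * q * w / v / z) / (q ^ Suc r * w) = t ^ 2 / (q ^ r * v * z)"
     "t * q * w / v / z / q = (t * w) / (v * z)" "t * q * w / v / z / (q ^ r * w) = (t * q) / (q ^ r * v * z)"
    using assms(1-3) q_nonzero t_nonzero by (simp_all add: power2_eq_square)
  then have eq: "A w r (t * q * w / v / z) = q * Th ((q * w) / (v * z)) * Th (t ^ 2 / (q ^ r * v * z)) /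
        (t * Th ((t * w) / (v * z)) * Th ((t * q) / (q ^ r * v * z)))"
    unfolding A_def by simp
  have eqs: "Th ((q * w) / (v * z)) = - ((q * w) / (v * z)) * Th (v * z / (q * w))"
    "Th (t ^ 2 / (q ^ r * v * z)) = - (t ^ 2 / (q ^ r * v * z)) * Th (q ^ r * v * z / t ^ 2)"
    "Th ((t * w) / (v * z)) = - ((t * w) / (v * z)) * Th (v * z / (t * w))"
    "Th ((t * q) / (q ^ r * v * z)) = - ((t * q) / (q ^ r * v * z)) * Th (q ^ r * v * z / (t * q))"
    by (rule Th_flip; use assms(1-3) q_nonzero t_nonzero in simp)+
  show ?thesis
    unfolding eq eqs phi_def using assms q_nonzero t_nonzero
    by (simp add: divide_simps) (simp add: power2_eq_square)
qed

lemma B_reflect_mult_phi: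
  assumes "v \<noteq> 0" "w \<noteq> 0" "z \<noteq> 0" "Th (z / q) \<noteq> 0" "Th (z / t) \<noteq> 0"
  shows "Th (v * z / (t * w)) * Th (q ^ r * v * z / q) / (Th (v * z / (q * w)) * Th (q ^ r * v * z / t))
    = B v w r (t * q * w / v / z) * phi v w z"
proof -
  have "v * (t * q * w / v / z) / (q * w) = t / z" "t * q * w / v / z / (q ^ r * t * w) = q / (q ^ r * v * z)"
     "v * (t * q * w / v / z) / (t * w) = q / z" "t * q * w / v / z / (q ^ Suc r * w) = t / (q ^ r * v * z)"
    using assms(1-3) q_nonzero t_nonzero by simp_all
  then have eq: "B v w r (t * q * w / v / z) = Th (t / z) * Th (q / (q ^ r * v * z)) /
        (Th (q / z) * Th (t / (q ^ r * v * z)))"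
    unfolding B_def by simp
  have eqs: "Th (t / z) = - (t / z) * Th (z / t)"
    "Th (q / (q ^ r * v * z)) = - (q / (q ^ r * v * z)) * Th (q ^ r * v * z / q)"
    "Th (q / z) = - (q / z) * Th (z / q)"
    "Th (t / (q ^ r * v * z)) = - (t / (q ^ r * v * z)) * Th (q ^ r * v * z / t)"
    by (rule Th_flip; use assms(1-3) q_nonzero t_nonzero in simp)+
  show ?thesis
    unfolding eq eqs phi_def using assms q_nonzero t_nonzero
    by (simp add: divide_simps)
qed

end

text \<open>All parameters, the nome included, are arguments because the final limit moves them
  simultaneously.\<close>

definition lhs_sum :: "complex \<Rightarrow> complex \<Rightarrow> complex \<Rightarrow> complex \<Rightarrow> complex \<Rightarrow> nat \<Rightarrow> (nat \<Rightarrow> complex) \<Rightarrow> complex" where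
  "lhs_sum p v w q t n x =
    (\<Sum>r=0..n. theta_facts q p [v, w] r / theta_facts q p [q * v / t, q * w / t] r *
        (\<Sum>I | I \<subseteq> {1..n} \<and> card I = r.
          (\<Prod>i\<in>I. q * theta p (v * x i / (t * w)) * theta p (t * q powi (- int r) * x i / (q * w)) /
                  (t * theta p (v * x i / (q * w)) * theta p (q powi (- int r) * x i / w))) *
          (\<Prod>j\<in>{1..n} - I. theta p (x j / q) * theta p (q powi (- int r) * x j / (t * w)) /
                  (theta p (x j / t) * theta p (q powi (- int r) * x j / (q * w)))) *
          (\<Prod>i\<in>I. \<Prod>j\<in>{1..n} - I. theta p (t * x i / (q * x j)) * theta p (q * x i / x j) /
                  (theta p (x i / x j) * theta p (t * x i / x j)))))"

definition rhs_sum :: "complex \<Rightarrow> complex \<Rightarrow> complex \<Rightarrow> complex \<Rightarrow> complex \<Rightarrow> nat \<Rightarrow> (nat \<Rightarrow> complex) \<Rightarrow> complex" where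
  "rhs_sum p v w q t n x =
     (\<Sum>r=0..n. theta_facts q p [v, w] r / theta_facts q p [q * v / t, q * w / t] r *
        (\<Sum>I | I \<subseteq> {1..n} \<and> card I = r.
          (\<Prod>i\<in>I. q * theta p (x i / q) * theta p (q ^ r * v * x i / t ^ 2) /
                  (t * theta p (x i / t) * theta p (q ^ r * v * x i / (t * q)))) *
          (\<Prod>j\<in>{1..n} - I. theta p (v * x j / (t * w)) * theta p (q ^ r * v * x j / q) /
                  (theta p (v * x j / (q * w)) * theta p (q ^ r * v * x j / t))) *
          (\<Prod>i\<in>I. \<Prod>j\<in>{1..n} - I. theta p (t * x j / (q * x i)) * theta p (q * x j / x i) /
                  (theta p (x j / x i) * theta p (t * x j / x i)))))"

lemma (in theta_params) mult_independent_lhs_eq_rhs: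
  assumes mult_independent: "mult_independent v w {1..n} x"
  shows "lhs_sum p v w q t n x = rhs_sum p v w q t n x"
proof -
  note nz = mult_independent_nonzero[OF mult_independent] q_nonzero t_nonzero
  have Tn: "Th (x i / q) \<noteq> 0" "Th (x i / t) \<noteq> 0" "Th (v * x i / (t * w)) \<noteq> 0" "Th (v * x i / (q * w)) \<noteq> 0"
    if "i \<in> {1..n}" for i
    using mult_independent_Th_1[OF mult_independent finite_atLeastAtMost that, of 1 "-1" 0 0 0] mult_independent_Th_1[OF mult_independent finite_atLeastAtMost that, of 1 0 "-1" 0 0]
      mult_independent_Th_1[OF mult_independent finite_atLeastAtMost that, of 1 0 "-1" "-1" 1] mult_independent_Th_1[OF mult_independent finite_atLeastAtMost that, of 1 "-1" 0 "-1" 1]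
    by (simp_all add: power_int_minus divide_inverse mult_ac)
  have "lhs_sum p v w q t n x = (\<Prod>i\<in>{1..n}. phi v w (x i)) * F v w {1..n} x"
    unfolding lhs_sum_def theta_facts_eq_fact_ratio
  proof (rule sum_card_eq_F)
    show "Th (t * x i / (q * x j)) * Th (q * x i / x j) / (Th (x i / x j) * Th (t * x i / x j)) = K (x i / x j)" for i j
      by (simp add: K_def mult_ac)
  qed (use Tn A_mult_phi B_mult_phi in auto)
  moreover have "rhs_sum p v w q t n x = (\<Prod>i\<in>{1..n}. phi v w (x i)) * F v w {1..n} (reflect v w x)"
    unfolding rhs_sum_def theta_facts_eq_fact_ratio
  proof (rule sum_card_eq_F)
    fix r i assume i: "i \<in> {1..n}"
    show "q * Th (x i / q) * Th (q ^ r * v * x i / t ^ 2) / (t * Th (x i / t) * Th (q ^ r * v * x i / (t * q)))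
        = A w r (reflect v w x i) * phi v w (x i)"
      unfolding reflect_def using nz(1,2) nz(3)[OF i] Tn(3,4)[OF i] by (rule A_reflect_mult_phi)
    show "Th (v * x i / (t * w)) * Th (q ^ r * v * x i / q) / (Th (v * x i / (q * w)) * Th (q ^ r * v * x i / t))
        = B v w r (reflect v w x i) * phi v w (x i)"
      unfolding reflect_def using nz(1,2) nz(3)[OF i] Tn(1,2)[OF i] by (rule B_reflect_mult_phi)
  next
    \<comment> \<open>Reflection inverts ratios, which accounts for the exchanged roles of i and j
      on the right side.\<close>
    show "Th (t * x j / (q * x i)) * Th (q * x j / x i) / (Th (x j / x i) * Th (t * x j / x i)) = K (reflect v w x i / reflect v w x j)" for i j
      using nz by (simp add: K_def reflect_def mult_ac)
  qed
  moreover have "F v w {1..n} x = F v w {1..n} (reflect v w x)"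
    using D_eq_0[OF _ mult_independent] by (simp add: D_def)
  ultimately show ?thesis by simp
qed

section \<open>Continuity of both sides in all parameters\<close>

lemma tendsto_theta_fact:
  assumes "(P \<longlongrightarrow> p) G" "(Q \<longlongrightarrow> q) G" "(a \<longlongrightarrow> b) G" "norm p < 1" "q \<noteq> 0" "b \<noteq> 0"
  shows "((\<lambda>s. theta_fact (Q s) (P s) (a s) r) \<longlongrightarrow> theta_fact q p b r) G"
  unfolding theta_fact_def using assms by (intro tendsto_prod tendsto_theta tendsto_intros) auto

lemma tendsto_theta_facts_quotient:
  assumes "(P \<longlongrightarrow> p) G" "(Q \<longlongrightarrow> q) G" "(T \<longlongrightarrow> t) G" "(V \<longlongrightarrow> v) G" "(W \<longlongrightarrow> w) G"
    and "norm p < 1" "q \<noteq> 0" "t \<noteq> 0" "v \<noteq> 0" "w \<noteq> 0" "theta_facts q p [q * v / t, q * w / t] r \<noteq> 0"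
  shows "((\<lambda>s. theta_facts (Q s) (P s) [V s, W s] r / theta_facts (Q s) (P s) [Q s * V s / T s, Q s * W s / T s] r)
    \<longlongrightarrow> theta_facts q p [v, w] r / theta_facts q p [q * v / t, q * w / t] r) G"
  using assms unfolding theta_facts_def by (auto intro!: tendsto_intros tendsto_theta_fact)

lemma tendsto_lhs:
  assumes lim: "(P \<longlongrightarrow> p) G" "(Q \<longlongrightarrow> q) G" "(T \<longlongrightarrow> t) G" "(V \<longlongrightarrow> v) G" "(W \<longlongrightarrow> w) G" "\<And>i. ((\<lambda>s. X s i) \<longlongrightarrow> x i) G"
    and nz: "norm p < 1" "q \<noteq> 0" "t \<noteq> 0" "v \<noteq> 0" "w \<noteq> 0" "\<And>i. i \<in> {1..n} \<Longrightarrow> x i \<noteq> 0"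
    and wd: "\<And>r. r \<le> n \<Longrightarrow> theta_facts q p [q * v / t, q * w / t] r \<noteq> 0"
      "\<And>r I i. r \<le> n \<Longrightarrow> I \<subseteq> {1..n} \<Longrightarrow> card I = r \<Longrightarrow> i \<in> I \<Longrightarrow>
         theta p (v * x i / (q * w)) \<noteq> 0 \<and> theta p (q powi (- int r) * x i / w) \<noteq> 0"
      "\<And>r I j. r \<le> n \<Longrightarrow> I \<subseteq> {1..n} \<Longrightarrow> card I = r \<Longrightarrow> j \<in> {1..n} - I \<Longrightarrow>
         theta p (x j / t) \<noteq> 0 \<and> theta p (q powi (- int r) * x j / (q * w)) \<noteq> 0"
      "\<And>r I i j. r \<le> n \<Longrightarrow> I \<subseteq> {1..n} \<Longrightarrow> card I = r \<Longrightarrow> i \<in> I \<Longrightarrow> j \<in> {1..n} - I \<Longrightarrow>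
         theta p (x i / x j) \<noteq> 0 \<and> theta p (t * x i / x j) \<noteq> 0"
  shows "((\<lambda>s. lhs_sum (P s) (V s) (W s) (Q s) (T s) n (X s)) \<longlongrightarrow> lhs_sum p v w q t n x) G"
  unfolding lhs_sum_def
proof (intro tendsto_sum tendsto_mult tendsto_prod tendsto_theta_facts_quotient)
  fix r I i assume *: "r \<in> {0..n}" "I \<in> {I. I \<subseteq> {1..n} \<and> card I = r}" "i \<in> I"
  then have i: "r \<le> n" "I \<subseteq> {1..n}" "card I = r" "x i \<noteq> 0" using nz(6) by auto
  show "((\<lambda>s. Q s * theta (P s) (V s * X s i / (T s * W s)) * theta (P s) (T s * Q s powi (- int r) * X s i / (Q s * W s)) /
            (T s * theta (P s) (V s * X s i / (Q s * W s)) * theta (P s) (Q s powi (- int r) * X s i / W s))) \<longlongrightarrow>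
        q * theta p (v * x i / (t * w)) * theta p (t * q powi (- int r) * x i / (q * w)) /
            (t * theta p (v * x i / (q * w)) * theta p (q powi (- int r) * x i / w))) G"
    using wd(2)[OF i(1-3) *(3)] i nz
    by (intro tendsto_intros tendsto_theta tendsto_power_int lim) auto
next
  fix r I j assume *: "r \<in> {0..n}" "I \<in> {I. I \<subseteq> {1..n} \<and> card I = r}" "j \<in> {1..n} - I"
  then have i: "r \<le> n" "I \<subseteq> {1..n}" "card I = r" "x j \<noteq> 0" using nz(6) by auto
  show "((\<lambda>s. theta (P s) (X s j / Q s) * theta (P s) (Q s powi (- int r) * X s j / (T s * W s)) /
            (theta (P s) (X s j / T s) * theta (P s) (Q s powi (- int r) * X s j / (Q s * W s)))) \<longlongrightarrow>
        theta p (x j / q) * theta p (q powi (- int r) * x j / (t * w)) /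
            (theta p (x j / t) * theta p (q powi (- int r) * x j / (q * w)))) G"
    using wd(3)[OF i(1-3) *(3)] i nz
    by (intro tendsto_intros tendsto_theta tendsto_power_int lim) auto
next
  fix r I i j assume *: "r \<in> {0..n}" "I \<in> {I. I \<subseteq> {1..n} \<and> card I = r}" "i \<in> I" "j \<in> {1..n} - I"
  then have i: "r \<le> n" "I \<subseteq> {1..n}" "card I = r" "x i \<noteq> 0" "x j \<noteq> 0" using nz(6) by auto
  show "((\<lambda>s. theta (P s) (T s * X s i / (Q s * X s j)) * theta (P s) (Q s * X s i / X s j) /
            (theta (P s) (X s i / X s j) * theta (P s) (T s * X s i / X s j))) \<longlongrightarrow>
        theta p (t * x i / (q * x j)) * theta p (q * x i / x j) /
            (theta p (x i / x j) * theta p (t * x i / x j))) G"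
    using wd(4)[OF i(1-3) *(3,4)] i nz
    by (intro tendsto_intros tendsto_theta tendsto_power_int lim) auto
qed (use lim nz wd(1) in auto)

lemma tendsto_rhs:
  assumes lim: "(P \<longlongrightarrow> p) G" "(Q \<longlongrightarrow> q) G" "(T \<longlongrightarrow> t) G" "(V \<longlongrightarrow> v) G" "(W \<longlongrightarrow> w) G" "\<And>i. ((\<lambda>s. X s i) \<longlongrightarrow> x i) G"
    and nz: "norm p < 1" "q \<noteq> 0" "t \<noteq> 0" "v \<noteq> 0" "w \<noteq> 0" "\<And>i. i \<in> {1..n} \<Longrightarrow> x i \<noteq> 0"
    and wd: "\<And>r. r \<le> n \<Longrightarrow> theta_facts q p [q * v / t, q * w / t] r \<noteq> 0"
      "\<And>r I i. r \<le> n \<Longrightarrow> I \<subseteq> {1..n} \<Longrightarrow> card I = r \<Longrightarrow> i \<in> I \<Longrightarrow>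
         theta p (x i / t) \<noteq> 0 \<and> theta p (q ^ r * v * x i / (t * q)) \<noteq> 0"
      "\<And>r I j. r \<le> n \<Longrightarrow> I \<subseteq> {1..n} \<Longrightarrow> card I = r \<Longrightarrow> j \<in> {1..n} - I \<Longrightarrow>
         theta p (v * x j / (q * w)) \<noteq> 0 \<and> theta p (q ^ r * v * x j / t) \<noteq> 0"
      "\<And>r I i j. r \<le> n \<Longrightarrow> I \<subseteq> {1..n} \<Longrightarrow> card I = r \<Longrightarrow> i \<in> I \<Longrightarrow> j \<in> {1..n} - I \<Longrightarrow>
         theta p (x j / x i) \<noteq> 0 \<and> theta p (t * x j / x i) \<noteq> 0"
  shows "((\<lambda>s. rhs_sum (P s) (V s) (W s) (Q s) (T s) n (X s)) \<longlongrightarrow> rhs_sum p v w q t n x) G"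
  unfolding rhs_sum_def
proof (intro tendsto_sum tendsto_mult tendsto_prod tendsto_theta_facts_quotient)
  fix r I i assume *: "r \<in> {0..n}" "I \<in> {I. I \<subseteq> {1..n} \<and> card I = r}" "i \<in> I"
  then have i: "r \<le> n" "I \<subseteq> {1..n}" "card I = r" "x i \<noteq> 0" using nz(6) by auto
  show "((\<lambda>s. Q s * theta (P s) (X s i / Q s) * theta (P s) (Q s ^ r * V s * X s i / T s ^ 2) /
            (T s * theta (P s) (X s i / T s) * theta (P s) (Q s ^ r * V s * X s i / (T s * Q s)))) \<longlongrightarrow>
        q * theta p (x i / q) * theta p (q ^ r * v * x i / t ^ 2) /
            (t * theta p (x i / t) * theta p (q ^ r * v * x i / (t * q)))) G"
    using wd(2)[OF i(1-3) *(3)] i nz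
    by (intro tendsto_intros tendsto_theta lim) auto
next
  fix r I j assume *: "r \<in> {0..n}" "I \<in> {I. I \<subseteq> {1..n} \<and> card I = r}" "j \<in> {1..n} - I"
  then have i: "r \<le> n" "I \<subseteq> {1..n}" "card I = r" "x j \<noteq> 0" using nz(6) by auto
  show "((\<lambda>s. theta (P s) (V s * X s j / (T s * W s)) * theta (P s) (Q s ^ r * V s * X s j / Q s) /
            (theta (P s) (V s * X s j / (Q s * W s)) * theta (P s) (Q s ^ r * V s * X s j / T s))) \<longlongrightarrow>
        theta p (v * x j / (t * w)) * theta p (q ^ r * v * x j / q) /
            (theta p (v * x j / (q * w)) * theta p (q ^ r * v * x j / t))) G"
    using wd(3)[OF i(1-3) *(3)] i nz
    by (intro tendsto_intros tendsto_theta lim) auto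
next
  fix r I i j assume *: "r \<in> {0..n}" "I \<in> {I. I \<subseteq> {1..n} \<and> card I = r}" "i \<in> I" "j \<in> {1..n} - I"
  then have i: "r \<le> n" "I \<subseteq> {1..n}" "card I = r" "x i \<noteq> 0" "x j \<noteq> 0" using nz(6) by auto
  show "((\<lambda>s. theta (P s) (T s * X s j / (Q s * X s i)) * theta (P s) (Q s * X s j / X s i) /
            (theta (P s) (X s j / X s i) * theta (P s) (T s * X s j / X s i))) \<longlongrightarrow>
        theta p (t * x j / (q * x i)) * theta p (q * x j / x i) /
            (theta p (x j / x i) * theta p (t * x j / x i))) G"
    using wd(4)[OF i(1-3) *(3,4)] i nz
    by (intro tendsto_intros tendsto_theta lim) auto
qed (use lim nz wd(1) in auto)

lemma exists_mult_independent_parameters: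
  fixes p v w q t :: complex and x :: "nat \<Rightarrow> complex"
  assumes p: "norm p < 1" "p \<noteq> 0" and nz: "v \<noteq> 0" "w \<noteq> 0" "q \<noteq> 0" "t \<noteq> 0" "\<And>i. i \<in> {1..n} \<Longrightarrow> x i \<noteq> 0"
    and \<delta>: "\<delta> > 0"
  shows "\<exists>\<epsilon>. norm \<epsilon> < \<delta> \<and> theta_params p (q * exp (\<epsilon> ^ 1)) (t * exp (\<epsilon> ^ 2)) \<and>
    theta_params.mult_independent p (q * exp (\<epsilon> ^ 1)) (t * exp (\<epsilon> ^ 2)) (v * exp (\<epsilon> ^ 4)) (w * exp (\<epsilon> ^ 3)) {1..n} (\<lambda>i. x i * exp (\<epsilon> ^ (i + 4)))"
proof -
  \<comment> \<open>The list is q, t, w, v, x_1, ..., x_n, and entry i is multiplied by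
    exp(\<epsilon>^(i+1)). Hence w gets the third power, v the fourth, and x_i, at position i + 3,
    the power i + 4.\<close>
  define u where "u i = (if i = 0 then q else if i = 1 then t else if i = 2 then w else if i = 3 then v else x (i - 3))" for i
  have u: "u i \<noteq> 0" if "i < Suc (Suc (Suc (Suc n)))" for i
  proof (cases "i > 3")
    case True
    then have "i - 3 \<in> {1..n}" using that by auto
    then show ?thesis using True nz(5) by (simp add: u_def)
  qed (use nz(1-4) in \<open>auto simp: u_def\<close>)
  obtain \<epsilon> where \<epsilon>: "norm \<epsilon> < \<delta>"
    "\<forall>k m. (\<Prod>i<Suc (Suc (Suc (Suc n))). (u i * exp (\<epsilon> ^ Suc i)) powi k i) = p powi m \<longrightarrow> (\<forall>i<Suc (Suc (Suc (Suc n))). k i = 0)"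
    using exists_independent_perturbation[of p "Suc (Suc (Suc (Suc n)))" u, OF p(2) u \<delta>] by blast
  interpret theta_params p "q * exp (\<epsilon> ^ 1)" "t * exp (\<epsilon> ^ 2)"
    by unfold_locales (use p nz in auto)
  have "mult_independent (v * exp (\<epsilon> ^ 4)) (w * exp (\<epsilon> ^ 3)) {1..n} (\<lambda>i. x i * exp (\<epsilon> ^ (i + 4)))"
    unfolding mult_independent_def
  proof (intro conjI allI impI)
    fix \<alpha> \<beta> \<gamma> \<delta>' k m
    assume *: "(q * exp (\<epsilon> ^ 1)) powi \<alpha> * (t * exp (\<epsilon> ^ 2)) powi \<beta> * (w * exp (\<epsilon> ^ 3)) powi \<gamma> * (v * exp (\<epsilon> ^ 4)) powi \<delta>' *
       (\<Prod>i\<in>{1..n}. (x i * exp (\<epsilon> ^ (i + 4))) powi k i) = p powi m"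
    define l where "l i = (if i = 0 then \<alpha> else if i = 1 then \<beta> else if i = 2 then \<gamma> else if i = 3 then \<delta>' else k (i - 3))" for i
    have "(\<Prod>i<Suc (Suc (Suc (Suc n))). (u i * exp (\<epsilon> ^ Suc i)) powi l i) = p powi m"
      unfolding prod.lessThan_Suc_shift *[symmetric]
      by (simp add: u_def l_def numeral_eq_Suc mult.assoc prod.atLeast1_atMost_eq)
    then have l: "\<forall>i<Suc (Suc (Suc (Suc n))). l i = 0" using \<epsilon>(2) by blast
    have "l 0 = 0" "l 1 = 0" "l 2 = 0" "l 3 = 0" using l by auto
    then show "\<alpha> = 0" "\<beta> = 0" "\<gamma> = 0" "\<delta>' = 0" by (simp_all add: l_def)
    show "\<forall>i\<in>{1..n}. k i = 0"
    proof
      fix i assume "i \<in> {1..n}"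
      then have "l (i + 3) = 0" using l by auto
      then show "k i = 0" using \<open>i \<in> {1..n}\<close> by (simp add: l_def)
    qed
  qed (use nz in auto)
  then show ?thesis using \<epsilon>(1) theta_params_axioms by blast
qed

text \<open>Well-definedness is expressed by nonzero denominators for those ranks and index sets
  that occur in the sums. This is exactly what continuity at the given parameters requires.\<close>

theorem theorem1p1:
  fixes p v w q t :: complex and n :: nat and x :: "nat \<Rightarrow> complex"
  assumes p: "norm p < 1"
    and nonzero: "v \<noteq> 0" "w \<noteq> 0" "q \<noteq> 0" "t \<noteq> 0" "\<And>i. i \<in> {1..n} \<Longrightarrow> x i \<noteq> 0"
    and well_defined_both:
      "\<And>r. r \<le> n \<Longrightarrow> theta_facts q p [q * v / t, q * w / t] r \<noteq> 0"
    and well_defined_lhs: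
      "\<And>r I i. r \<le> n \<Longrightarrow> I \<subseteq> {1..n} \<Longrightarrow> card I = r \<Longrightarrow> i \<in> I \<Longrightarrow>
         theta p (v * x i / (q * w)) \<noteq> 0 \<and> theta p (q powi (- int r) * x i / w) \<noteq> 0"
      "\<And>r I j. r \<le> n \<Longrightarrow> I \<subseteq> {1..n} \<Longrightarrow> card I = r \<Longrightarrow> j \<in> {1..n} - I \<Longrightarrow>
         theta p (x j / t) \<noteq> 0 \<and> theta p (q powi (- int r) * x j / (q * w)) \<noteq> 0"
      "\<And>r I i j. r \<le> n \<Longrightarrow> I \<subseteq> {1..n} \<Longrightarrow> card I = r \<Longrightarrow> i \<in> I \<Longrightarrow> j \<in> {1..n} - I \<Longrightarrow>
         theta p (x i / x j) \<noteq> 0 \<and> theta p (t * x i / x j) \<noteq> 0"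
    and well_defined_rhs:
      "\<And>r I i. r \<le> n \<Longrightarrow> I \<subseteq> {1..n} \<Longrightarrow> card I = r \<Longrightarrow> i \<in> I \<Longrightarrow>
         theta p (x i / t) \<noteq> 0 \<and> theta p (q ^ r * v * x i / (t * q)) \<noteq> 0"
      "\<And>r I j. r \<le> n \<Longrightarrow> I \<subseteq> {1..n} \<Longrightarrow> card I = r \<Longrightarrow> j \<in> {1..n} - I \<Longrightarrow>
         theta p (v * x j / (q * w)) \<noteq> 0 \<and> theta p (q ^ r * v * x j / t) \<noteq> 0"
      "\<And>r I i j. r \<le> n \<Longrightarrow> I \<subseteq> {1..n} \<Longrightarrow> card I = r \<Longrightarrow> i \<in> I \<Longrightarrow> j \<in> {1..n} - I \<Longrightarrow>
         theta p (x j / x i) \<noteq> 0 \<and> theta p (t * x j / x i) \<noteq> 0"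
  shows
    "(\<Sum>r=0..n. theta_facts q p [v, w] r / theta_facts q p [q * v / t, q * w / t] r *
        (\<Sum>I | I \<subseteq> {1..n} \<and> card I = r.
          (\<Prod>i\<in>I. q * theta p (v * x i / (t * w)) * theta p (t * q powi (- int r) * x i / (q * w)) /
                  (t * theta p (v * x i / (q * w)) * theta p (q powi (- int r) * x i / w))) *
          (\<Prod>j\<in>{1..n} - I. theta p (x j / q) * theta p (q powi (- int r) * x j / (t * w)) /
                  (theta p (x j / t) * theta p (q powi (- int r) * x j / (q * w)))) *
          (\<Prod>i\<in>I. \<Prod>j\<in>{1..n} - I. theta p (t * x i / (q * x j)) * theta p (q * x i / x j) /
                  (theta p (x i / x j) * theta p (t * x i / x j)))))
     =
     (\<Sum>r=0..n. theta_facts q p [v, w] r / theta_facts q p [q * v / t, q * w / t] r *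
        (\<Sum>I | I \<subseteq> {1..n} \<and> card I = r.
          (\<Prod>i\<in>I. q * theta p (x i / q) * theta p (q ^ r * v * x i / t ^ 2) /
                  (t * theta p (x i / t) * theta p (q ^ r * v * x i / (t * q)))) *
          (\<Prod>j\<in>{1..n} - I. theta p (v * x j / (t * w)) * theta p (q ^ r * v * x j / q) /
                  (theta p (v * x j / (q * w)) * theta p (q ^ r * v * x j / t))) *
          (\<Prod>i\<in>I. \<Prod>j\<in>{1..n} - I. theta p (t * x j / (q * x i)) * theta p (q * x j / x i) /
                  (theta p (x j / x i) * theta p (t * x j / x i)))))"
proof -
  \<comment> \<open>Only the nome 0 has to be replaced; the shift by 2 keeps the first term below 1
    in norm.\<close>
  define P :: "nat \<Rightarrow> complex" where "P N = (if p = 0 then of_real (inverse (real (N + 2))) else p)" for N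
  have P: "norm (P N) < 1" "P N \<noteq> 0" for N
  proof -
    have "norm (of_real (inverse (real (N + 2))) :: complex) < 1"
      unfolding norm_of_real by (simp add: field_simps)
    moreover have "(of_real (inverse (real (N + 2))) :: complex) \<noteq> 0"
      unfolding of_real_eq_0_iff by simp
    ultimately show "norm (P N) < 1" "P N \<noteq> 0"
      using p unfolding P_def by auto
  qed
  have "\<exists>\<epsilon>. \<forall>N. norm (\<epsilon> N) < inverse (real (Suc N)) \<and> theta_params (P N) (q * exp (\<epsilon> N ^ 1)) (t * exp (\<epsilon> N ^ 2)) \<and>
    theta_params.mult_independent (P N) (q * exp (\<epsilon> N ^ 1)) (t * exp (\<epsilon> N ^ 2)) (v * exp (\<epsilon> N ^ 4)) (w * exp (\<epsilon> N ^ 3)) {1..n} (\<lambda>i. x i * exp (\<epsilon> N ^ (i + 4)))"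
    by (intro choice allI exists_mult_independent_parameters P nonzero) simp_all
  then obtain \<epsilon> where \<epsilon>: "\<And>N. norm (\<epsilon> N) < inverse (real (Suc N))"
    "\<And>N. theta_params (P N) (q * exp (\<epsilon> N ^ 1)) (t * exp (\<epsilon> N ^ 2))"
    "\<And>N. theta_params.mult_independent (P N) (q * exp (\<epsilon> N ^ 1)) (t * exp (\<epsilon> N ^ 2)) (v * exp (\<epsilon> N ^ 4)) (w * exp (\<epsilon> N ^ 3)) {1..n} (\<lambda>i. x i * exp (\<epsilon> N ^ (i + 4)))"
    by blast
  have P_lim: "P \<longlonglongrightarrow> p"
  proof (cases "p = 0")
    case True
    have "(\<lambda>N. complex_of_real (inverse (real (N + 2)))) \<longlonglongrightarrow> of_real 0"
      by (intro tendsto_of_real) (use LIMSEQ_ignore_initial_segment[OF lim_inverse_n, of 2] in simp)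
    then show ?thesis using True by (simp add: P_def[abs_def])
  qed (simp add: P_def[abs_def])
  have "\<epsilon> \<longlonglongrightarrow> 0"
    by (rule Lim_null_comparison[OF _ LIMSEQ_inverse_real_of_nat]) (use \<epsilon>(1) less_imp_le in \<open>auto intro!: always_eventually\<close>)
  then have "(\<lambda>N. c * exp (\<epsilon> N ^ k)) \<longlonglongrightarrow> c * exp (0 ^ k)" for c :: complex and k
    by (intro tendsto_intros)
  \<comment> \<open>A positive power is required: 0^0 = 1 would give the limit c exp(1).\<close>
  then have \<epsilon>_lim: "(\<lambda>N. c * exp (\<epsilon> N ^ k)) \<longlonglongrightarrow> c" if "k > 0" for c :: complex and k
    using that by (metis exp_zero mult.right_neutral zero_power)
  have lhs_lim: "(\<lambda>N. lhs_sum (P N) (v * exp (\<epsilon> N ^ 4)) (w * exp (\<epsilon> N ^ 3)) (q * exp (\<epsilon> N ^ 1)) (t * exp (\<epsilon> N ^ 2)) n (\<lambda>i. x i * exp (\<epsilon> N ^ (i + 4))))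
      \<longlonglongrightarrow> lhs_sum p v w q t n x"
    by (rule tendsto_lhs[OF P_lim \<epsilon>_lim \<epsilon>_lim \<epsilon>_lim \<epsilon>_lim \<epsilon>_lim p nonzero(3,4,1,2,5) well_defined_both well_defined_lhs]) auto
  have rhs_lim: "(\<lambda>N. rhs_sum (P N) (v * exp (\<epsilon> N ^ 4)) (w * exp (\<epsilon> N ^ 3)) (q * exp (\<epsilon> N ^ 1)) (t * exp (\<epsilon> N ^ 2)) n (\<lambda>i. x i * exp (\<epsilon> N ^ (i + 4))))
      \<longlonglongrightarrow> rhs_sum p v w q t n x"
    by (rule tendsto_rhs[OF P_lim \<epsilon>_lim \<epsilon>_lim \<epsilon>_lim \<epsilon>_lim \<epsilon>_lim p nonzero(3,4,1,2,5) well_defined_both well_defined_rhs]) auto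
  \<comment> \<open>The approximating sequences coincide term by term, by the independent
    case.\<close>
  have "lhs_sum p v w q t n x = rhs_sum p v w q t n x"
    using lhs_lim rhs_lim unfolding theta_params.mult_independent_lhs_eq_rhs[OF \<epsilon>(2,3)] by (rule LIMSEQ_unique)
  then show ?thesis
    unfolding lhs_sum_def rhs_sum_def .
qed

end
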